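(* For any analytic self-map $\phi\colon\mathbb{D}\to\mathbb{D}$, the following assertions are equivalent: 1) there is $w\in H^2$, $w\not\equiv0$, such that $M_wC_\phi$ is a Hilbert–Schmidt operator on $H^2$; 2) there is $\tilde w\in H^\infty$, $\tilde w\not\equiv0$, such that $M_{\tilde w}C_\phi\in S_p(H^2)$ for all $p>0$; 3) there exist $p<\infty$ and $w_p\in H^\infty$, $w_p\not\equiv0$, such that $M_{w_p}C_\phi\in S_p(H^2)$; 4) $\displaystyle\int_{\mathbb{T}}\log\frac{1}{1-|\phi^\ast|}\,dm<\infty$.
   Context: $\mathbb{D}$ is the open unit disk, $\mathbb{T}=\partial\mathbb{D}$, $m$ the normalized Lebesgue measure on $\mathbb{T}$, $H^2$ the Hardy space, $H^\infty$ the bounded analytic functions on $\mathbb{D}$. $M_wC_\phi$ is the operator $f\mapsto w\,(f\circ\phi)$. $\phi^\ast$ is the radial limit function of $\phi$ (defined $m$-a.e.), the integrand in 4) being $+\infty$ where $|\phi^\ast|=1$. $S_p(H^2)$, $p>0$, is the Schatten class of compact operators $T$ on $H^2$ with $\sum_n s_n(T)^p<\infty$. *)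

theory Defs
  imports "HOL-Analysis.Analysis"
begin

abbreviation unit_disc :: "complex set" where
  "unit_disc \<equiv> ball 0 1"

definition taylor_coeff :: "(complex \<Rightarrow> complex) \<Rightarrow> nat \<Rightarrow> complex" where
  "taylor_coeff f n = (deriv ^^ n) f 0 / of_nat (fact n)"

definition H2 :: "(complex \<Rightarrow> complex) set" where
  "H2 = {f. f holomorphic_on unit_disc \<and> summable (\<lambda>n. (cmod (taylor_coeff f n))\<^sup>2)}"

definition h2norm :: "(complex \<Rightarrow> complex) \<Rightarrow> real" where
  "h2norm f = sqrt (\<Sum>n. (cmod (taylor_coeff f n))\<^sup>2)"

definition Hinf :: "(complex \<Rightarrow> complex) set" where
  "Hinf = {f. f holomorphic_on unit_disc \<and> bounded (f ` unit_disc)}"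

definition wcomp :: "(complex \<Rightarrow> complex) \<Rightarrow> (complex \<Rightarrow> complex)
    \<Rightarrow> (complex \<Rightarrow> complex) \<Rightarrow> (complex \<Rightarrow> complex)" where
  "wcomp w \<phi> = (\<lambda>f z. w z * f (\<phi> z))"

text \<open>Linear operator from H^2 into H^2 (functions identified by their values on the disk).\<close>
definition H2_linear_op :: "((complex \<Rightarrow> complex) \<Rightarrow> (complex \<Rightarrow> complex)) \<Rightarrow> bool" where
  "H2_linear_op T \<longleftrightarrow> (\<forall>f\<in>H2. T f \<in> H2) \<and>
     (\<forall>f\<in>H2. \<forall>g\<in>H2. \<forall>a b. \<forall>z\<in>unit_disc.
        T (\<lambda>x. a * f x + b * g x) z = a * T f z + b * T g z)"

definition H2_bounded_op :: "((complex \<Rightarrow> complex) \<Rightarrow> (complex \<Rightarrow> complex)) \<Rightarrow> bool" where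
  "H2_bounded_op T \<longleftrightarrow> H2_linear_op T \<and>
     (\<exists>C. \<forall>f\<in>H2. h2norm (T f) \<le> C * h2norm f)"

definition H2_rank_le :: "((complex \<Rightarrow> complex) \<Rightarrow> (complex \<Rightarrow> complex)) \<Rightarrow> nat \<Rightarrow> bool" where
  "H2_rank_le R n \<longleftrightarrow> H2_linear_op R \<and>
     (\<exists>g :: nat \<Rightarrow> complex \<Rightarrow> complex. \<forall>f\<in>H2. \<exists>c :: nat \<Rightarrow> complex.
        \<forall>z\<in>unit_disc. R f z = (\<Sum>i<n. c i * g i z))"

text \<open>n-th singular number (approximation number), n = 0,1,2,...:
  s_n(T) = inf { ||T - R|| : rank R \<le> n }.\<close>
definition sing_num :: "((complex \<Rightarrow> complex) \<Rightarrow> (complex \<Rightarrow> complex)) \<Rightarrow> nat \<Rightarrow> real" where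
  "sing_num T n = Inf {C. C \<ge> 0 \<and> (\<exists>R. H2_rank_le R n \<and>
      (\<forall>f\<in>H2. h2norm (\<lambda>z. T f z - R f z) \<le> C * h2norm f))}"

definition schatten :: "real \<Rightarrow> ((complex \<Rightarrow> complex) \<Rightarrow> (complex \<Rightarrow> complex)) \<Rightarrow> bool" where
  "schatten p T \<longleftrightarrow> H2_bounded_op T \<and> summable (\<lambda>n. sing_num T n powr p)"

text \<open>Hilbert--Schmidt operators on H^2 (orthonormal basis z^n).\<close>
definition hilbert_schmidt :: "((complex \<Rightarrow> complex) \<Rightarrow> (complex \<Rightarrow> complex)) \<Rightarrow> bool" where
  "hilbert_schmidt T \<longleftrightarrow> H2_bounded_op T \<and> summable (\<lambda>n. (h2norm (T (\<lambda>z. z ^ n)))\<^sup>2)"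

definition radial_limit :: "(complex \<Rightarrow> complex) \<Rightarrow> real \<Rightarrow> complex" where
  "radial_limit \<phi> t = Lim (at_left 1) (\<lambda>r::real. \<phi> (of_real r * cis t))"

definition log_integral :: "(complex \<Rightarrow> complex) \<Rightarrow> ennreal" where
  "log_integral \<phi> = ennreal (1 / (2 * pi)) *
     (\<integral>\<^sup>+ t \<in> {0..2*pi}. (if cmod (radial_limit \<phi> t) < 1
         then ennreal (ln (1 / (1 - cmod (radial_limit \<phi> t)))) else \<infinity>) \<partial>lborel)"

end

theory Submission
  imports Defs "HOL-Complex_Analysis.Complex_Analysis"
begin

text \<open>
  Since \<open>log (1 / (1 - x\<^sup>2)) = \<Sum> x\<^sup>2\<^sup>n / n\<close> and, by Fatou's theorem on radial limits, the boundary integral of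
  \<open>|\<phi>|\<^sup>2\<^sup>n\<close> is \<open>\<parallel>\<phi>\<^sup>n\<parallel>\<^sup>2\<close>, finiteness of the logarithmic integral means \<open>\<Sum> \<parallel>\<phi>\<^sup>n\<parallel>\<^sup>2 / n < \<infinity>\<close>.

  If this holds, it still holds with coefficients \<open>b\<^sub>n / n\<close> for some \<open>b\<^sub>n \<rightarrow> \<infinity>\<close>. The exponential of minus the
  Schwarz integral of \<open>\<Sum> (b\<^sub>n / n) |\<phi>|\<^sup>2\<^sup>n\<close> over circles of radius \<open>r < 1\<close>, followed by a normal families
  argument, produces \<open>w\<close> with \<open>w 0 \<noteq> 0\<close> and \<open>|w| \<le> C\<^sub>K (1 - |\<phi>|\<^sup>2)\<^sup>K\<close> for every \<open>K\<close>. Truncating Taylor series then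
  shows that the singular numbers of \<open>f \<mapsto> w (f \<circ> \<phi>)\<close> decay faster than any power.

  Conversely, either operator condition forces \<open>\<parallel>w \<phi>\<^sup>n\<parallel>\<^sup>2\<close> to decay geometrically along \<open>n = 4\<^sup>j\<close>: an operator of rank
  \<open>N\<close> has squared Hilbert--Schmidt norm at most \<open>N\<close> times its squared norm. Hence the circle means of
  \<open>|w|\<^sup>2 (1 - |\<phi>|\<^sup>2)\<^sup>-\<^sup>\<epsilon>\<close> are bounded for some \<open>\<epsilon> > 0\<close>, and Jensen's inequality for \<open>w\<close> bounds the means of
  \<open>log (1 / (1 - |\<phi>|))\<close>.
\<close>

subsection \<open>Means over the unit circle and the Poisson formula\<close>

text \<open>With coefficients 1 / n the weight would only satisfy |w| <= 1 - |phi|^2, a single power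
  of the defect. Coefficients that eventually exceed K / n for every K let one w beat all powers, so
  that it serves every p > 0 at once. Circles of radius r < 1 keep the data of the Schwarz integral
  continuous. The lower bound on its real part survives because |phi^n|^2 lies below its own Poisson
  averages, and its value at 0 is a circle mean, bounded by the squared H^2 norm uniformly in r. The
  indices 4^j come from testing an approximant of rank 2^j on 4^j monomials: per monomial the rank
  contributes 2^j / 4^j = 2^-j, and the approximation error contributes its square, which also
  decays geometrically. Two obstacles shape the rest. \<open>radial_limit\<close> is a
  \<open>Lim\<close> and says nothing until the limit is known to exist, so a maximal inequality has
  to come first. And w may vanish on the circles used, so Jensen's inequality is obtained without
  integrating log |w|. Singular numbers are approximation numbers here, so rank arguments take the
  place of spectral theory.\<close>

definition circ :: "real measure" where
  "circ = uniform_measure lborel {0..2*pi}"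

lemma sets_circ [simp, measurable_cong]: "sets circ = sets borel"
  by (simp add: circ_def)

lemma space_circ [simp]: "space circ = UNIV"
  by (simp add: circ_def)

lemma emeasure_circ_UNIV [simp]: "emeasure circ UNIV = 1"
  using pi_gt_zero by (simp add: circ_def divide_ennreal del: pi_gt_zero)

lemma measure_circ_UNIV [simp]: "measure circ UNIV = 1"
  by (simp add: measure_def)

interpretation circ: finite_measure circ
  by standard simp

lemma AE_circ_iff: "(AE t in circ. P t) \<longleftrightarrow> (AE t in lborel. t \<in> {0..2*pi} \<longrightarrow> P t)"
  unfolding circ_def using pi_gt_zero by (intro AE_uniform_measure) (auto simp: ennreal_eq_0_iff simp del: pi_gt_zero)

lemma AE_circ_mem: "AE t in circ. t \<in> {0..2*pi}"
  by (simp add: AE_circ_iff)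

lemma integrable_circ:
  fixes f :: "real \<Rightarrow> 'b::{banach,second_countable_topology}"
  assumes "continuous_on UNIV f"
  shows "integrable circ f"
proof -
  have "compact (f ` {0..2*pi})"
    by (intro compact_continuous_image continuous_on_subset[OF assms]) auto
  then obtain B where B: "\<And>t. t \<in> {0..2*pi} \<Longrightarrow> norm (f t) \<le> B"
    using compact_imp_bounded[THEN bounded_normE] by (metis imageI)
  show ?thesis
  proof (rule circ.integrable_const_bound)
    show "AE x in circ. norm (f x) \<le> B"
      by (rule eventually_mono[OF AE_circ_mem]) (rule B)
  qed (use borel_measurable_continuous_onI[OF assms] in simp)
qed

lemma integral_circ_eq:
  fixes f :: "real \<Rightarrow> 'b::euclidean_space"
  assumes "continuous_on UNIV f"
  shows "(LINT t|circ. f t) = (1/(2*pi)) *\<^sub>R integral {0..2*pi} f"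
proof -
  have c: "continuous_on {0..2*pi} f" using assms continuous_on_subset by blast
  have [measurable]: "f \<in> borel_measurable borel"
    by (rule borel_measurable_continuous_onI[OF assms])
  have e: "circ = density lborel (\<lambda>t. ennreal (indicator {0..2*pi} t / (2*pi)))"
    unfolding circ_def uniform_measure_def
    by (intro arg_cong2[where f=density] refl ext)
       (auto split: split_indicator simp flip: divide_ennreal ennreal_1)
  have "(LINT t|circ. f t) = (LINT t|lborel. (indicator {0..2*pi} t / (2*pi)) *\<^sub>R f t)"
    unfolding e by (rule integral_density) auto
  also have "\<dots> = (LINT t|lborel. (1/(2*pi)) *\<^sub>R (indicator {0..2*pi} t *\<^sub>R f t))"
    by simp
  also have "\<dots> = (1/(2*pi)) *\<^sub>R (LINT t:{0..2*pi}|lborel. f t)"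
    unfolding set_lebesgue_integral_def by (rule integral_scaleR_right)
  also have "\<dots> = (1/(2*pi)) *\<^sub>R integral {0..2*pi} f"
    using set_borel_integral_eq_integral(2)[OF borel_integrable_atLeastAtMost'[OF c]] by simp
  finally show ?thesis .
qed

lemma continuous_on_cis_comp:
  assumes "continuous_on (sphere 0 1) f"
  shows "continuous_on UNIV (\<lambda>t. f (cis t))"
  by (rule continuous_on_compose2[OF assms continuous_on_cis]) (auto intro: continuous_intros)

text \<open>On the unit circle dz = i z dt, so dividing by z leaves the angular mean. This is the
  bridge from means to Cauchy's formula.\<close>

lemma has_contour_integral_circ:
  assumes "continuous_on (sphere 0 1) f"
  shows "((\<lambda>z. f z / z) has_contour_integral (2 * of_real pi * \<i> * (LINT t|circ. f (cis t)))) (circlepath 0 1)"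
proof -
  have c: "continuous_on UNIV (\<lambda>t. f (cis t))"
    by (rule continuous_on_cis_comp[OF assms])
  have c': "continuous_on {0..2*pi} (\<lambda>t. f (cis t))"
    using c continuous_on_subset by blast
  have "((\<lambda>t. f (cis t)) has_integral (2 * of_real pi * (LINT t|circ. f (cis t)))) {0..2*pi}"
    using integrable_integral[OF integrable_continuous_real[OF c']] integral_circ_eq[OF c]
    by (simp add: scaleR_conv_of_real)
  then have "((\<lambda>t. \<i> * f (cis t)) has_integral (\<i> * (2 * of_real pi * (LINT t|circ. f (cis t))))) {0..2*pi}"
    by (rule has_integral_mult_right)
  then show ?thesis
    unfolding circlepath_def
    by (subst has_contour_integral_part_circlepath_iff) (auto simp: mult_ac)
qed

section \<open>The Poisson kernel and Poisson averages\<close>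

definition poisson :: "complex \<Rightarrow> complex \<Rightarrow> real" where
  "poisson z \<zeta> = (1 - (cmod z)\<^sup>2) / (cmod (\<zeta> - z))\<^sup>2"

lemma poisson_nonneg: "cmod z < 1 \<Longrightarrow> poisson z \<zeta> \<ge> 0"
  unfolding poisson_def by (auto intro!: divide_nonneg_nonneg simp: power_le_one)

lemma continuous_on_poisson: 
  assumes "cmod z < 1" shows "continuous_on (sphere 0 1) (poisson z)"
  unfolding poisson_def using assms by (intro continuous_intros) auto

text \<open>Cauchy's formula is applied to \<open>H\<close>, the product of g with (1 - |z|^2) / (1
  - cnj z * u). The extra factor equals 1 at u = z, and for |u| = 1 the identity |u - z|^2 u = (1 -
  cnj z * u) (u - z) turns the Cauchy kernel into the Poisson kernel.\<close>

theorem poisson_formula: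
  assumes g: "g holomorphic_on ball 0 R" and "R > 1" and z: "cmod z < 1"
  shows "(LINT t|circ. of_real (poisson z (cis t)) * g (cis t)) = g z"
proof -
  define H where "H = (\<lambda>\<zeta>. g \<zeta> * (1 - of_real ((cmod z)\<^sup>2)) / (1 - cnj z * \<zeta>))"
  have ne: "1 - cnj z * \<zeta> \<noteq> 0" if "cmod \<zeta> \<le> 1" for \<zeta>
  proof
    assume "1 - cnj z * \<zeta> = 0"
    then have "cnj z * \<zeta> = 1" by simp
    then have "cmod (cnj z * \<zeta>) = 1" by simp
    moreover have "cmod (cnj z * \<zeta>) \<le> cmod z * 1"
      using that by (simp add: norm_mult mult_left_le)
    ultimately show False using z by simp
  qed
  have "H holomorphic_on cball 0 1"
    unfolding H_def
    by (intro holomorphic_intros holomorphic_on_subset[OF g]) (use \<open>R > 1\<close> ne in auto)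
  then have 1: "((\<lambda>u. H u / (u - z)) has_contour_integral (2 * of_real pi * \<i> * H z)) (circlepath 0 1)"
    by (rule Cauchy_integral_circlepath_simple) (use z in auto)
  have 2: "((\<lambda>u. (of_real (poisson z u) * g u) / u) has_contour_integral
     (2 * of_real pi * \<i> * (LINT t|circ. of_real (poisson z (cis t)) * g (cis t)))) (circlepath 0 1)"
    using z \<open>R > 1\<close>
    by (intro has_contour_integral_circ continuous_intros continuous_on_poisson
          holomorphic_on_imp_continuous_on holomorphic_on_subset[OF g]) auto
  have eq: "H u / (u - z) = (of_real (poisson z u) * g u) / u" if "u \<in> path_image (circlepath 0 1)" for u
  proof -
    have u: "cmod u = 1" using that by simp
    then have "u \<noteq> 0" "u \<noteq> z" using z by auto
    have "u * cnj u = 1" using u by (simp add: complex_norm_square[symmetric])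
    then have "of_real ((cmod (u - z))\<^sup>2) * u = (1 - cnj z * u) * (u - z)"
      unfolding complex_norm_square by (simp add: algebra_simps)
    then show ?thesis
      using \<open>u \<noteq> 0\<close> \<open>u \<noteq> z\<close> ne[of u] u unfolding H_def poisson_def
      by (simp add: field_simps)
  qed
  have "2 * of_real pi * \<i> * (LINT t|circ. of_real (poisson z (cis t)) * g (cis t)) = 2 * of_real pi * \<i> * H z"
    using 1 2 eq by (metis (mono_tags, lifting) has_contour_integral_cong has_contour_integral_unique)
  then have "(LINT t|circ. of_real (poisson z (cis t)) * g (cis t)) = H z" by simp
  also have "H z = g z"
  proof -
    have "cnj z * z = of_real ((cmod z)\<^sup>2)" by (simp only: complex_norm_square mult.commute)
    then show ?thesis using ne[of z] z unfolding H_def by (simp del: of_real_power)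
  qed
  finally show ?thesis .
qed

lemma integral_poisson:
  assumes "cmod z < 1"
  shows "(LINT t|circ. poisson z (cis t)) = 1"
proof -
  have "(LINT t|circ. complex_of_real (poisson z (cis t)) * 1) = 1"
    by (rule poisson_formula[where R=2]) (use assms in auto)
  then show ?thesis
    by (simp add: integral_complex_of_real)
qed

lemma mean_value_circ:
  assumes g: "g holomorphic_on ball 0 R" and "R > 1"
  shows "(LINT t|circ. g (cis t)) = g 0"
  using poisson_formula[OF assms, of 0] by (simp add: poisson_def)

text \<open>Expand the Poisson average of the nonnegative function \<open>|g - g z|\<^sup>2\<close>.\<close>
lemma poisson_norm_square_le:
  assumes g: "g holomorphic_on ball 0 R" and "R > 1" and z: "cmod z < 1"
  shows "(cmod (g z))\<^sup>2 \<le> (LINT t|circ. poisson z (cis t) * (cmod (g (cis t)))\<^sup>2)"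
proof -
  have cg: "continuous_on (sphere 0 1) g"
    using \<open>R > 1\<close> by (intro holomorphic_on_imp_continuous_on holomorphic_on_subset[OF g]) auto
  note cp = continuous_on_poisson[OF z]
  have i1: "integrable circ (\<lambda>t. of_real (poisson z (cis t)) * g (cis t))"
    by (intro integrable_circ continuous_on_cis_comp continuous_intros cg cp)
  have i2: "integrable circ (\<lambda>t. poisson z (cis t) * (cmod (g (cis t)))\<^sup>2)"
    by (intro integrable_circ continuous_on_cis_comp continuous_intros cg cp)
  have i3: "integrable circ (\<lambda>t. poisson z (cis t))"
    by (intro integrable_circ continuous_on_cis_comp continuous_intros cg cp)
  have i4: "integrable circ (\<lambda>t. Re (cnj (g z) * (of_real (poisson z (cis t)) * g (cis t))))"
    using i1 by (intro integrable_Re integrable_mult_right) auto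
  have "0 \<le> (LINT t|circ. poisson z (cis t) * (cmod (g (cis t) - g z))\<^sup>2)"
    by (intro integral_nonneg_AE AE_I2 mult_nonneg_nonneg poisson_nonneg z) auto
  also have "(\<lambda>t. poisson z (cis t) * (cmod (g (cis t) - g z))\<^sup>2) =
     (\<lambda>t. poisson z (cis t) * (cmod (g (cis t)))\<^sup>2
        - 2 * Re (cnj (g z) * (of_real (poisson z (cis t)) * g (cis t)))
        + (cmod (g z))\<^sup>2 * poisson z (cis t))"
    by (rule ext, simp only: cmod_power2) (simp add: algebra_simps power2_eq_square)
  also have "(LINT t|circ. \<dots> t) = (LINT t|circ. poisson z (cis t) * (cmod (g (cis t)))\<^sup>2)
     - 2 * (LINT t|circ. Re (cnj (g z) * (of_real (poisson z (cis t)) * g (cis t))))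
     + (cmod (g z))\<^sup>2 * (LINT t|circ. poisson z (cis t))"
    by (simp only: Bochner_Integration.integral_add Bochner_Integration.integral_diff
        Bochner_Integration.integrable_diff integrable_mult_right integral_mult_right_zero i2 i3 i4)
  also have "(LINT t|circ. Re (cnj (g z) * (of_real (poisson z (cis t)) * g (cis t))))
      = Re (cnj (g z) * g z)"
    using i1 poisson_formula[OF assms] by (subst integral_Re) auto
  also have "cnj (g z) * g z = of_real ((cmod (g z))\<^sup>2)"
    by (simp only: complex_norm_square mult.commute)
  finally show ?thesis using integral_poisson[OF z] by simp
qed

subsection \<open>Taylor coefficients and circle means\<close>

lemma taylor_sums:
  assumes "f holomorphic_on unit_disc" "cmod z < 1"
  shows "(\<lambda>n. taylor_coeff f n * z ^ n) sums f z"
  using holomorphic_power_series[OF assms(1), of z] assms(2) by (simp add: taylor_coeff_def)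

lemma taylor_coeff_unique:
  assumes "\<And>z. z \<in> unit_disc \<Longrightarrow> (\<lambda>n. a n * z ^ n) sums f z"
  shows "taylor_coeff f n = a n"
proof -
  have "f has_fps_expansion Abs_fps a"
  proof (rule has_fps_expansionI)
    have "\<forall>\<^sub>F u in nhds 0. u \<in> unit_disc"
      by (rule eventually_nhds_in_open) auto
    then show "\<forall>\<^sub>F u in nhds 0. (\<lambda>n. fps_nth (Abs_fps a) n * u ^ n) sums f u"
      by eventually_elim (use assms in auto)
  qed
  from fps_nth_fps_expansion[OF this, of n] show ?thesis
    by (simp add: taylor_coeff_def)
qed

lemma taylor_coeff_cong:
  assumes "\<And>z. z \<in> unit_disc \<Longrightarrow> f z = g z"
  shows "taylor_coeff f n = taylor_coeff g n"
proof -
  have "\<forall>\<^sub>F u in nhds 0. f u = g u"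
    by (rule eventually_nhds_in_open[of unit_disc, THEN eventually_mono]) (use assms in auto)
  then show ?thesis unfolding taylor_coeff_def
    by (metis higher_deriv_cong_ev)
qed

lemma taylor_coeff_lincomb:
  assumes "f holomorphic_on unit_disc" "g holomorphic_on unit_disc"
  shows "taylor_coeff (\<lambda>z. a * f z + b * g z) n = a * taylor_coeff f n + b * taylor_coeff g n"
proof (rule taylor_coeff_unique)
  fix z :: complex assume "z \<in> unit_disc"
  then have z: "cmod z < 1" by simp
  show "(\<lambda>n. (a * taylor_coeff f n + b * taylor_coeff g n) * z ^ n) sums (a * f z + b * g z)"
    using sums_add[OF sums_mult[OF taylor_sums[OF assms(1) z], of a] sums_mult[OF taylor_sums[OF assms(2) z], of b]]
    by (simp add: algebra_simps)
qed

lemma taylor_coeff_diff: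
  assumes "f holomorphic_on unit_disc" "g holomorphic_on unit_disc"
  shows "taylor_coeff (\<lambda>z. f z - g z) n = taylor_coeff f n - taylor_coeff g n"
  using taylor_coeff_lincomb[OF assms, of 1 "-1" n] by simp

lemma taylor_coeff_sum:
  assumes "\<And>i. i \<in> I \<Longrightarrow> f i holomorphic_on unit_disc" "finite I"
  shows "taylor_coeff (\<lambda>z. \<Sum>i\<in>I. a i * f i z) n = (\<Sum>i\<in>I. a i * taylor_coeff (f i) n)"
proof (rule taylor_coeff_unique)
  fix z :: complex assume "z \<in> unit_disc"
  then have z: "cmod z < 1" by simp
  have "(\<lambda>n. \<Sum>i\<in>I. a i * (taylor_coeff (f i) n * z ^ n)) sums (\<Sum>i\<in>I. a i * f i z)"
    by (intro sums_sum sums_mult taylor_sums assms z)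
  then show "(\<lambda>n. (\<Sum>i\<in>I. a i * taylor_coeff (f i) n) * z ^ n) sums (\<Sum>i\<in>I. a i * f i z)"
    by (simp add: sum_distrib_right mult.assoc)
qed

lemma taylor_coeff_poly:
  "taylor_coeff (\<lambda>z. \<Sum>i<N. a i * z ^ i) n = (if n < N then a n else 0)"
proof (rule taylor_coeff_unique)
  fix z :: complex
  have "(\<lambda>n. if n \<in> {..<N} then a n * z ^ n else 0) sums (\<Sum>i\<in>{..<N}. a i * z ^ i)"
    by (rule sums_If_finite_set) simp
  also have "(\<lambda>n. if n \<in> {..<N} then a n * z ^ n else 0) = (\<lambda>n. (if n < N then a n else 0) * z ^ n)"
    by auto
  finally show "(\<lambda>n. (if n < N then a n else 0) * z ^ n) sums (\<Sum>i<N. a i * z ^ i)" .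
qed

lemma h2norm_poly:
  shows "(\<lambda>z. \<Sum>i<N. a i * z ^ i) \<in> H2" "(h2norm (\<lambda>z. \<Sum>i<N. a i * z ^ i))\<^sup>2 = (\<Sum>i<N. (cmod (a i))\<^sup>2)"
proof -
  have eq: "(\<lambda>n. (cmod (if n < N then a n else 0))\<^sup>2) = (\<lambda>n. if n \<in> {..<N} then (cmod (a n))\<^sup>2 else 0)"
    by auto
  have "(\<lambda>n. (cmod (if n < N then a n else 0))\<^sup>2) sums (\<Sum>n\<in>{..<N}. (cmod (a n))\<^sup>2)"
    unfolding eq by (rule sums_If_finite_set) simp
  then show "(\<lambda>z. \<Sum>i<N. a i * z ^ i) \<in> H2" "(h2norm (\<lambda>z. \<Sum>i<N. a i * z ^ i))\<^sup>2 = (\<Sum>i<N. (cmod (a i))\<^sup>2)"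
    unfolding H2_def h2norm_def
    by (auto intro!: holomorphic_intros simp: sums_iff sum_nonneg taylor_coeff_poly)
qed

lemma h2norm_nonneg: "f \<in> H2 \<Longrightarrow> h2norm f \<ge> 0"
  unfolding h2norm_def H2_def by (auto intro!: suminf_nonneg)

lemma h2norm_square:
  "f \<in> H2 \<Longrightarrow> (\<lambda>n. (cmod (taylor_coeff f n))\<^sup>2) sums (h2norm f)\<^sup>2"
  unfolding h2norm_def H2_def
  by (subst real_sqrt_pow2) (auto intro!: suminf_nonneg intro: summable_sums)

section \<open>Orthogonality on the circle and Parseval's identity\<close>

lemma integral_circ_cis_mult_cnj:
  "(LINT t|circ. cis t ^ m * cnj (cis t ^ n)) = (if m = n then 1 else 0)"
proof -
  have *: "(LINT t|circ. cis t ^ k) = 0" if "k > 0" for k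
    using mean_value_circ[of "\<lambda>z. z ^ k" 2] that by (simp add: holomorphic_on_power)
  have one: "cis t * cnj (cis t) = 1" for t
    by (simp flip: complex_norm_square)
  consider "m = n" | "m > n" | "m < n" by linarith
  then show ?thesis
  proof cases
    case 1
    have "cis t ^ n * cnj (cis t ^ n) = 1" for t
      using one[of t] by (simp flip: power_mult_distrib)
    with 1 show ?thesis by simp
  next
    case 2
    have "cis t ^ m * cnj (cis t ^ n) = cis t ^ (m - n)" for t
    proof -
      have "cis t ^ m = cis t ^ (m - n) * cis t ^ n" using 2 by (simp flip: power_add)
      then show ?thesis using one[of t] by (simp add: mult.assoc flip: power_mult_distrib)
    qed
    then show ?thesis using 2 * by simp
  next
    case 3
    have "cis t ^ m * cnj (cis t ^ n) = cnj (cis t ^ (n - m))" for t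
    proof -
      have "cis t ^ n = cis t ^ (n - m) * cis t ^ m" using 3 by (simp flip: power_add)
      then show ?thesis using one[of t] by (simp add: mult_ac flip: power_mult_distrib)
    qed
    then have "(LINT t|circ. cis t ^ m * cnj (cis t ^ n)) = (LINT t|circ. cnj (cis t ^ (n - m)))" by simp
    also have "\<dots> = cnj (LINT t|circ. (cis t ^ (n - m)))" 
      by (intro integral_bounded_linear bounded_linear_cnj integrable_circ continuous_intros)
    finally show ?thesis using 3 * by simp
  qed
qed

lemma parseval_poly:
  "(LINT t|circ. (cmod (\<Sum>i<N. a i * cis t ^ i))\<^sup>2) = (\<Sum>i<N. (cmod (a i))\<^sup>2)"
proof -
  have int: "integrable circ (\<lambda>t. cis t ^ i * cnj (cis t ^ j))" for i j
    by (intro integrable_circ continuous_intros)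
  have "complex_of_real (LINT t|circ. (cmod (\<Sum>i<N. a i * cis t ^ i))\<^sup>2)
     = (LINT t|circ. (\<Sum>i<N. a i * cis t ^ i) * cnj (\<Sum>i<N. a i * cis t ^ i))"
    by (simp only: integral_complex_of_real[symmetric] complex_norm_square)
  also have "\<dots> = (LINT t|circ. (\<Sum>i<N. \<Sum>j<N. (a i * cnj (a j)) * (cis t ^ i * cnj (cis t ^ j))))"
    unfolding cnj_sum sum_product complex_cnj_mult
    by (intro Bochner_Integration.integral_cong sum.cong refl) (simp add: mult_ac)
  also have "\<dots> = (\<Sum>i<N. \<Sum>j<N. (a i * cnj (a j)) * (LINT t|circ. cis t ^ i * cnj (cis t ^ j)))"
    by (subst Bochner_Integration.integral_sum integral_mult_right_zero; 
        (intro Bochner_Integration.integrable_sum integrable_mult_right int)?)+ (rule refl)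
  also have "\<dots> = (\<Sum>i<N. a i * cnj (a i))"
    unfolding integral_circ_cis_mult_cnj
    by (intro sum.cong refl) (simp add: if_distrib[of "\<lambda>x. _ * x"] sum.delta cong: if_cong)
  also have "\<dots> = of_real (\<Sum>i<N. (cmod (a i))\<^sup>2)"
    by (simp only: of_real_sum complex_norm_square)
  finally show ?thesis by (simp only: of_real_eq_iff)
qed

lemma continuous_on_circle:
  assumes "f holomorphic_on unit_disc" "0 \<le> r" "r < 1"
  shows "continuous_on UNIV (\<lambda>t. f (of_real r * cis t))"
  by (rule continuous_on_compose2[OF holomorphic_on_imp_continuous_on[OF assms(1)]])
     (use assms in \<open>auto intro!: continuous_intros simp: norm_mult\<close>)

text \<open>Dominated convergence from the polynomial case: the series converges absolutely on the
  circle of radius r, so the sum of absolute values is a constant majorant of all partial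
  sums.\<close>

lemma parseval:
  assumes f: "f holomorphic_on unit_disc" and r: "0 \<le> r" "r < 1"
  shows "(\<lambda>n. (cmod (taylor_coeff f n))\<^sup>2 * r ^ (2*n)) sums (LINT t|circ. (cmod (f (of_real r * cis t)))\<^sup>2)"
proof -
  define a where "a = (\<lambda>n. taylor_coeff f n * of_real r ^ n)"
  have s: "(\<lambda>n. a n * cis t ^ n) sums f (of_real r * cis t)" for t
    using taylor_sums[OF f, of "of_real r * cis t"] r
    by (simp add: a_def norm_mult power_mult_distrib mult_ac)
  have sa: "summable (\<lambda>n. cmod (a n))"
  proof -
    \<comment> \<open>Convergence at a strictly larger radius forces absolute convergence at
      r.\<close>
    obtain \<rho> where \<rho>: "r < \<rho>" "\<rho> < 1" using dense r by blast
    have "summable (\<lambda>n. taylor_coeff f n * of_real \<rho> ^ n)"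
      using taylor_sums[OF f, of "of_real \<rho>"] \<rho> r by (simp add: sums_iff)
    then show ?thesis unfolding a_def
      by (rule powser_insidea) (use \<rho> r in auto)
  qed
  have "(\<lambda>N. (LINT t|circ. (cmod (\<Sum>i<N. a i * cis t ^ i))\<^sup>2)) \<longlonglongrightarrow> (LINT t|circ. (cmod (f (of_real r * cis t)))\<^sup>2)"
  proof (rule integral_dominated_convergence)
    show "integrable circ (\<lambda>_. (suminf (\<lambda>n. cmod (a n)))\<^sup>2)" by simp
    show "AE t in circ. (\<lambda>N. (cmod (\<Sum>i<N. a i * cis t ^ i))\<^sup>2) \<longlonglongrightarrow> (cmod (f (of_real r * cis t)))\<^sup>2"
      using s unfolding sums_def by (intro AE_I2 tendsto_intros) 
    show "(\<lambda>t. (cmod (f (of_real r * cis t)))\<^sup>2) \<in> borel_measurable circ"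
      by (intro borel_measurable_integrable integrable_circ continuous_intros continuous_on_circle f r)
    show "(\<lambda>t. (cmod (\<Sum>i<N. a i * cis t ^ i))\<^sup>2) \<in> borel_measurable circ" for N
      by (intro borel_measurable_integrable integrable_circ continuous_intros)
    show "AE t in circ. norm ((cmod (\<Sum>i<N. a i * cis t ^ i))\<^sup>2) \<le> (suminf (\<lambda>n. cmod (a n)))\<^sup>2" for N
    proof (rule AE_I2)
      fix t
      have "cmod (\<Sum>i<N. a i * cis t ^ i) \<le> (\<Sum>i<N. cmod (a i))"
        by (rule order_trans[OF norm_sum]) (simp add: norm_mult norm_power)
      also have "\<dots> \<le> suminf (\<lambda>n. cmod (a n))" by (rule sum_le_suminf[OF sa]) auto
      finally show "norm ((cmod (\<Sum>i<N. a i * cis t ^ i))\<^sup>2) \<le> (suminf (\<lambda>n. cmod (a n)))\<^sup>2"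
        by (simp add: power_mono)
    qed
  qed
  then show ?thesis
    unfolding parseval_poly sums_def using r
    by (simp add: a_def norm_mult norm_power power_mult_distrib power_mult[symmetric] mult.commute)
qed

lemma circle_mean_le_h2norm:
  assumes "f \<in> H2" "0 \<le> r" "r < 1"
  shows "(LINT t|circ. (cmod (f (of_real r * cis t)))\<^sup>2) \<le> (h2norm f)\<^sup>2"
proof -
  have f: "f holomorphic_on unit_disc" using assms by (simp add: H2_def)
  show ?thesis
    by (rule sums_le[OF _ parseval[OF f assms(2,3)] h2norm_square[OF assms(1)]])
       (use assms in \<open>auto intro!: mult_left_le power_le_one\<close>)
qed

text \<open>Each finite partial sum of Parseval's identity is bounded by B, and r may tend to 1 in
  it. This is how pointwise or integral estimates become statements about \<open>H2\<close> and
  \<open>h2norm\<close>, which are defined by coefficients.\<close>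

lemma H2_if_circle_means_bounded:
  assumes f: "f holomorphic_on unit_disc"
    and B: "\<And>r. 0 \<le> r \<Longrightarrow> r < 1 \<Longrightarrow> (LINT t|circ. (cmod (f (of_real r * cis t)))\<^sup>2) \<le> B"
  shows "f \<in> H2" "(h2norm f)\<^sup>2 \<le> B"
proof -
  have *: "(\<Sum>n<N. (cmod (taylor_coeff f n))\<^sup>2) \<le> B" for N
  proof (rule tendsto_upperbound)
    show "((\<lambda>r. \<Sum>n<N. (cmod (taylor_coeff f n))\<^sup>2 * r ^ (2*n)) \<longlongrightarrow> (\<Sum>n<N. (cmod (taylor_coeff f n))\<^sup>2)) (at_left (1::real))"
      by (rule tendsto_eq_intros refl | simp)+
    have "\<forall>\<^sub>F r in at_left (1::real). r \<in> {0<..<1}"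
      by (rule eventually_at_leftI[of 0]) auto
    then show "\<forall>\<^sub>F r in at_left 1. (\<Sum>n<N. (cmod (taylor_coeff f n))\<^sup>2 * r ^ (2*n)) \<le> B"
    proof eventually_elim
      case (elim r)
      then have p: "(\<lambda>n. (cmod (taylor_coeff f n))\<^sup>2 * r ^ (2*n)) sums (LINT t|circ. (cmod (f (of_real r * cis t)))\<^sup>2)"
        by (intro parseval f) auto
      have "(\<Sum>n<N. (cmod (taylor_coeff f n))\<^sup>2 * r ^ (2*n)) \<le> (LINT t|circ. (cmod (f (of_real r * cis t)))\<^sup>2)"
        unfolding sums_unique[OF p]
        by (rule sum_le_suminf) (use p elim in \<open>auto simp: sums_iff\<close>)
      then show ?case using B[of r] elim by auto
    qed
  qed simp
  have s: "summable (\<lambda>n. (cmod (taylor_coeff f n))\<^sup>2)"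
    by (rule bounded_imp_summable[of _ B]) (use *[of "Suc _"] in \<open>auto simp: lessThan_Suc_atMost\<close>)
  show f2: "f \<in> H2" using f s by (simp add: H2_def)
  show "(h2norm f)\<^sup>2 \<le> B"
    using h2norm_square[OF f2] * unfolding sums_def by (intro LIMSEQ_le_const2) auto
qed

lemma H2_if_bounded:
  assumes f: "f holomorphic_on unit_disc" and B: "\<And>z. z \<in> unit_disc \<Longrightarrow> cmod (f z) \<le> B"
  shows "f \<in> H2" "h2norm f \<le> B"
proof -
  have "B \<ge> 0" using B[of 0] norm_ge_zero[of "f 0"] by (simp del: norm_ge_zero)
  have "(LINT t|circ. (cmod (f (of_real r * cis t)))\<^sup>2) \<le> B\<^sup>2" if "0 \<le> r" "r < 1" for r
  proof -
    have "(LINT t|circ. (cmod (f (of_real r * cis t)))\<^sup>2) \<le> (LINT t|circ. B\<^sup>2)"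
      using that B
      by (intro integral_mono integrable_circ continuous_intros continuous_on_circle f power_mono)
         (auto simp: norm_mult)
    then show ?thesis by simp
  qed
  from H2_if_circle_means_bounded[OF f this] show "f \<in> H2" "h2norm f \<le> B"
    using \<open>B \<ge> 0\<close> by (auto simp: power2_le_iff_abs_le)
qed

text \<open>From above the means never exceed the limit; from below finitely many coefficients
  already come close to it, and a finite sum is continuous in r.\<close>

lemma tendsto_circle_mean:
  assumes "f \<in> H2"
  shows "((\<lambda>r. LINT t|circ. (cmod (f (of_real r * cis t)))\<^sup>2) \<longlongrightarrow> (h2norm f)\<^sup>2) (at_left 1)"
proof (rule order_tendstoI)
  have f: "f holomorphic_on unit_disc" using assms by (simp add: H2_def)
  have ev: "\<forall>\<^sub>F r in at_left (1::real). r \<in> {0<..<1}"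
    by (rule eventually_at_leftI[of 0]) auto
  fix a assume a: "a < (h2norm f)\<^sup>2"
  then obtain N where N: "(\<Sum>n<N. (cmod (taylor_coeff f n))\<^sup>2) > a"
    using order_tendstoD(1)[OF h2norm_square[OF assms, unfolded sums_def]] 
    by (auto simp: eventually_sequentially)
  have "((\<lambda>r. \<Sum>n<N. (cmod (taylor_coeff f n))\<^sup>2 * r ^ (2*n)) \<longlongrightarrow> (\<Sum>n<N. (cmod (taylor_coeff f n))\<^sup>2)) (at_left (1::real))"
    by (rule tendsto_eq_intros refl | simp)+
  from order_tendstoD(1)[OF this N] ev
  show "\<forall>\<^sub>F r in at_left 1. a < (LINT t|circ. (cmod (f (of_real r * cis t)))\<^sup>2)"
  proof eventually_elim
    case (elim r)
    then have p: "(\<lambda>n. (cmod (taylor_coeff f n))\<^sup>2 * r ^ (2*n)) sums (LINT t|circ. (cmod (f (of_real r * cis t)))\<^sup>2)"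
      by (intro parseval f) auto
    have "(\<Sum>n<N. (cmod (taylor_coeff f n))\<^sup>2 * r ^ (2*n)) \<le> (LINT t|circ. (cmod (f (of_real r * cis t)))\<^sup>2)"
      unfolding sums_unique[OF p]
      by (rule sum_le_suminf) (use p elim in \<open>auto simp: sums_iff\<close>)
    then show ?case using elim by auto
  qed
next
  have ev: "\<forall>\<^sub>F r in at_left (1::real). r \<in> {0<..<1}"
    by (rule eventually_at_leftI[of 0]) auto
  fix a assume a: "a > (h2norm f)\<^sup>2"
  show "\<forall>\<^sub>F r in at_left 1. a > (LINT t|circ. (cmod (f (of_real r * cis t)))\<^sup>2)"
    using ev 
  proof eventually_elim
    case (elim r)
    then show ?case using circle_mean_le_h2norm[OF assms, of r] a by simp
  qed
qed

subsection \<open>Radial limits\<close>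

text \<open>The squared distance is (1 - r)^2 + 4 r sin^2 (u / 2). As |u / 2| <= 2, the cubic Taylor
  bound gives |sin x| >= |x| / 3, and r >= 1/2 then makes the distance term at least ((1 - r)^2 +
  u^2) / 18. The factor 36 is this 18 times the bound 2 for 1 + r.\<close>

lemma poisson_kernel_le:
  fixes r u :: real
  assumes r: "1/2 \<le> r" "r < 1" and u: "\<bar>u\<bar> \<le> pi"
  shows "poisson (of_real r) (cis u) \<le> 36 * ((1 - r) / ((1 - r)\<^sup>2 + u\<^sup>2))"
proof -
  define x where "x = u / 2"
  have x: "\<bar>x\<bar> \<le> 2" using u pi_less_4 by (simp add: x_def)
  have "\<bar>sin x - x\<bar> \<le> inverse 6 * \<bar>x\<bar> ^ 3"
    using Maclaurin_sin_bound[of x 3] by (simp add: numeral_3_eq_3 sin_coeff_def fact_numeral)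
  also have "\<dots> = \<bar>x\<bar> * (x\<^sup>2 / 6)" by (simp add: power3_eq_cube power2_eq_square abs_mult[symmetric])
  also have "\<dots> \<le> \<bar>x\<bar> * (2/3)"
    using power_mono[of "\<bar>x\<bar>" 2 2] x by (intro mult_left_mono) auto
  finally have "\<bar>sin x\<bar> \<ge> \<bar>x\<bar> / 3" by linarith
  then have "(\<bar>x\<bar> / 3)\<^sup>2 \<le> \<bar>sin x\<bar>\<^sup>2" by (intro power_mono) auto
  then have sx: "(sin x)\<^sup>2 \<ge> u\<^sup>2 / 36" by (simp add: x_def power_divide)
  have aux: "a + 2 * (b / 36) \<le> c \<Longrightarrow> 0 \<le> a \<Longrightarrow> (a + b) / 18 \<le> c" for a b c :: real
    by simp
  have "(cmod (cis u - of_real r))\<^sup>2 = 1 - 2 * r * cos u + r\<^sup>2"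
    using sin_cos_squared_add[of u] by (simp add: cmod_power2 power2_diff algebra_simps)
  also have "\<dots> = (1 - r)\<^sup>2 + 4 * r * (sin x)\<^sup>2"
  proof -
    have c: "cos u = 1 - 2 * (sin x)\<^sup>2" using cos_double_sin[of x] by (simp add: x_def)
    show ?thesis unfolding c by (simp add: power2_diff algebra_simps)
  qed
  also have "\<dots> \<ge> (1 - r)\<^sup>2 + 2 * (u\<^sup>2 / 36)"
    using r sx by (intro add_left_mono mult_mono) auto
  finally have d: "(cmod (cis u - of_real r))\<^sup>2 \<ge> ((1 - r)\<^sup>2 + u\<^sup>2) / 18"
    by (rule aux) simp
  have p: "(1 - r)\<^sup>2 + u\<^sup>2 > 0" using r by (intro add_pos_nonneg) auto
  have "poisson (of_real r) (cis u) = (1 + r) * (1 - r) / (cmod (cis u - of_real r))\<^sup>2"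
    using r by (simp add: poisson_def power2_eq_square algebra_simps)
  also have "\<dots> \<le> 2 * (1 - r) / (((1 - r)\<^sup>2 + u\<^sup>2) / 18)"
    using r d p by (intro frac_le mult_right_mono mult_nonneg_nonneg) auto
  finally show ?thesis by simp
qed

text \<open>A Hardy--Littlewood type bound: \<open>k\<close> decreases, so integrating \<open>k q\<close> by parts keeps
  the sign of \<open>\<integral>\<^sub>0\<^sup>x q - c x \<le> 0\<close>.\<close>
lemma integral_kernel_le:
  fixes q :: "real \<Rightarrow> real"
  assumes d: "d > 0" and b: "b > 0" and c: "c \<ge> 0" and q: "continuous_on {0..b} q"
    and Q: "\<And>x. 0 \<le> x \<Longrightarrow> x \<le> b \<Longrightarrow> integral {0..x} q \<le> c * x"
  shows "integral {0..b} (\<lambda>u. d / (d\<^sup>2 + u\<^sup>2) * q u) \<le> c * (pi / 2)"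
proof -
  define k where "k = (\<lambda>u::real. d / (d\<^sup>2 + u\<^sup>2))"
  define k' where "k' = (\<lambda>u::real. - (d * (2 * u)) / (d\<^sup>2 + u\<^sup>2)\<^sup>2)"
  define F where "F = (\<lambda>x. k x * (integral {0..x} q - c * x))"
  have pos: "d\<^sup>2 + u\<^sup>2 > 0" for u using d by (simp add: add_pos_nonneg)
  have dk: "(k has_real_derivative k' u) (at u within S)" for u S
    unfolding k_def k'_def using pos[of u]
    by (auto intro!: derivative_eq_intros simp: power2_eq_square)
  have ck: "continuous_on S k" for S
    unfolding k_def using pos by (intro continuous_intros) (auto simp: less_imp_neq[symmetric] dest: less_imp_neq)
  have dF: "(F has_real_derivative (k' x * (integral {0..x} q - c * x) + (q x - c) * k x)) (at x within {0..b})"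
    if "x \<in> {0..b}" for x
  proof -
    have "((\<lambda>x. integral {0..x} q) has_real_derivative q x) (at x within {0..b})"
      using integral_has_real_derivative[OF q] that by auto
    then have "((\<lambda>x. integral {0..x} q - c * x) has_real_derivative q x - c) (at x within {0..b})"
      by (auto intro!: derivative_eq_intros)
    from DERIV_mult'[OF dk this] show ?thesis unfolding F_def
      by (simp add: algebra_simps)
  qed
  have I: "((\<lambda>x. k' x * (integral {0..x} q - c * x) + (q x - c) * k x) has_integral F b - F 0) {0..b}"
    using b dF by (intro fundamental_theorem_of_calculus)
      (auto simp: has_real_derivative_iff_has_vector_derivative[symmetric])
  have J: "((\<lambda>x. k x * q x) has_integral integral {0..b} (\<lambda>x. k x * q x)) {0..b}"
    by (intro integrable_integral integrable_continuous_real continuous_intros q ck)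
  have K: "(k has_integral (arctan (b / d) - arctan (0 / d))) {0..b}"
  proof (rule fundamental_theorem_of_calculus)
    fix x assume "x \<in> {0..b}"
    have "((\<lambda>x. arctan (x / d)) has_real_derivative k x) (at x within {0..b})"
      unfolding k_def using d pos[of x]
      by (auto intro!: derivative_eq_intros simp: field_simps power2_eq_square)
    then show "((\<lambda>x. arctan (x / d)) has_vector_derivative k x) (at x within {0..b})"
      by (simp add: has_real_derivative_iff_has_vector_derivative)
  qed (use b in auto)
  have L: "((\<lambda>x. k x * q x - c * k x) has_integral
      (integral {0..b} (\<lambda>x. k x * q x) - c * (arctan (b / d) - arctan (0 / d)))) {0..b}"
    by (intro has_integral_diff J has_integral_mult_right K)
  have "integral {0..b} (\<lambda>x. k x * q x) - c * (arctan (b / d) - arctan (0 / d)) \<le> F b - F 0"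
  proof (rule has_integral_le[OF L I])
    fix x assume x: "x \<in> {0..b}"
    have "k' x \<le> 0" unfolding k'_def using d x by (auto intro!: divide_nonpos_nonneg)
    moreover have "integral {0..x} q - c * x \<le> 0" using Q[of x] x by simp
    ultimately have "k' x * (integral {0..x} q - c * x) \<ge> 0" by (rule mult_nonpos_nonpos)
    then show "k x * q x - c * k x \<le> k' x * (integral {0..x} q - c * x) + (q x - c) * k x"
      by (simp add: algebra_simps)
  qed
  also have "F b - F 0 \<le> 0"
  proof -
    have "k b \<ge> 0" unfolding k_def using d by simp
    then have "F b \<le> 0" unfolding F_def using Q[of b] b by (intro mult_nonneg_nonpos) auto
    then show ?thesis by (simp add: F_def)
  qed
  finally have "integral {0..b} (\<lambda>x. k x * q x) \<le> c * arctan (b / d)" by simp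
  also have "\<dots> \<le> c * (pi / 2)" using c arctan_ubound[of "b / d"] by (intro mult_left_mono) auto
  finally show ?thesis by (simp add: k_def)
qed

lemma poisson_formula_centered:
  fixes r t :: real
  assumes g: "g holomorphic_on ball 0 R" and "R > 1" and r: "0 \<le> r" "r < 1"
  shows "g (of_real r * cis t) =
    (1 / (2*pi)) *\<^sub>R integral {-pi..pi} (\<lambda>u. of_real (poisson (of_real r) (cis u)) * g (cis (t + u)))"
proof -
  \<comment> \<open>The rotation carries a minus sign so that the evaluation point becomes -r:
    shifting the angle by pi then moves [0, 2 pi] to [-pi, pi], with the peak of the kernel in the
    middle.\<close>
  define h where "h = (\<lambda>z. g (- cis t * z))"
  have h: "h holomorphic_on ball 0 R"
    unfolding h_def
    by (rule holomorphic_on_compose_gen[OF _ g, of _ "ball 0 R", unfolded o_def])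
       (auto intro!: holomorphic_intros simp: norm_mult)
  have z: "cmod (- of_real r) < 1" using r by simp
  have c: "continuous_on UNIV (\<lambda>s. of_real (poisson (- of_real r) (cis s)) * h (cis s))"
    using \<open>R > 1\<close>
    by (intro continuous_on_cis_comp continuous_intros continuous_on_poisson z
         holomorphic_on_imp_continuous_on holomorphic_on_subset[OF h]) auto
  have "g (of_real r * cis t) = h (- of_real r)" by (simp add: h_def mult.commute)
  also have "\<dots> = (LINT s|circ. of_real (poisson (- of_real r) (cis s)) * h (cis s))"
    by (rule poisson_formula[OF h \<open>R > 1\<close> z, symmetric])
  also have "\<dots> = (1 / (2*pi)) *\<^sub>R integral {0..2*pi} (\<lambda>s. of_real (poisson (- of_real r) (cis s)) * h (cis s))"
    by (rule integral_circ_eq[OF c])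
  also have "integral {0..2*pi} (\<lambda>s. of_real (poisson (- of_real r) (cis s)) * h (cis s)) =
     integral {0-pi..2*pi-pi} (\<lambda>u. of_real (poisson (- of_real r) (cis (u + pi))) * h (cis (u + pi)))"
    by (rule integral_shift_real_ivl[symmetric])
  also have "(\<lambda>u. of_real (poisson (- of_real r) (cis (u + pi))) * h (cis (u + pi))) =
     (\<lambda>u. complex_of_real (poisson (of_real r) (cis u)) * g (cis (t + u)))"
  proof
    fix u
    have e: "cis (u + pi) = - cis u" by (simp flip: cis_mult)
    have "cmod (- cis u + of_real r) = cmod (cis u - of_real r)"
      by (metis norm_minus_commute uminus_add_conv_diff add.commute)
    then show "of_real (poisson (- of_real r) (cis (u + pi))) * h (cis (u + pi)) =
      complex_of_real (poisson (of_real r) (cis u)) * g (cis (t + u))"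
      unfolding e by (simp add: poisson_def h_def cis_mult)
  qed
  finally show ?thesis by simp
qed

text \<open>The majorant of the kernel is even, so the integral folds onto [0, pi], where
  \<open>integral_kernel_le\<close> applies with c = 2 l. The constants combine to 36 / (2 pi) * (2
  l) * (pi / 2) = 18 l.\<close>

lemma radial_maximal_bound:
  fixes r t :: real
  assumes g: "g holomorphic_on ball 0 R" and "R > 1" and r: "1/2 \<le> r" "r < 1" and "l > 0"
    and M: "\<And>a. 0 < a \<Longrightarrow> a \<le> pi \<Longrightarrow> integral {t-a..t+a} (\<lambda>s. cmod (g (cis s))) \<le> 2 * a * l"
  shows "cmod (g (of_real r * cis t)) \<le> 18 * l"
proof -
  define h where "h = (\<lambda>s. cmod (g (cis s)))"
  define d where "d = 1 - r"
  define k where "k = (\<lambda>u::real. d / (d\<^sup>2 + u\<^sup>2))"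
  have d: "d > 0" using r by (simp add: d_def)
  have pos: "d\<^sup>2 + u\<^sup>2 > 0" for u using d by (simp add: add_pos_nonneg)
  have ck: "continuous_on S k" for S
    unfolding k_def using pos by (intro continuous_intros) (auto simp: less_imp_neq[symmetric] dest: less_imp_neq)
  have cg: "continuous_on (sphere 0 1) g"
    using \<open>R > 1\<close> by (intro holomorphic_on_imp_continuous_on holomorphic_on_subset[OF g]) auto
  have ch': "continuous_on UNIV h"
    unfolding h_def by (intro continuous_intros continuous_on_cis_comp cg)
  have ch: "continuous_on S (\<lambda>u. h (f u))" if "continuous_on S f" for S and f :: "real \<Rightarrow> real"
    by (rule continuous_on_compose2[OF ch' that]) auto
  have i: "(\<lambda>u. k u * h (t + u)) integrable_on {a..b}" for a b
    by (intro integrable_continuous_real continuous_intros ch ck)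
  \<comment> \<open>Folding is needed for two even weights: the kernel \<open>k\<close> in the main
    estimate and the constant 1, which brings the hypothesis on centred intervals into the form that
    the kernel lemma expects.\<close>
  have symm: "integral {-a..a} (\<lambda>u. p u * h (t + u)) = integral {0..a} (\<lambda>u. p u * (h (t + u) + h (t - u)))"
    if "a \<ge> 0" and cp: "\<And>S. continuous_on S p" and pe: "\<And>u. p (-u) = p u" for a :: real and p
  proof -
    have i: "(\<lambda>u. p u * h (t + u)) integrable_on {a..b}" "(\<lambda>u. p u * h (t - u)) integrable_on {a..b}" for a b
      by (intro integrable_continuous_real continuous_intros ch cp)+
    have "integral {-a..a} (\<lambda>u. p u * h (t + u)) =
       integral {-a..0} (\<lambda>u. p u * h (t + u)) + integral {0..a} (\<lambda>u. p u * h (t + u))"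
      using Henstock_Kurzweil_Integration.integral_combine[OF _ _ i(1), of "-a" 0 a] that(1) by simp
    also have "integral {-a..0} (\<lambda>u. p u * h (t + u)) = integral {0..a} (\<lambda>u. p u * h (t - u))"
      using Henstock_Kurzweil_Integration.integral_reflect_real[of a 0 "\<lambda>u. p u * h (t - u)"] pe by simp
    finally show ?thesis
      using Henstock_Kurzweil_Integration.integral_add[OF i(1) i(2), of 0 a] by (simp add: algebra_simps)
  qed
  have "cmod (g (of_real r * cis t)) = (1 / (2*pi)) *
     cmod (integral {-pi..pi} (\<lambda>u. of_real (poisson (of_real r) (cis u)) * g (cis (t + u))))"
    using r by (subst poisson_formula_centered[OF g \<open>R > 1\<close>]) auto
  also have "\<dots> \<le> (1 / (2*pi)) * integral {-pi..pi} (\<lambda>u. 36 * (k u * h (t + u)))"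
  proof (intro mult_left_mono integral_norm_bound_integral)
    show "(\<lambda>u. of_real (poisson (of_real r) (cis u)) * g (cis (t + u))) integrable_on {-pi..pi}"
    proof (intro integrable_continuous_real continuous_intros)
      show "continuous_on {-pi..pi} (\<lambda>u. poisson (of_real r) (cis u))"
        by (rule continuous_on_subset[OF continuous_on_cis_comp[OF continuous_on_poisson]]) (use r in auto)
      show "continuous_on {-pi..pi} (\<lambda>u. g (cis (t + u)))"
        by (rule continuous_on_compose2[OF cg]) (auto intro!: continuous_intros)
    qed
    show "(\<lambda>u. 36 * (k u * h (t + u))) integrable_on {-pi..pi}"
      by (intro integrable_on_mult_right i)
    fix u assume "u \<in> {-pi..pi}"
    then have "poisson (of_real r) (cis u) \<le> 36 * k u"
      unfolding k_def d_def by (intro poisson_kernel_le r) auto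
    moreover have "poisson (of_real r) (cis u) \<ge> 0" using r by (intro poisson_nonneg) auto
    ultimately show "cmod (of_real (poisson (of_real r) (cis u)) * g (cis (t + u))) \<le> 36 * (k u * h (t + u))"
      unfolding norm_mult h_def by (simp add: mult_right_mono flip: mult.assoc)
  qed auto
  also have "\<dots> = (18 / pi) * integral {-pi..pi} (\<lambda>u. k u * h (t + u))" by simp
  also have "integral {-pi..pi} (\<lambda>u. k u * h (t + u)) = integral {0..pi} (\<lambda>u. k u * (h (t + u) + h (t - u)))"
    by (rule symm[OF _ ck]) (auto simp: k_def)
  also have "\<dots> \<le> (2 * l) * (pi / 2)"
    unfolding k_def
  proof (rule integral_kernel_le[OF d])
    show "continuous_on {0..pi} (\<lambda>u. h (t + u) + h (t - u))"
      by (intro continuous_intros ch)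
    fix x assume x: "0 \<le> x" "x \<le> pi"
    have "integral {0..x} (\<lambda>u. h (t + u) + h (t - u)) = integral {-x..x} (\<lambda>u. h (u + t))"
      using symm[of x "\<lambda>_. 1"] x by (simp add: add.commute)
    also have "\<dots> = integral {t-x..t+x} h"
      using integral_shift_real_ivl[of "t-x" t "t+x" h] by simp
    also have "\<dots> \<le> 2 * l * x" using M[of x] x unfolding h_def by (cases "x = 0") (auto simp: mult_ac)
    finally show "integral {0..x} (\<lambda>u. h (t + u) + h (t - u)) \<le> 2 * l * x" .
  qed (use \<open>l > 0\<close> in auto)
  finally show ?thesis using pi_gt_zero by (simp add: field_simps)
qed

section \<open>Weak type inequality for interval averages\<close>

lemma emeasure_UN_le_nn_integral:
  assumes "countable C" and [measurable]: "\<And>i. i \<in> C \<Longrightarrow> B i \<in> sets M"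
  shows "emeasure M (\<Union>i\<in>C. B i) \<le> (\<integral>\<^sup>+i. emeasure M (B i) \<partial>count_space C)"
proof -
  have [measurable]: "(\<Union>i\<in>C. B i) \<in> sets M" using assms by (intro sets.countable_UN') auto
  have "emeasure M (\<Union>i\<in>C. B i) = (\<integral>\<^sup>+x. indicator (\<Union>i\<in>C. B i) x \<partial>M)" by simp
  also have "\<dots> \<le> (\<integral>\<^sup>+x. (\<integral>\<^sup>+i. indicator (B i) x \<partial>count_space C) \<partial>M)"
  proof (rule nn_integral_mono)
    fix x
    show "indicator (\<Union>i\<in>C. B i) x \<le> (\<integral>\<^sup>+i. indicator (B i) x \<partial>count_space C)"
    proof (cases "x \<in> (\<Union>i\<in>C. B i)")
      case True
      then obtain i where i: "i \<in> C" "x \<in> B i" by auto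
      have "(indicator (B i) x :: ennreal) \<le> (\<integral>\<^sup>+i. indicator (B i) x \<partial>count_space C)"
        using i(1) by (rule nn_integral_ge_point)
      then show ?thesis using i by (simp add: indicator_def)
    qed simp
  qed
  also have "\<dots> = (\<integral>\<^sup>+i. (\<integral>\<^sup>+x. indicator (B i) x \<partial>M) \<partial>count_space C)"
    by (rule nn_integral_count_space_nn_integral) (use assms in auto)
  also have "\<dots> = (\<integral>\<^sup>+i. emeasure M (B i) \<partial>count_space C)"
    by (intro nn_integral_cong) simp
  finally show ?thesis .
qed

text \<open>Vitali's covering argument. Each selected interval of radius r has h-mass above 2 r l,
  so its fivefold enlargement has length 10 r, at most 5 / l times that mass. The selected intervals
  are disjoint and lie within three periods of h, which gives 5 * 3 = 15. The set \<open>S\<close>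
  is the union of the enlarged intervals, a Borel superset of the exceptional set \<open>E\<close>,
  so measurability of \<open>E\<close> never arises.\<close>

lemma weak_type_inequality:
  fixes h :: "real \<Rightarrow> real"
  assumes ch: "continuous_on UNIV h" and h0: "\<And>s. h s \<ge> 0" and per: "\<And>s. h (s + 2*pi) = h s" and l: "l > 0"
  obtains S where "S \<in> sets borel" "emeasure lborel S \<le> ennreal (15 / l * integral {0..2*pi} h)"
    "\<And>t a. t \<in> {0..2*pi} \<Longrightarrow> t \<notin> S \<Longrightarrow> 0 < a \<Longrightarrow> a \<le> pi \<Longrightarrow> integral {t-a..t+a} h \<le> 2 * a * l"
proof -
  define E where "E = {t\<in>{0..2*pi}. \<exists>a. 0 < a \<and> a \<le> pi \<and> integral {t-a..t+a} h > 2 * a * l}"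
  obtain r where r: "\<And>t. t \<in> E \<Longrightarrow> 0 < r t \<and> r t \<le> pi \<and> integral {t - r t..t + r t} h > 2 * r t * l"
    unfolding E_def by (atomize_elim, intro choice) blast
  have hi: "h integrable_on {a..b}" for a b
    by (intro integrable_continuous_real continuous_on_subset[OF ch]) auto
  have [measurable]: "h \<in> borel_measurable borel" by (rule borel_measurable_continuous_onI[OF ch])
  have sub: "E \<subseteq> (\<Union>t\<in>E. cball t (r t))"
  proof
    fix t assume "t \<in> E"
    then show "t \<in> (\<Union>t\<in>E. cball t (r t))" using r[of t] by (intro UN_I[of t]) auto
  qed
  obtain C where C: "countable C" "C \<subseteq> E"
     "pairwise (\<lambda>i j. disjnt (cball i (r i)) (cball j (r j))) C"
     "E \<subseteq> (\<Union>i\<in>C. cball i (5 * r i))"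
    by (rule Vitali_covering_lemma_cballs[OF sub, of pi]) (use r in auto)
  define S where "S = (\<Union>i\<in>C. cball i (5 * r i))"
  define \<nu> where "\<nu> = density lborel (\<lambda>x. ennreal (h x))"
  have sn [simp]: "sets \<nu> = sets borel" by (simp add: \<nu>_def)
  have \<nu>: "emeasure \<nu> {a..b} = ennreal (integral {a..b} h)" for a b
  proof -
    have eq: "(\<lambda>x. h x * indicator {a..b} x) = (\<lambda>x. if x \<in> {a..b} then h x else 0)" by auto
    have "((\<lambda>x. h x * indicator {a..b} x) has_integral integral {a..b} h) UNIV"
      unfolding eq has_integral_restrict_UNIV by (rule integrable_integral[OF hi])
    then have "(\<integral>\<^sup>+x. ennreal (h x * indicator {a..b} x) \<partial>lborel) = ennreal (integral {a..b} h)"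
      by (intro nn_integral_has_integral_lborel) (auto simp: h0)
    then show ?thesis unfolding \<nu>_def by (simp add: emeasure_density ennreal_mult' h0 ennreal_indicator)
  qed
  have "emeasure lborel S \<le> (\<integral>\<^sup>+i. emeasure lborel (cball i (5 * r i)) \<partial>count_space C)"
    unfolding S_def by (rule emeasure_UN_le_nn_integral) (use C in auto)
  also have "\<dots> \<le> (\<integral>\<^sup>+i. ennreal (5 / l) * emeasure \<nu> (cball i (r i)) \<partial>count_space C)"
  proof (rule nn_integral_mono)
    fix i assume "i \<in> space (count_space C)"
    then have i: "0 < r i" "integral {i - r i..i + r i} h > 2 * r i * l" using C r[of i] by auto
    have "emeasure lborel (cball i (5 * r i)) = ennreal (10 * r i)"
      using i by (simp add: cball_eq_atLeastAtMost)
    also have "\<dots> \<le> ennreal (5 / l * integral {i - r i..i + r i} h)"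
      using i l by (intro ennreal_leI) (simp add: field_simps)
    also have "\<dots> = ennreal (5 / l) * emeasure \<nu> (cball i (r i))"
      using l by (simp add: cball_eq_atLeastAtMost \<nu> flip: ennreal_mult')
    finally show "emeasure lborel (cball i (5 * r i)) \<le> ennreal (5 / l) * emeasure \<nu> (cball i (r i))" .
  qed
  also have "\<dots> = ennreal (5 / l) * (\<integral>\<^sup>+i. emeasure \<nu> (cball i (r i)) \<partial>count_space C)"
    by (rule nn_integral_cmult) auto
  also have "(\<integral>\<^sup>+i. emeasure \<nu> (cball i (r i)) \<partial>count_space C) = emeasure \<nu> (\<Union>i\<in>C. cball i (r i))"
    by (rule emeasure_UN_countable[symmetric])
       (use C in \<open>auto simp: disjoint_family_on_def pairwise_def disjnt_def\<close>)
  also have "emeasure \<nu> (\<Union>i\<in>C. cball i (r i)) \<le> emeasure \<nu> {-2*pi..4*pi}"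
  proof (intro emeasure_mono UN_least)
    fix i assume "i \<in> C"
    then have "i \<in> {0..2*pi}" "r i \<le> pi" using C r[of i] by (auto simp: E_def)
    then show "cball i (r i) \<subseteq> {-2*pi..4*pi}" by (auto simp: cball_eq_atLeastAtMost)
  qed simp
  also have "emeasure \<nu> {-2*pi..4*pi} = ennreal (3 * integral {0..2*pi} h)"
  proof -
    have "integral {-2*pi..4*pi} h = integral {-2*pi..0} h + integral {0..4*pi} h"
      using Henstock_Kurzweil_Integration.integral_combine[OF _ _ hi, of "-2*pi" 0 "4*pi"] by simp
    also have "integral {0..4*pi} h = integral {0..2*pi} h + integral {2*pi..4*pi} h"
      using Henstock_Kurzweil_Integration.integral_combine[OF _ _ hi, of 0 "2*pi" "4*pi"] by simp
    also have "integral {2*pi..4*pi} h = integral {0..2*pi} h"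
      using integral_shift_real_ivl[of "2*pi" "2*pi" "4*pi" h] per by simp
    also have "integral {-2*pi..0} h = integral {0..2*pi} h"
      using integral_shift_real_ivl[of 0 "2*pi" "2*pi" h] per by simp
    finally show ?thesis unfolding \<nu> by simp
  qed
  finally have "emeasure lborel S \<le> ennreal (5 / l) * ennreal (3 * integral {0..2*pi} h)"
    by (simp add: mult_left_mono)
  also have "\<dots> = ennreal (15 / l * integral {0..2*pi} h)"
    using l by (simp flip: ennreal_mult')
  finally have m: "emeasure lborel S \<le> ennreal (15 / l * integral {0..2*pi} h)" .
  show ?thesis
  proof (rule that[OF _ m])
    show "S \<in> sets borel" unfolding S_def using C by (intro sets.countable_UN') auto
    fix t a assume "t \<in> {0..2*pi}" "t \<notin> S" "0 < a" "a \<le> pi"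
    then have "t \<notin> E" using C(4) unfolding S_def by blast
    then show "integral {t-a..t+a} h \<le> 2 * a * l"
      using \<open>t \<in> _\<close> \<open>0 < a\<close> \<open>a \<le> pi\<close> unfolding E_def by force
  qed
qed

text \<open>The variance of h is nonnegative. This passes from the L^1 mean in the weak type
  inequality to the H^2 norm.\<close>

lemma circ_mean_square_le:
  fixes h :: "real \<Rightarrow> real"
  assumes "continuous_on UNIV h"
  shows "(LINT t|circ. h t)\<^sup>2 \<le> (LINT t|circ. (h t)\<^sup>2)"
proof -
  define m where "m = (LINT t|circ. h t)"
  have i: "integrable circ h" "integrable circ (\<lambda>t. (h t)\<^sup>2)"
    by (intro integrable_circ continuous_intros assms)+
  have "0 \<le> (LINT t|circ. (h t - m)\<^sup>2)" by simp
  also have "(\<lambda>t. (h t - m)\<^sup>2) = (\<lambda>t. (h t)\<^sup>2 - (2 * m) * h t + m\<^sup>2)"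
    by (auto simp: power2_diff)
  also have "(LINT t|circ. (h t)\<^sup>2 - (2 * m) * h t + m\<^sup>2) = (LINT t|circ. (h t)\<^sup>2) - (2 * m) * m + m\<^sup>2"
    using i by (simp add: m_def)
  finally show ?thesis by (simp add: m_def power2_eq_square)
qed

text \<open>Boundary values are not yet available, so the weak type inequality is applied to the
  dilates of f by \<open>\<rho> n\<close>, each with its own exceptional set. The constant is 15
  times the length 2 pi of the period.\<close>

lemma H2_maximal_inequality:
  assumes f: "f \<in> H2" and l: "l > 0"
  obtains S where "S \<in> sets borel" "emeasure lborel S \<le> ennreal (30 * pi / l * h2norm f)"
    "\<And>t r. t \<in> {0..2*pi} \<Longrightarrow> t \<notin> S \<Longrightarrow> 1/2 \<le> r \<Longrightarrow> r < 1 \<Longrightarrow> cmod (f (of_real r * cis t)) \<le> 18 * l"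
proof -
  have hol: "f holomorphic_on unit_disc" using f by (simp add: H2_def)
  define \<rho> where "\<rho> = (\<lambda>n. 1 - inverse (real (Suc (Suc n))))"
  have \<rho>: "0 < \<rho> n" "\<rho> n < 1" for n by (auto simp: \<rho>_def inverse_less_1_iff)
  have lim: "\<rho> \<longlonglongrightarrow> 1"
    unfolding \<rho>_def by (rule tendsto_eq_intros LIMSEQ_Suc[OF LIMSEQ_inverse_real_of_nat] refl | simp)+
  have "\<exists>S. S \<in> sets borel \<and> emeasure lborel S \<le> ennreal (30 * pi / l * h2norm f) \<and>
    (\<forall>t r. t \<in> {0..2*pi} \<longrightarrow> t \<notin> S \<longrightarrow> 1/2 \<le> r \<longrightarrow> r < 1 \<longrightarrow> cmod (f (of_real (\<rho> n * r) * cis t)) \<le> 18 * l)" for n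
  proof -
    define g where "g = (\<lambda>z. f (of_real (\<rho> n) * z))"
    define h where "h = (\<lambda>s. cmod (g (cis s)))"
    have R: "1 / \<rho> n > 1" using \<rho>[of n] by simp
    have g: "g holomorphic_on ball 0 (1 / \<rho> n)" unfolding g_def
      by (rule holomorphic_on_compose_gen[OF _ hol, of _ "ball 0 (1 / \<rho> n)", unfolded o_def])
         (use \<rho>[of n] in \<open>auto intro!: holomorphic_intros simp: norm_mult field_simps\<close>)
    have ch: "continuous_on UNIV h"
      unfolding h_def g_def using \<rho>[of n] by (intro continuous_intros continuous_on_circle hol) auto
    obtain S where S: "S \<in> sets borel" "emeasure lborel S \<le> ennreal (15 / l * integral {0..2*pi} h)"
      "\<And>t a. t \<in> {0..2*pi} \<Longrightarrow> t \<notin> S \<Longrightarrow> 0 < a \<Longrightarrow> a \<le> pi \<Longrightarrow> integral {t-a..t+a} h \<le> 2 * a * l"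
      by (rule weak_type_inequality[OF ch _ _ l]) (auto simp: h_def simp flip: cis_mult)
    have "(LINT t|circ. h t)\<^sup>2 \<le> (LINT t|circ. (h t)\<^sup>2)" by (rule circ_mean_square_le[OF ch])
    also have "\<dots> \<le> (h2norm f)\<^sup>2"
      unfolding h_def g_def using \<rho>[of n] by (intro circle_mean_le_h2norm f) auto
    finally have "(LINT t|circ. h t) \<le> h2norm f"
      using h2norm_nonneg[OF f] by (rule power2_le_imp_le)
    then have "integral {0..2*pi} h \<le> 2 * pi * h2norm f"
      unfolding integral_circ_eq[OF ch] by (simp add: field_simps)
    then have "15 / l * integral {0..2*pi} h \<le> 15 / l * (2 * pi * h2norm f)"
      using l by (intro mult_left_mono) auto
    then have "emeasure lborel S \<le> ennreal (30 * pi / l * h2norm f)"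
      using S(2) by (auto elim!: order_trans intro!: ennreal_leI)
    moreover have "cmod (f (of_real (\<rho> n * r) * cis t)) \<le> 18 * l"
      if "t \<in> {0..2*pi}" "t \<notin> S" "1/2 \<le> r" "r < 1" for t r
      using radial_maximal_bound[OF g R that(3,4) l, of t] S(3)[OF that(1,2)]
      unfolding h_def g_def by (simp add: mult.assoc)
    ultimately show ?thesis using S(1) by blast
  qed
  then obtain S where S: "\<And>n. S n \<in> sets borel" "\<And>n. emeasure lborel (S n) \<le> ennreal (30 * pi / l * h2norm f)"
    "\<And>n t r. t \<in> {0..2*pi} \<Longrightarrow> t \<notin> S n \<Longrightarrow> 1/2 \<le> r \<Longrightarrow> r < 1 \<Longrightarrow> cmod (f (of_real (\<rho> n * r) * cis t)) \<le> 18 * l"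
    by metis
  show ?thesis
  \<comment> \<open>The lower limit of the sets keeps the common measure bound, being an increasing
    union of subsets of the \<open>S N\<close>. A point outside it avoids \<open>S n\<close> for
    arbitrarily large n, so any r < 1 can be written as \<open>\<rho> n\<close> times a radius that
    is still below 1.\<close>
  proof (rule that[of "\<Union>N. \<Inter>n\<in>{N..}. S n"])
    show "(\<Union>N. \<Inter>n\<in>{N..}. S n) \<in> sets borel"
      using S(1) by (intro sets.countable_UN sets.countable_INT') auto
    have "emeasure lborel (\<Union>N. \<Inter>n\<in>{N..}. S n) = (SUP N. emeasure lborel (\<Inter>n\<in>{N..}. S n))"
      using S(1) by (intro SUP_emeasure_incseq[symmetric])
        (auto intro!: sets.countable_INT' simp: incseq_def)
    also have "\<dots> \<le> ennreal (30 * pi / l * h2norm f)"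
    proof (rule SUP_least)
      fix N
      have "emeasure lborel (\<Inter>n\<in>{N..}. S n) \<le> emeasure lborel (S N)"
        using S(1) by (intro emeasure_mono) auto
      then show "emeasure lborel (\<Inter>n\<in>{N..}. S n) \<le> ennreal (30 * pi / l * h2norm f)"
        using S(2)[of N] by simp
    qed
    finally show "emeasure lborel (\<Union>N. \<Inter>n\<in>{N..}. S n) \<le> ennreal (30 * pi / l * h2norm f)" .
    fix t r :: real assume t: "t \<in> {0..2*pi}" "t \<notin> (\<Union>N. \<Inter>n\<in>{N..}. S n)" and r: "1/2 \<le> r" "r < 1"
    obtain N where N: "\<And>n. n \<ge> N \<Longrightarrow> \<rho> n > r"
      using order_tendstoD(1)[OF lim r(2)] by (auto simp: eventually_sequentially)
    obtain n where n: "n \<ge> N" "t \<notin> S n" using t(2) by auto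
    have "1/2 \<le> r / \<rho> n"
    proof -
      have "r \<le> r / \<rho> n" using \<rho>[of n] r by (simp add: field_simps)
      with r(1) show ?thesis by (rule order_trans)
    qed
    moreover have "r / \<rho> n < 1" using N[OF n(1)] \<rho>[of n] by (simp add: field_simps)
    ultimately have "cmod (f (of_real (\<rho> n * (r / \<rho> n)) * cis t)) \<le> 18 * l"
      by (rule S(3)[OF t(1) n(2)])
    then show "cmod (f (of_real r * cis t)) \<le> 18 * l" using \<rho>(1)[of n] by simp
  qed
qed

text \<open>For polynomials the radial limit is clear; the maximal inequality controls the error of
  polynomial approximation on the whole radius at once, outside a small set. Borel-Cantelli then
  leaves almost every angle outside all but finitely many of these sets, and there f satisfies the
  Cauchy criterion along the radius.\<close>

theorem radial_limit_exists_AE: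
  assumes f: "f \<in> H2"
  shows "AE t in circ. ((\<lambda>r::real. f (of_real r * cis t)) \<longlongrightarrow> radial_limit f t) (at_left 1)"
proof -
  have hol: "f holomorphic_on unit_disc" using f by (simp add: H2_def)
  define p where "p = (\<lambda>N z. \<Sum>i<N. taylor_coeff f i * z ^ i)"
  have hp: "p N holomorphic_on A" for N A unfolding p_def by (intro holomorphic_intros)
  have tail: "(\<lambda>z. f z - p N z) \<in> H2 \<and> (h2norm (\<lambda>z. f z - p N z))\<^sup>2 = (\<Sum>n. (cmod (taylor_coeff f (n + N)))\<^sup>2)" for N
  proof -
    have tc: "taylor_coeff (\<lambda>z. f z - p N z) n = (if n < N then 0 else taylor_coeff f n)" for n
      by (subst taylor_coeff_diff[OF hol hp]) (simp add: p_def taylor_coeff_poly)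
    have sm: "summable (\<lambda>n. (cmod (taylor_coeff f n))\<^sup>2)" using f by (simp add: H2_def)
    have sm': "summable (\<lambda>n. (cmod (if n < N then 0 else taylor_coeff f n))\<^sup>2)"
      by (rule summable_comparison_test'[OF sm, of 0]) auto
    have "(\<Sum>n. (cmod (if n < N then 0 else taylor_coeff f n))\<^sup>2) = (\<Sum>n. (cmod (taylor_coeff f (n + N)))\<^sup>2)"
      using suminf_minus_initial_segment[OF sm', of N] by simp
    moreover have "(\<lambda>z. f z - p N z) \<in> H2"
      using hol hp sm' unfolding H2_def by (auto simp: tc intro!: holomorphic_intros)
    ultimately show ?thesis using h2norm_square[of "\<lambda>z. f z - p N z"] by (simp add: tc sums_iff)
  qed
  have lim: "(\<lambda>N. \<Sum>n. (cmod (taylor_coeff f (n + N)))\<^sup>2) \<longlonglongrightarrow> 0"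
    using f suminf_exist_split2 by (auto simp: H2_def)
  \<comment> \<open>Norms below 4^-k are tested against the level 2^-k, so both the exceptional
    measures and the pointwise errors are of order 2^-k.\<close>
  have "\<exists>N. h2norm (\<lambda>z. f z - p N z) \<le> (1/4) ^ k" for k
  proof -
    have "((1/4::real) ^ k)\<^sup>2 > 0" by simp
    from order_tendstoD(2)[OF lim this] obtain N
      where "(\<Sum>n. (cmod (taylor_coeff f (n + N)))\<^sup>2) < ((1/4::real) ^ k)\<^sup>2"
      by (auto simp: eventually_sequentially)
    then have "(h2norm (\<lambda>z. f z - p N z))\<^sup>2 \<le> ((1/4::real) ^ k)\<^sup>2" using tail[of N] by simp
    then have "h2norm (\<lambda>z. f z - p N z) \<le> (1/4) ^ k" by (rule power2_le_imp_le) simp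
    then show ?thesis ..
  qed
  then obtain N where N: "\<And>k. h2norm (\<lambda>z. f z - p (N k) z) \<le> (1/4) ^ k" by metis
  have "\<exists>S. S \<in> sets borel \<and> emeasure lborel S \<le> ennreal (30 * pi * (1/2) ^ k) \<and>
    (\<forall>t r. t \<in> {0..2*pi} \<longrightarrow> t \<notin> S \<longrightarrow> 1/2 \<le> r \<longrightarrow> r < 1 \<longrightarrow>
       cmod (f (of_real r * cis t) - p (N k) (of_real r * cis t)) \<le> 18 * (1/2) ^ k)" for k
  proof -
    obtain S where S: "S \<in> sets borel"
       "emeasure lborel S \<le> ennreal (30 * pi / (1/2) ^ k * h2norm (\<lambda>z. f z - p (N k) z))"
       "\<And>t r. t \<in> {0..2*pi} \<Longrightarrow> t \<notin> S \<Longrightarrow> 1/2 \<le> r \<Longrightarrow> r < 1 \<Longrightarrow>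
         cmod (f (of_real r * cis t) - p (N k) (of_real r * cis t)) \<le> 18 * (1/2) ^ k"
      using H2_maximal_inequality[of "\<lambda>z. f z - p (N k) z" "(1/2) ^ k"] tail[of "N k"] by auto
    have "30 * pi / (1/2) ^ k * h2norm (\<lambda>z. f z - p (N k) z) \<le> 30 * pi / (1/2) ^ k * (1/4) ^ k"
      by (intro mult_left_mono N) auto
    also have "\<dots> = 30 * pi * (1/2) ^ k"
      by (simp add: power_one_over field_simps flip: power_mult_distrib)
    finally show ?thesis using S by (auto elim!: order_trans intro!: ennreal_leI)
  qed
  then obtain S where S: "\<And>k. S k \<in> sets borel" "\<And>k. emeasure lborel (S k) \<le> ennreal (30 * pi * (1/2) ^ k)"
    "\<And>k t r. t \<in> {0..2*pi} \<Longrightarrow> t \<notin> S k \<Longrightarrow> 1/2 \<le> r \<Longrightarrow> r < 1 \<Longrightarrow>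
       cmod (f (of_real r * cis t) - p (N k) (of_real r * cis t)) \<le> 18 * (1/2) ^ k"
    by metis
  have "AE t in lborel. eventually (\<lambda>k. t \<in> space lborel - S k) sequentially"
  proof (rule borel_cantelli_AE1)
    show "S k \<in> sets lborel" for k using S by simp
    show "emeasure lborel (S k) < \<infinity>" for k using S(2)[of k] by (auto simp: less_top[symmetric] top_unique)
    show "summable (\<lambda>k. measure lborel (S k))"
    proof (rule summable_comparison_test'[where N=0])
      show "summable (\<lambda>k. 30 * pi * (1/2) ^ k)" by (intro summable_mult summable_geometric) auto
      show "norm (measure lborel (S k)) \<le> 30 * pi * (1/2) ^ k" for k
        using S(2)[of k] by (simp add: measure_def enn2real_leI)
    qed
  qed
  then show ?thesis unfolding AE_circ_iff
  proof (rule eventually_mono, intro impI)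
    fix t assume ev: "eventually (\<lambda>k. t \<in> space lborel - S k) sequentially" and t: "t \<in> {0..2*pi}"
    define F where "F = (\<lambda>r::real. f (of_real r * cis t))"
    have "cauchy_filter (filtermap F (at_left 1))"
      unfolding cauchy_filter_metric_filtermap
    proof (intro allI impI)
      fix e :: real assume e: "e > 0"
      have "(\<lambda>k. 18 * (1/2::real) ^ k) \<longlonglongrightarrow> 0"
        by (rule tendsto_eq_intros LIMSEQ_power_zero refl | simp)+
      then have "\<forall>\<^sub>F k in sequentially. 18 * (1/2::real) ^ k < e / 3"
        by (rule order_tendstoD) (use e in auto)
      with ev have "\<forall>\<^sub>F k in sequentially. t \<notin> S k \<and> 18 * (1/2::real) ^ k < e / 3"
        by eventually_elim auto
      then obtain k where k: "t \<notin> S k" "18 * (1/2::real) ^ k < e / 3"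
        by (auto simp: eventually_sequentially)
      define G where "G = (\<lambda>r::real. p (N k) (of_real r * cis t))"
      have "isCont G 1" unfolding G_def p_def by (intro continuous_intros)
      then have "(G \<longlongrightarrow> G 1) (at_left 1)"
        unfolding isCont_def by (rule filterlim_mono) (auto simp: at_within_le_at)
      then have G: "\<forall>\<^sub>F r in at_left 1. dist (G r) (G 1) < e / 6"
        using e by (intro tendstoD) auto
      have "\<forall>\<^sub>F r in at_left (1::real). r \<in> {1/2<..<1}"
        by (rule eventually_at_leftI[of "1/2"]) auto
      with G have P: "\<forall>\<^sub>F r in at_left 1. dist (G r) (G 1) < e / 6 \<and> 1/2 \<le> r \<and> r < 1"
        by eventually_elim auto
      show "\<exists>P. eventually P (at_left 1) \<and> (\<forall>x y. P x \<and> P y \<longrightarrow> dist (F x) (F y) < e)"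
      proof (intro exI conjI allI impI, rule P)
        fix x y assume xy: "(dist (G x) (G 1) < e / 6 \<and> 1/2 \<le> x \<and> x < 1) \<and> (dist (G y) (G 1) < e / 6 \<and> 1/2 \<le> y \<and> y < 1)"
        have "dist (F x) (G x) < e / 3" "dist (F y) (G y) < e / 3"
          using S(3)[OF t k(1), of x] S(3)[OF t k(1), of y] xy k(2) by (auto simp: dist_norm F_def G_def)
        then show "dist (F x) (F y) < e"
          using xy by metric
      qed
    qed
    then obtain c where "filtermap F (at_left 1) \<le> nhds c"
      using cauchy_filter_complete_converges[of "filtermap F (at_left 1)" UNIV]
      by (auto simp: complete_UNIV filtermap_bot_iff)
    then have "(F \<longlongrightarrow> c) (at_left 1)" by (simp add: filterlim_def)
    then show "((\<lambda>r::real. f (of_real r * cis t)) \<longlongrightarrow> radial_limit f t) (at_left 1)"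
      unfolding radial_limit_def F_def by (simp add: tendsto_Lim)
  qed
qed

subsection \<open>The logarithmic integral\<close>

text \<open>Fatou's lemma, dominated convergence and measurability of limits need a sequence of
  radii. It starts at 1/2 because the later estimates hold only for r >= 1/2.\<close>

definition radius :: "nat \<Rightarrow> real" where
  "radius n = 1 - inverse (real (Suc (Suc n)))"

lemma radius: "1/2 \<le> radius n" "0 \<le> radius n" "radius n < 1"
proof -
  have "inverse (real (Suc (Suc n))) \<le> inverse 2" by (intro le_imp_inverse_le) auto
  then show "1/2 \<le> radius n" by (simp add: radius_def)
  then show "0 \<le> radius n" by simp
  show "radius n < 1" by (simp add: radius_def)
qed

lemma tendsto_radius: "radius \<longlonglongrightarrow> 1"
  unfolding radius_def
  by (rule tendsto_eq_intros LIMSEQ_Suc[OF LIMSEQ_inverse_real_of_nat] refl | simp)+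

lemma filterlim_radius: "filterlim radius (at_left 1) sequentially"
  using tendsto_radius radius(3) by (auto simp: filterlim_at intro!: always_eventually dest: less_imp_neq)

text \<open>The term at n = 0 is a division by zero and hence 0, so the series may be indexed from
  0. The same convention holds for all sums with coefficients 1 / n below.\<close>

lemma ln_one_minus_sums:
  fixes y :: real
  assumes "0 \<le> y" "y < 1"
  shows "(\<lambda>n. y ^ n / n) sums ln (1 / (1 - y))"
proof -
  have "(\<lambda>n. - ((- (- y)) ^ n) / of_nat n) sums ln (1 + (- y))"
    by (rule ln_series') (use assms in auto)
  from sums_minus[OF this] show ?thesis using assms by (simp add: ln_div)
qed

section \<open>Boundary values of a self-map and its logarithmic integral\<close>

locale self_map =
  fixes \<phi> :: "complex \<Rightarrow> complex"
  assumes hol: "\<phi> holomorphic_on unit_disc" and ran: "\<phi> ` unit_disc \<subseteq> unit_disc"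
begin

lemma norm_less_1: "cmod z < 1 \<Longrightarrow> cmod (\<phi> z) < 1"
  using ran by (auto simp: image_subset_iff)

lemma norm_circle_less_1: "0 \<le> r \<Longrightarrow> r < 1 \<Longrightarrow> cmod (\<phi> (of_real r * cis t)) < 1"
  by (rule norm_less_1) (simp add: norm_mult)

lemma power_H2: "(\<lambda>z. \<phi> z ^ n) \<in> H2"
  by (rule H2_if_bounded[where B=1])
     (use norm_less_1 in \<open>auto intro!: holomorphic_intros hol power_le_one simp: norm_power less_imp_le\<close>)

lemma self_H2: "\<phi> \<in> H2" using power_H2[of 1] by simp

text \<open>A limit along one sequence of continuous functions, hence Borel measurable on the whole
  line. It stands in for \<open>radial_limit\<close>, with which it agrees almost
  everywhere.\<close>

definition boundary :: "real \<Rightarrow> complex" where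
  "boundary t = lim (\<lambda>n. \<phi> (of_real (radius n) * cis t))"

lemma borel_measurable_circle [measurable]:
  "(\<lambda>t. \<phi> (of_real (radius n) * cis t)) \<in> borel_measurable borel"
  by (intro borel_measurable_continuous_onI continuous_on_circle hol radius)

lemma borel_measurable_boundary [measurable]: "boundary \<in> borel_measurable borel"
  unfolding boundary_def by (rule borel_measurable_lim_metric) simp

lemma AE_boundary:
  "AE t in circ. (\<lambda>n. \<phi> (of_real (radius n) * cis t)) \<longlonglongrightarrow> boundary t \<and> boundary t = radial_limit \<phi> t
     \<and> cmod (boundary t) \<le> 1"
  using radial_limit_exists_AE[OF self_H2]
proof (rule eventually_mono)
  fix t assume "((\<lambda>r::real. \<phi> (of_real r * cis t)) \<longlongrightarrow> radial_limit \<phi> t) (at_left 1)"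
  from filterlim_compose[OF this filterlim_radius]
  have *: "(\<lambda>n. \<phi> (of_real (radius n) * cis t)) \<longlonglongrightarrow> radial_limit \<phi> t" .
  then have "boundary t = radial_limit \<phi> t" unfolding boundary_def by (rule limI)
  moreover have "cmod (radial_limit \<phi> t) \<le> 1"
    using norm_circle_less_1[OF radius(2,3), of _ t]
    by (intro LIMSEQ_le_const2[OF tendsto_norm[OF *]]) (auto intro: less_imp_le)
  ultimately show "(\<lambda>n. \<phi> (of_real (radius n) * cis t)) \<longlonglongrightarrow> boundary t \<and> boundary t = radial_limit \<phi> t
     \<and> cmod (boundary t) \<le> 1" using * by simp
qed

lemma log_integral_eq:
  "log_integral \<phi> = (\<integral>\<^sup>+t. (if cmod (boundary t) < 1
      then ennreal (ln (1 / (1 - cmod (boundary t)))) else \<infinity>) \<partial>circ)"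
proof -
  let ?G = "\<lambda>x. if x < 1 then ennreal (ln (1 / (1 - x))) else \<infinity>"
  have "AE t in lborel. t \<in> {0..2*pi} \<longrightarrow> boundary t = radial_limit \<phi> t"
    using AE_boundary unfolding AE_circ_iff by (auto elim!: eventually_mono)
  then have "(\<integral>\<^sup>+t\<in>{0..2*pi}. ?G (cmod (radial_limit \<phi> t)) \<partial>lborel) =
     (\<integral>\<^sup>+t\<in>{0..2*pi}. ?G (cmod (boundary t)) \<partial>lborel)"
    by (intro nn_integral_cong_AE) (auto elim!: eventually_mono split: split_indicator)
  moreover have "(\<integral>\<^sup>+t. ?G (cmod (boundary t)) \<partial>circ) = 
     (\<integral>\<^sup>+t\<in>{0..2*pi}. ?G (cmod (boundary t)) \<partial>lborel) / ennreal (2*pi)"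
    unfolding circ_def by (subst nn_integral_uniform_measure) auto
  moreover have "inverse (ennreal (2*pi)) = ennreal (1 / (2*pi))"
    by (subst inverse_ennreal) (auto simp: inverse_eq_divide)
  ultimately show ?thesis unfolding log_integral_def
    by (simp only: divide_ennreal_def mult.commute)
qed

text \<open>Fatou's lemma along \<open>radius\<close>. Where the boundary value has modulus 1 the
  integrand is infinite, and there the logarithms inside the disk do tend to infinity, so the
  comparison with the lower limit holds at those angles too.\<close>

lemma log_integral_finite_if_circle_means:
  assumes B: "\<And>r. 1/2 \<le> r \<Longrightarrow> r < 1 \<Longrightarrow> (LINT t|circ. ln (1 / (1 - cmod (\<phi> (of_real r * cis t))))) \<le> B"
  shows "log_integral \<phi> < \<infinity>"
proof -
  let ?G = "\<lambda>x. if x < 1 then ennreal (ln (1 / (1 - x))) else \<infinity>"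
  let ?x = "\<lambda>n t. cmod (\<phi> (of_real (radius n) * cis t))"
  have x1: "?x n t < 1" for n t by (intro norm_circle_less_1 radius)
  have "(\<integral>\<^sup>+t. ?G (cmod (boundary t)) \<partial>circ) \<le> (\<integral>\<^sup>+t. liminf (\<lambda>n. ennreal (ln (1 / (1 - ?x n t)))) \<partial>circ)"
  proof (rule nn_integral_mono_AE, rule eventually_mono[OF AE_boundary])
    fix t assume "(\<lambda>n. \<phi> (of_real (radius n) * cis t)) \<longlonglongrightarrow> boundary t \<and> boundary t = radial_limit \<phi> t
     \<and> cmod (boundary t) \<le> 1"
    then have lim: "(\<lambda>n. ?x n t) \<longlonglongrightarrow> cmod (boundary t)" and le: "cmod (boundary t) \<le> 1"
      by (auto intro!: tendsto_intros)
    show "?G (cmod (boundary t)) \<le> liminf (\<lambda>n. ennreal (ln (1 / (1 - ?x n t))))"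
    proof (cases "cmod (boundary t) < 1")
      case True
      have "(\<lambda>n. ennreal (ln (1 / (1 - ?x n t)))) \<longlonglongrightarrow> ennreal (ln (1 / (1 - cmod (boundary t))))"
        using True by (intro tendsto_intros lim) auto
      from lim_imp_Liminf[OF _ this] show ?thesis using True by simp
    next
      case False
      with le have b: "cmod (boundary t) = 1" by simp
      have "filterlim (\<lambda>n. 1 - ?x n t) (at_right 0) sequentially"
        using tendsto_diff[OF tendsto_const[of 1] lim] x1[of _ t] unfolding b
        by (auto simp: filterlim_at intro!: always_eventually dest: less_imp_neq)
      then have "filterlim (\<lambda>n. - ln (1 - ?x n t)) at_top sequentially"
        by (intro filterlim_compose[OF filterlim_uminus_at_top_at_bot] filterlim_compose[OF ln_at_0])
      then have "filterlim (\<lambda>n. ln (1 / (1 - ?x n t))) at_top sequentially"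
        using less_imp_neq[OF x1[of _ t]] by (simp add: ln_div)
      then have "(\<lambda>n. ennreal (ln (1 / (1 - ?x n t)))) \<longlonglongrightarrow> \<infinity>"
        by (simp add: ennreal_tendsto_top_eq_at_top)
      from lim_imp_Liminf[OF _ this] show ?thesis by simp
    qed
  qed
  also have "\<dots> \<le> liminf (\<lambda>n. \<integral>\<^sup>+t. ennreal (ln (1 / (1 - ?x n t))) \<partial>circ)"
    by (rule nn_integral_liminf) simp
  also have "\<dots> \<le> ennreal B"
  proof (rule order_trans[OF Liminf_le_Limsup Limsup_bounded])
    show "\<forall>\<^sub>F n in sequentially. (\<integral>\<^sup>+t. ennreal (ln (1 / (1 - ?x n t))) \<partial>circ) \<le> ennreal B"
    proof (rule always_eventually, rule allI)
      fix n
      have c: "continuous_on UNIV (\<lambda>t. ln (1 / (1 - ?x n t)))"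
        using x1[of n] by (intro continuous_intros continuous_on_circle hol radius) (auto simp: less_imp_neq dest: less_imp_neq)
      have "ln (1 / (1 - ?x n t)) \<ge> 0" for t using x1[of n t] by (intro ln_ge_zero) (auto simp: field_simps)
      then have "(\<integral>\<^sup>+t. ennreal (ln (1 / (1 - ?x n t))) \<partial>circ) = ennreal (LINT t|circ. ln (1 / (1 - ?x n t)))"
        by (intro nn_integral_eq_integral integrable_circ c) auto
      also have "\<dots> \<le> ennreal B" by (intro ennreal_leI B radius)
      finally show "(\<integral>\<^sup>+t. ennreal (ln (1 / (1 - ?x n t))) \<partial>circ) \<le> ennreal B" .
    qed
  qed simp
  finally show ?thesis unfolding log_integral_eq by (auto simp: less_top[symmetric] top_unique)
qed

lemma h2norm_power_eq:
  "(h2norm (\<lambda>z. \<phi> z ^ n))\<^sup>2 = (LINT t|circ. cmod (boundary t) ^ (2*n))"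
proof (rule LIMSEQ_unique)
  show "(\<lambda>k. LINT t|circ. (cmod (\<phi> (of_real (radius k) * cis t) ^ n))\<^sup>2) \<longlonglongrightarrow> (h2norm (\<lambda>z. \<phi> z ^ n))\<^sup>2"
    by (rule filterlim_compose[OF tendsto_circle_mean[OF power_H2] filterlim_radius])
  have eq: "(cmod (z ^ n))\<^sup>2 = cmod z ^ (2*n)" for z
    by (simp add: norm_power power_mult[symmetric] mult.commute)
  show "(\<lambda>k. LINT t|circ. (cmod (\<phi> (of_real (radius k) * cis t) ^ n))\<^sup>2) \<longlonglongrightarrow> (LINT t|circ. cmod (boundary t) ^ (2*n))"
    unfolding eq
  proof (rule integral_dominated_convergence[where w="\<lambda>_. 1"])
    show "AE t in circ. (\<lambda>k. cmod (\<phi> (of_real (radius k) * cis t)) ^ (2*n)) \<longlonglongrightarrow> cmod (boundary t) ^ (2*n)"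
      using AE_boundary by (rule eventually_mono) (auto intro!: tendsto_intros)
    show "AE t in circ. norm (cmod (\<phi> (of_real (radius k) * cis t)) ^ (2*n)) \<le> 1" for k
      using norm_circle_less_1[OF radius(2,3)] by (intro AE_I2) (auto intro!: power_le_one simp: less_imp_le)
  qed auto
qed

text \<open>Only partial sums are integrated, so sum and integral are never interchanged in the
  limit. Pointwise, x^2 <= x puts the series in x^2 below log (1 / (1 - x)), and for x >= 1 the
  right side is infinite.\<close>

lemma summable_if_log_integral_finite:
  assumes "log_integral \<phi> < \<infinity>"
  shows "summable (\<lambda>n. (h2norm (\<lambda>z. \<phi> z ^ n))\<^sup>2 / n)"
proof -
  let ?G = "\<lambda>x. if x < 1 then ennreal (ln (1 / (1 - x))) else \<infinity>"
  obtain B where B: "log_integral \<phi> = ennreal B" "B \<ge> 0"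
    using assms by (cases "log_integral \<phi>") auto
  have i: "integrable circ (\<lambda>t. cmod (boundary t) ^ (2*n))" for n
    by (rule circ.integrable_const_bound[where B=1])
       (auto intro!: power_le_one eventually_mono[OF AE_boundary])
  have G: "ennreal (\<Sum>n<N. x ^ (2*n) / n) \<le> ?G x" if "0 \<le> x" for x N
  proof (cases "x < 1")
    case True
    have x2: "x\<^sup>2 < 1" using True that by (simp add: power_less_one_iff abs_square_less_1)
    have s: "(\<lambda>n. (x\<^sup>2) ^ n / n) sums ln (1 / (1 - x\<^sup>2))"
      by (rule ln_one_minus_sums) (use x2 in auto)
    have "(\<Sum>n<N. x ^ (2*n) / n) = (\<Sum>n<N. (x\<^sup>2) ^ n / n)" by (simp add: power_mult)
    also have "\<dots> \<le> ln (1 / (1 - x\<^sup>2))"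
      unfolding sums_unique[OF s] by (rule sum_le_suminf) (use s in \<open>auto simp: sums_iff\<close>)
    also have "\<dots> \<le> ln (1 / (1 - x))"
      using True that x2 by (auto intro!: divide_left_mono simp: power2_eq_square mult_left_le)
    finally show ?thesis using True by (simp add: ennreal_leI)
  qed simp
  have *: "(\<Sum>n<N. (h2norm (\<lambda>z. \<phi> z ^ n))\<^sup>2 / n) \<le> B" for N
  proof -
    have "ennreal (\<Sum>n<N. (h2norm (\<lambda>z. \<phi> z ^ n))\<^sup>2 / n) = ennreal (LINT t|circ. (\<Sum>n<N. cmod (boundary t) ^ (2*n) / n))"
      unfolding h2norm_power_eq using i by simp
    also have "\<dots> = (\<integral>\<^sup>+t. ennreal (\<Sum>n<N. cmod (boundary t) ^ (2*n) / n) \<partial>circ)"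
      using i by (intro nn_integral_eq_integral[symmetric] AE_I2 sum_nonneg) auto
    also have "\<dots> \<le> log_integral \<phi>"
      unfolding log_integral_eq by (intro nn_integral_mono G) auto
    finally show ?thesis using B by simp
  qed
  show ?thesis
    by (rule bounded_imp_summable[of _ B]) (use *[of "Suc _"] in \<open>auto simp: lessThan_Suc_atMost\<close>)
qed

end

subsection \<open>Weights dominated by powers of the defect\<close>

text \<open>The kernel (zeta + z) / (zeta - z) has the Poisson kernel as its real part. Written as 2
  zeta / (zeta - z) - 1, it reduces holomorphy to that of the Cauchy integral \<open>A\<close> of a
  continuous function.\<close>

lemma schwarz_integral:
  fixes u :: "complex \<Rightarrow> real"
  assumes u: "continuous_on (sphere 0 1) u"
  obtains h where "h holomorphic_on unit_disc"
    "\<And>z. cmod z < 1 \<Longrightarrow> Re (h z) = (LINT t|circ. poisson z (cis t) * u (cis t))"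
proof -
  define A where "A = (\<lambda>z. LINT t|circ. of_real (u (cis t)) * cis t / (cis t - z))"
  define m where "m = (LINT t|circ. complex_of_real (u (cis t)))"
  define h where "h = (\<lambda>z. 2 * A z - m)"
  have c1: "continuous_on (sphere 0 1) (\<lambda>\<zeta>. of_real (u \<zeta>) * \<zeta> / (\<zeta> - z))" if "cmod z < 1" for z
    using that by (intro continuous_intros u) auto
  have A: "((\<lambda>\<zeta>. of_real (u \<zeta>) / (\<zeta> - z) ^ 1) has_contour_integral (2 * of_real pi * \<i> * A z)) (circlepath 0 1)"
    if "z \<in> ball 0 1" for z
  proof -
    have "((\<lambda>\<zeta>. (of_real (u \<zeta>) * \<zeta> / (\<zeta> - z)) / \<zeta>) has_contour_integral (2 * of_real pi * \<i> * A z)) (circlepath 0 1)"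
      unfolding A_def by (rule has_contour_integral_circ[OF c1]) (use that in simp)
    then show ?thesis
      by (rule has_contour_integral_eq) auto
  qed
  have "(\<lambda>z. 2 * of_real pi * \<i> * A z) holomorphic_on unit_disc"
  proof (rule holomorphic_onI)
    fix z :: complex assume z: "z \<in> unit_disc"
    have "\<exists>D. ((\<lambda>z. 2 * of_real pi * \<i> * A z) has_field_derivative D) (at z)"
      by (rule exI, rule Cauchy_next_derivative_circlepath(2)[where k=1 and f="\<lambda>\<zeta>. of_real (u \<zeta>)" and r=1 and z=0])
         (use A z u in \<open>auto intro!: continuous_intros\<close>)
    then show "(\<lambda>z. 2 * of_real pi * \<i> * A z) field_differentiable at z within unit_disc"
      by (meson field_differentiable_def field_differentiable_at_within)
  qed
  then have "(\<lambda>z. (2 * of_real pi * \<i> * A z) / (2 * of_real pi * \<i>)) holomorphic_on unit_disc"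
    by (rule holomorphic_on_divide) auto
  moreover have "(\<lambda>z. (2 * of_real pi * \<i> * A z) / (2 * of_real pi * \<i>)) = A" by auto
  ultimately have "A holomorphic_on unit_disc" by (simp only:)
  then have "h holomorphic_on unit_disc" unfolding h_def by (intro holomorphic_intros)
  moreover have "Re (h z) = (LINT t|circ. poisson z (cis t) * u (cis t))" if z: "cmod z < 1" for z
  proof -
    have i1: "integrable circ (\<lambda>t. of_real (u (cis t)) * cis t / (cis t - z))"
      by (intro integrable_circ continuous_on_cis_comp c1 z)
    have i2: "integrable circ (\<lambda>t. complex_of_real (u (cis t)))"
      by (intro integrable_circ continuous_intros continuous_on_cis_comp u)
    have "h z = (LINT t|circ. 2 * (of_real (u (cis t)) * cis t / (cis t - z)) - of_real (u (cis t)))"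
      unfolding h_def A_def m_def using i1 i2
      by (simp only: Bochner_Integration.integral_diff integrable_mult_right integral_mult_right_zero)
    then have "Re (h z) = (LINT t|circ. Re (2 * (of_real (u (cis t)) * cis t / (cis t - z)) - of_real (u (cis t))))"
      using i1 i2 by (simp only: integral_Re Bochner_Integration.integrable_diff integrable_mult_right)
    also have "\<dots> = (LINT t|circ. poisson z (cis t) * u (cis t))"
    proof (rule Bochner_Integration.integral_cong[OF refl])
      fix t
      define \<zeta> where "\<zeta> = cis t"
      have \<zeta>: "cmod \<zeta> = 1" by (simp add: \<zeta>_def)
      then have ne: "\<zeta> - z \<noteq> 0" using z by auto
      have aux: "Re (of_real a * (x / of_real b)) = a * (Re x / b)" for a b x by simp
      have "2 * (of_real (u \<zeta>) * \<zeta> / (\<zeta> - z)) - of_real (u \<zeta>) = of_real (u \<zeta>) * ((\<zeta> + z) / (\<zeta> - z))"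
        using ne by (simp add: field_simps)
      also have "(\<zeta> + z) / (\<zeta> - z) = ((\<zeta> + z) * cnj (\<zeta> - z)) / of_real ((cmod (\<zeta> - z))\<^sup>2)"
        using ne unfolding complex_norm_square by simp
      finally have "Re (2 * (of_real (u \<zeta>) * \<zeta> / (\<zeta> - z)) - of_real (u \<zeta>)) =
          u \<zeta> * (Re ((\<zeta> + z) * cnj (\<zeta> - z)) / (cmod (\<zeta> - z))\<^sup>2)"
        by (simp only: aux)
      also have "Re ((\<zeta> + z) * cnj (\<zeta> - z)) = (cmod \<zeta>)\<^sup>2 - (cmod z)\<^sup>2"
        by (simp add: cmod_power2) (simp add: algebra_simps power2_eq_square)
      finally show "Re (2 * (of_real (u (cis t)) * cis t / (cis t - z)) - of_real (u (cis t))) = poisson z (cis t) * u (cis t)"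
        by (simp add: \<zeta>_def[symmetric] \<zeta> poisson_def)
    qed
    finally show ?thesis .
  qed
  ultimately show ?thesis by (rule that)
qed

section \<open>Exponential weights for a self-map\<close>

context self_map
begin

lemma dilation_holomorphic:
  assumes "0 < \<rho>" "\<rho> < 1"
  shows "(\<lambda>z. \<phi> (of_real \<rho> * z) ^ n) holomorphic_on ball 0 (1 / \<rho>)"
proof -
  have "(\<lambda>z. \<phi> (of_real \<rho> * z)) holomorphic_on ball 0 (1 / \<rho>)"
    by (rule holomorphic_on_compose_gen[OF _ hol, of _ "ball 0 (1 / \<rho>)", unfolded o_def])
       (use assms in \<open>auto intro!: holomorphic_intros simp: norm_mult field_simps\<close>)
  then show ?thesis by (intro holomorphic_intros)
qed

text \<open>The weight is exp (- h), where Re h is the Poisson average of u, the weighted sum of the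
  |phi^n|^2 for the dilated map. By \<open>poisson_norm_square_le\<close> this average is at least u
  inside the disk, which bounds the weight from above; at 0 it is a plain circle mean, which bounds
  the weight there from below.\<close>

lemma finite_weight:
  fixes c :: "nat \<Rightarrow> real"
  assumes c: "\<And>n. c n \<ge> 0" and \<rho>: "0 < \<rho>" "\<rho> < 1"
  obtains w where "w holomorphic_on unit_disc"
    "\<And>z. cmod z < 1 \<Longrightarrow> cmod (w z) \<le> exp (- (\<Sum>n<J. c n * cmod (\<phi> (of_real \<rho> * z)) ^ (2*n)))"
    "cmod (w 0) \<ge> exp (- (\<Sum>n<J. c n * (h2norm (\<lambda>z. \<phi> z ^ n))\<^sup>2))"
proof -
  let ?g = "\<lambda>n z. \<phi> (of_real \<rho> * z) ^ n"
  have sq: "cmod z ^ (2*n) = (cmod (z ^ n))\<^sup>2" for z n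
    by (simp add: norm_power power_mult[symmetric] mult.commute)
  have cont: "continuous_on (sphere 0 1) (?g n)" for n
    by (rule continuous_on_subset[OF holomorphic_on_imp_continuous_on[OF dilation_holomorphic[OF \<rho>]]])
       (use \<rho> in auto)
  define u where "u = (\<lambda>\<zeta>. \<Sum>n<J. c n * (cmod (?g n \<zeta>))\<^sup>2)"
  have "continuous_on (sphere 0 1) u"
    unfolding u_def by (intro continuous_intros cont)
  then obtain h where h: "h holomorphic_on unit_disc"
    "\<And>z. cmod z < 1 \<Longrightarrow> Re (h z) = (LINT t|circ. poisson z (cis t) * u (cis t))"
    by (rule schwarz_integral) blast
  have i: "integrable circ (\<lambda>t. c n * (poisson z (cis t) * (cmod (?g n (cis t)))\<^sup>2))" if "cmod z < 1" for n z
    by (intro integrable_circ continuous_on_cis_comp continuous_intros cont continuous_on_poisson that)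
  have Re: "Re (h z) = (\<Sum>n<J. c n * (LINT t|circ. poisson z (cis t) * (cmod (?g n (cis t)))\<^sup>2))" if "cmod z < 1" for z
  proof -
    have "Re (h z) = (LINT t|circ. (\<Sum>n<J. c n * (poisson z (cis t) * (cmod (?g n (cis t)))\<^sup>2)))"
      unfolding h(2)[OF that] u_def by (simp add: sum_distrib_left mult_ac)
    also have "\<dots> = (\<Sum>n<J. (LINT t|circ. c n * (poisson z (cis t) * (cmod (?g n (cis t)))\<^sup>2)))"
      by (rule Bochner_Integration.integral_sum) (rule i[OF that])
    finally show ?thesis by simp
  qed
  show ?thesis
  proof (rule that[of "\<lambda>z. exp (- h z)"])
    show "(\<lambda>z. exp (- h z)) holomorphic_on unit_disc" by (intro holomorphic_intros h)
    show "cmod (exp (- h z)) \<le> exp (- (\<Sum>n<J. c n * cmod (\<phi> (of_real \<rho> * z)) ^ (2*n)))" if "cmod z < 1" for z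
    proof -
      have "(\<Sum>n<J. c n * cmod (\<phi> (of_real \<rho> * z)) ^ (2*n)) \<le> Re (h z)"
        unfolding Re[OF that] sq
        by (intro sum_mono mult_left_mono c poisson_norm_square_le[OF dilation_holomorphic[OF \<rho>]])
           (use \<rho> that in auto)
      then show ?thesis by simp
    qed
    have "Re (h 0) \<le> (\<Sum>n<J. c n * (h2norm (\<lambda>z. \<phi> z ^ n))\<^sup>2)"
      using \<rho> circle_mean_le_h2norm[OF power_H2, of \<rho>]
      by (subst Re) (auto simp: poisson_def intro!: sum_mono mult_left_mono c)
    then show "cmod (exp (- h 0)) \<ge> exp (- (\<Sum>n<J. c n * (h2norm (\<lambda>z. \<phi> z ^ n))\<^sup>2))" by simp
  qed
qed

text \<open>The weights for finite J and radius tending to 1 are bounded by 1, so Montel's theorem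
  yields a limit, and the lower bound exp (- B) at 0 keeps it nonzero. For fixed J the later weights
  obey the estimate with J terms, since all c n are nonnegative, and this passes to the
  limit.\<close>

lemma weight_exists:
  fixes c :: "nat \<Rightarrow> real"
  assumes c: "\<And>n. c n \<ge> 0" and sm: "summable (\<lambda>n. c n * (h2norm (\<lambda>z. \<phi> z ^ n))\<^sup>2)"
  obtains w where "w holomorphic_on unit_disc" "w 0 \<noteq> 0"
    "\<And>z J. cmod z < 1 \<Longrightarrow> cmod (w z) \<le> exp (- (\<Sum>n<J. c n * cmod (\<phi> z) ^ (2*n)))"
proof -
  define B where "B = (\<Sum>n. c n * (h2norm (\<lambda>z. \<phi> z ^ n))\<^sup>2)"
  define Q where "Q = (\<lambda>J w. w holomorphic_on unit_disc \<and>
    (\<forall>z. cmod z < 1 \<longrightarrow> cmod (w z) \<le> exp (- (\<Sum>n<J. c n * cmod (\<phi> (of_real (radius J) * z)) ^ (2*n)))) \<and>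
    cmod (w 0) \<ge> exp (- (\<Sum>n<J. c n * (h2norm (\<lambda>z. \<phi> z ^ n))\<^sup>2)))"
  have "\<exists>w. Q J w" for J
  proof -
    have "0 < radius J" "radius J < 1" using radius[of J] by auto
    show ?thesis
    proof (rule finite_weight[of c "radius J" J, OF c \<open>0 < radius J\<close> \<open>radius J < 1\<close>])
      fix w
      assume "w holomorphic_on unit_disc"
        "\<And>z. cmod z < 1 \<Longrightarrow> cmod (w z) \<le> exp (- (\<Sum>n<J. c n * cmod (\<phi> (of_real (radius J) * z)) ^ (2*n)))"
        "cmod (w 0) \<ge> exp (- (\<Sum>n<J. c n * (h2norm (\<lambda>z. \<phi> z ^ n))\<^sup>2))"
      then show ?thesis unfolding Q_def by (intro exI[of _ w] conjI allI impI)
    qed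
  qed
  then obtain w where Q: "\<And>J. Q J (w J)" by metis
  have w: "w J holomorphic_on unit_disc"
    "cmod z < 1 \<Longrightarrow> cmod (w J z) \<le> exp (- (\<Sum>n<J. c n * cmod (\<phi> (of_real (radius J) * z)) ^ (2*n)))"
    "cmod (w J 0) \<ge> exp (- (\<Sum>n<J. c n * (h2norm (\<lambda>z. \<phi> z ^ n))\<^sup>2))" for J z
    using Q[of J] unfolding Q_def by auto
  have w1: "cmod (w J z) \<le> 1" if "cmod z < 1" for J z
  proof -
    have "0 \<le> (\<Sum>n<J. c n * cmod (\<phi> (of_real (radius J) * z)) ^ (2*n))"
      by (intro sum_nonneg mult_nonneg_nonneg c) auto
    then show ?thesis using w(2)[OF that, of J] by (meson exp_le_one_iff neg_le_0_iff_le order_trans)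
  qed
  obtain g s where g: "g holomorphic_on unit_disc" "strict_mono (s :: nat \<Rightarrow> nat)"
    "\<And>z. z \<in> unit_disc \<Longrightarrow> (\<lambda>n. w (s n) z) \<longlonglongrightarrow> g z"
  proof (rule Montel[of unit_disc "range w" w])
    show "\<exists>B. \<forall>h\<in>range w. \<forall>z\<in>K. cmod (h z) \<le> B" if "compact K" "K \<subseteq> unit_disc" for K
      using that w1 by (intro exI[of _ 1]) auto
  qed (use w in auto)
  show ?thesis
  proof (rule that[OF g(1)])
    have "exp (- B) \<le> cmod (w J 0)" for J
    proof -
      have "(\<Sum>n<J. c n * (h2norm (\<lambda>z. \<phi> z ^ n))\<^sup>2) \<le> B"
        unfolding B_def by (rule sum_le_suminf[OF sm]) (auto intro!: mult_nonneg_nonneg c)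
      then show ?thesis using w(3)[of J] by (meson exp_le_cancel_iff neg_le_iff_le order_trans)
    qed
    then have "exp (- B) \<le> cmod (g 0)"
      by (intro LIMSEQ_le_const[OF tendsto_norm[OF g(3)[of 0]]]) auto
    then show "g 0 \<noteq> 0" by auto
    fix z J assume z: "cmod z < 1"
    have "(\<lambda>k. of_real (radius (s k)) * z) \<longlonglongrightarrow> of_real 1 * z"
      by (intro tendsto_intros LIMSEQ_subseq_LIMSEQ[OF tendsto_radius g(2), unfolded o_def])
    moreover have "isCont \<phi> z"
      using hol z by (intro continuous_on_interior[of unit_disc] holomorphic_on_imp_continuous_on) auto
    ultimately have lim: "(\<lambda>k. \<phi> (of_real (radius (s k)) * z)) \<longlonglongrightarrow> \<phi> z"
      by (intro isCont_tendsto_compose[of z \<phi>]) auto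
    have lim': "(\<lambda>k. exp (- (\<Sum>n<J. c n * cmod (\<phi> (of_real (radius (s k)) * z)) ^ (2*n)))) \<longlonglongrightarrow>
        exp (- (\<Sum>n<J. c n * cmod (\<phi> z) ^ (2*n)))"
      by (intro tendsto_intros lim)
    show "cmod (g z) \<le> exp (- (\<Sum>n<J. c n * cmod (\<phi> z) ^ (2*n)))"
    proof (rule LIMSEQ_le[OF tendsto_norm[OF g(3)] lim'])
      show "\<exists>N. \<forall>k\<ge>N. cmod (w (s k) z) \<le> exp (- (\<Sum>n<J. c n * cmod (\<phi> (of_real (radius (s k)) * z)) ^ (2*n)))"
      proof (intro exI[of _ J] allI impI)
        fix k assume "J \<le> k"
        then have "J \<le> s k" using seq_suble[OF g(2), of k] by linarith
        then have "(\<Sum>n<J. c n * cmod (\<phi> (of_real (radius (s k)) * z)) ^ (2*n)) \<le>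
           (\<Sum>n<s k. c n * cmod (\<phi> (of_real (radius (s k)) * z)) ^ (2*n))"
          by (intro sum_mono2) (auto intro!: mult_nonneg_nonneg c)
        then show "cmod (w (s k) z) \<le> exp (- (\<Sum>n<J. c n * cmod (\<phi> (of_real (radius (s k)) * z)) ^ (2*n)))"
          using w(2)[OF z, of "s k"] by (meson exp_le_cancel_iff neg_le_iff_le order_trans)
      qed
    qed (use z in simp)
  qed
qed

end

text \<open>The choice of Abel and Dini: b is the inverse square root of the remainder r of the
  series. As a <= r n - r (Suc n), factoring this difference of squares of square roots bounds b n *
  a n by a telescoping term.\<close>

lemma summable_weight_at_top:
  fixes a :: "nat \<Rightarrow> real"
  assumes a: "\<And>n. a n \<ge> 0" "summable a"
  obtains b where "\<And>n. b n \<ge> 0" "filterlim b at_top sequentially" "summable (\<lambda>n. b n * a n)"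
proof -
  \<comment> \<open>The geometric term keeps every remainder strictly positive even if a vanishes
    from some index on.\<close>
  define d where "d = (\<lambda>n. a n + (1/2) ^ n)"
  have d: "summable d" unfolding d_def by (intro summable_add a summable_geometric) auto
  have d0: "d n > 0" for n unfolding d_def by (intro add_nonneg_pos a) auto
  define r where "r = (\<lambda>n. \<Sum>k. d (k + n))"
  have r0: "r n > 0" for n unfolding r_def
    by (intro suminf_pos d0 summable_ignore_initial_segment d)
  have rS: "r n = d n + r (Suc n)" for n
    using suminf_split_head[of "\<lambda>k. d (k + n)"] summable_ignore_initial_segment[OF d, of n]
    by (simp add: r_def)
  have lim: "r \<longlonglongrightarrow> 0" unfolding r_def by (rule suminf_exist_split2[OF d])
  define b where "b = (\<lambda>n. inverse (sqrt (r n)))"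
  have le: "b n * a n \<le> 2 * (sqrt (r n) - sqrt (r (Suc n)))" for n
  proof -
    define x where "x = sqrt (r n)"
    define y where "y = sqrt (r (Suc n))"
    have xy: "x > 0" "y > 0" "y \<le> x"
      using r0[of n] r0[of "Suc n"] rS[of n] d0[of n] by (simp_all add: x_def y_def)
    have "a n \<le> d n" by (simp add: d_def)
    also have "d n = x\<^sup>2 - y\<^sup>2" using rS[of n] r0[of n] r0[of "Suc n"] by (simp add: x_def y_def)
    also have "\<dots> = (x + y) * (x - y)" by (simp add: power2_eq_square algebra_simps)
    also have "\<dots> \<le> (2 * x) * (x - y)" using xy by (intro mult_right_mono) auto
    finally show ?thesis using xy unfolding b_def x_def[symmetric] y_def[symmetric]
      by (simp add: field_simps)
  qed
  show ?thesis
  proof (rule that)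
    show b0: "b n \<ge> 0" for n using r0[of n] by (simp add: b_def)
    have "filterlim (\<lambda>n. sqrt (r n)) (at_right 0) sequentially"
      using tendsto_real_sqrt[OF lim] r0 less_imp_neq[OF r0]
      by (auto simp: filterlim_at intro!: always_eventually)
    then show "filterlim b at_top sequentially"
      unfolding b_def by (rule filterlim_compose[OF filterlim_inverse_at_top_right])
    show "summable (\<lambda>n. b n * a n)"
    proof (rule summable_comparison_test'[of "\<lambda>n. 2 * (sqrt (r n) - sqrt (r (Suc n)))" 0])
      show "summable (\<lambda>n. 2 * (sqrt (r n) - sqrt (r (Suc n))))"
        by (intro summable_mult telescope_summable'[OF tendsto_real_sqrt[OF lim]])
    qed (use le b0 a in auto)
  qed
qed

context self_map
begin

text \<open>For each K the coefficients b n / n exceed K / n from some n0 on, so the exponent is at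
  least K log (1 / (1 - |phi|^2)) up to a constant. The weight does not depend on K; only the
  constant does. The case K = 0 later supplies boundedness of w.\<close>

lemma fast_weight_exists:
  assumes "log_integral \<phi> < \<infinity>"
  obtains w where "w holomorphic_on unit_disc" "w 0 \<noteq> 0"
    "\<And>K::nat. \<exists>C>0. \<forall>z\<in>unit_disc. cmod (w z) \<le> C * (1 - (cmod (\<phi> z))\<^sup>2) ^ K"
proof -
  obtain b where b: "\<And>n. b n \<ge> 0" "filterlim b at_top sequentially"
     "summable (\<lambda>n. b n * ((h2norm (\<lambda>z. \<phi> z ^ n))\<^sup>2 / n))"
    by (rule summable_weight_at_top[OF _ summable_if_log_integral_finite[OF assms]]) auto
  obtain w where w: "w holomorphic_on unit_disc" "w 0 \<noteq> 0"
    "\<And>z J. cmod z < 1 \<Longrightarrow> cmod (w z) \<le> exp (- (\<Sum>n<J. b n / n * cmod (\<phi> z) ^ (2*n)))"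
    by (rule weight_exists[of "\<lambda>n. b n / n"]) (use b in auto)
  show ?thesis
  proof (rule that[OF w(1,2)])
    fix K :: nat
    obtain n0 where n0: "\<And>n. n \<ge> n0 \<Longrightarrow> b n \<ge> K"
      using b(2) by (auto simp: filterlim_at_top eventually_sequentially)
    \<comment> \<open>The price of the finitely many indices at which b n may still be below
      K.\<close>
    define D where "D = (\<Sum>n<n0. K / n)"
    have "cmod (w z) \<le> exp D * (1 - (cmod (\<phi> z))\<^sup>2) ^ K" if z: "z \<in> unit_disc" for z
    proof -
      define y where "y = (cmod (\<phi> z))\<^sup>2"
      have y: "0 \<le> y" "y < 1" using norm_less_1[of z] z by (auto simp: y_def abs_square_less_1)
      have le: "cmod (w z) \<le> exp (D - K * (\<Sum>n<J. y ^ n / n))" for J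
      proof -
        \<comment> \<open>The intersection covers J < n0 as well; dropping terms from D only
          increases the right side.\<close>
        have "K * (\<Sum>n<J. y ^ n / n) - D \<le> (\<Sum>n<J. K * (y ^ n / n)) - (\<Sum>n\<in>{..<J} \<inter> {..<n0}. K / n)"
          unfolding D_def sum_distrib_left by (intro diff_left_mono sum_mono2) auto
        also have "(\<Sum>n\<in>{..<J} \<inter> {..<n0}. K / n) = (\<Sum>n<J. if n < n0 then K / n else 0)"
          by (subst sum.inter_restrict) auto
        also have "(\<Sum>n<J. K * (y ^ n / n)) - \<dots> = (\<Sum>n<J. K * (y ^ n / n) - (if n < n0 then K / n else 0))"
          by (rule sum_subtractf[symmetric])
        also have "\<dots> \<le> (\<Sum>n<J. b n / n * y ^ n)"
        proof (rule sum_mono)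
          fix n
          show "K * (y ^ n / n) - (if n < n0 then K / n else 0) \<le> b n / n * y ^ n"
          proof (cases "n < n0")
            case True
            have "K / n * y ^ n \<le> K / n * 1" using y by (intro mult_left_mono power_le_one) auto
            moreover have "b n / n * y ^ n \<ge> 0" using b(1)[of n] y by simp
            ultimately show ?thesis using True by simp
          next
            case False
            have "K / n * y ^ n \<le> b n / n * y ^ n"
              using n0[of n] False y by (intro mult_right_mono divide_right_mono) auto
            then show ?thesis using False by simp
          qed
        qed
        finally have "K * (\<Sum>n<J. y ^ n / n) - D \<le> (\<Sum>n<J. b n / n * cmod (\<phi> z) ^ (2*n))"
          by (simp add: y_def power_mult)
        then have "exp (- (\<Sum>n<J. b n / n * cmod (\<phi> z) ^ (2*n))) \<le> exp (D - K * (\<Sum>n<J. y ^ n / n))"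
          by simp
        then show ?thesis using w(3)[of z J] z by (meson mem_ball_0 order_trans)
      qed
      have "(\<lambda>J. exp (D - K * (\<Sum>n<J. y ^ n / n))) \<longlonglongrightarrow> exp (D - K * ln (1 / (1 - y)))"
        using ln_one_minus_sums[OF y] unfolding sums_def by (intro tendsto_intros)
      then have "cmod (w z) \<le> exp (D - K * ln (1 / (1 - y)))"
        by (rule LIMSEQ_le_const) (use le in auto)
      also have "D - K * ln (1 / (1 - y)) = D + K * ln (1 - y)" using y by (simp add: ln_div)
      also have "exp \<dots> = exp D * (1 - y) ^ K"
        using y by (simp add: exp_add exp_of_nat_mult)
      finally show ?thesis by (simp add: y_def)
    qed
    then show "\<exists>C>0. \<forall>z\<in>unit_disc. cmod (w z) \<le> C * (1 - (cmod (\<phi> z))\<^sup>2) ^ K"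
      by (intro exI[of _ "exp D"]) auto
  qed
qed

end

subsection \<open>Singular numbers and Hilbert--Schmidt norms\<close>

lemma projection_norm:
  fixes x U :: "nat \<Rightarrow> complex"
  assumes "(\<Sum>k<L. (cmod (U k))\<^sup>2) = 1 \<or> (\<forall>k<L. U k = 0)"
  defines "t \<equiv> (\<Sum>k<L. x k * cnj (U k))"
  shows "(\<Sum>k<L. (cmod (x k - t * U k))\<^sup>2) = (\<Sum>k<L. (cmod (x k))\<^sup>2) - (cmod t)\<^sup>2"
  using assms(1)
proof
  assume U: "(\<Sum>k<L. (cmod (U k))\<^sup>2) = 1"
  have "(\<Sum>k<L. (cmod (x k - t * U k))\<^sup>2) =
     (\<Sum>k<L. (cmod (x k))\<^sup>2 - 2 * Re (cnj t * (x k * cnj (U k))) + (cmod t)\<^sup>2 * (cmod (U k))\<^sup>2)"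
    by (intro sum.cong refl, simp only: cmod_power2) (simp add: algebra_simps power2_eq_square)
  also have "\<dots> = (\<Sum>k<L. (cmod (x k))\<^sup>2) - 2 * Re (cnj t * t) + (cmod t)\<^sup>2 * (\<Sum>k<L. (cmod (U k))\<^sup>2)"
    unfolding t_def by (simp only: sum.distrib sum_subtractf sum_distrib_left Re_sum)
  also have "Re (cnj t * t) = (cmod t)\<^sup>2" by (simp only: cmod_power2) (simp add: power2_eq_square)
  finally show ?thesis using U by simp
next
  assume "\<forall>k<L. U k = 0"
  then show ?thesis by (simp add: t_def)
qed

text \<open>A rank \<open>\<le> N\<close> hypothesis on the rows \<open>V n\<close> enters only through the linear relations that hold
  between them; each induction step splits off the direction of one row.\<close>
lemma hilbert_schmidt_le_rank_mult_norm:
  fixes V c :: "nat \<Rightarrow> nat \<Rightarrow> complex" and N M L :: nat and D :: real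
  assumes "D \<ge> 0"
    and "\<And>\<alpha>. (\<forall>i<N. (\<Sum>n<M. \<alpha> n * c n i) = 0) \<Longrightarrow> (\<forall>k<L. (\<Sum>n<M. \<alpha> n * V n k) = 0)"
    and "\<And>\<alpha>. (\<Sum>k<L. (cmod (\<Sum>n<M. \<alpha> n * V n k))\<^sup>2) \<le> D * (\<Sum>n<M. (cmod (\<alpha> n))\<^sup>2)"
  shows "(\<Sum>n<M. \<Sum>k<L. (cmod (V n k))\<^sup>2) \<le> N * D"
  using assms(2,3)
proof (induction N arbitrary: V c)
  case 0
  have "V m k = 0" if "m < M" "k < L" for m k
    using 0(1)[of "\<lambda>n. if n = m then 1 else 0"] that
    by (simp add: if_distrib[of "\<lambda>x. x * _"] sum.delta cong: if_cong)
  then show ?case by simp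
next
  case (Suc N)
  note rel = Suc.prems(1) and bd = Suc.prems(2)
  show ?case
  \<comment> \<open>If the last coordinate vanishes in every row, it imposes no condition and N
    suffices. Otherwise a row m with nonzero last coordinate serves as pivot.\<close>
  proof (cases "\<forall>n<M. c n N = 0")
    case True
    have "(\<Sum>n<M. \<Sum>k<L. (cmod (V n k))\<^sup>2) \<le> N * D"
    proof (rule Suc.IH[OF _ bd])
      fix \<alpha> assume *: "\<forall>i<N. (\<Sum>n<M. \<alpha> n * c n i) = 0"
      have "(\<Sum>n<M. \<alpha> n * c n i) = 0" if "i < Suc N" for i
        using that * True by (cases "i = N") auto
      then show "\<forall>k<L. (\<Sum>n<M. \<alpha> n * V n k) = 0" using rel by blast
    qed
    also have "\<dots> \<le> Suc N * D" using \<open>D \<ge> 0\<close> by (simp add: algebra_simps)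
    finally show ?thesis .
  next
    case False
    then obtain m where m: "m < M" "c m N \<noteq> 0" by auto
    define S where "S = (\<Sum>k<L. (cmod (V m k))\<^sup>2)"
    \<comment> \<open>For S = 0 the division yields the zero vector, the degenerate case allowed in
      \<open>projection_norm\<close>.\<close>
    define U where "U = (\<lambda>k. V m k / of_real (sqrt S))"
    define ip where "ip = (\<lambda>x. \<Sum>k<L. x k * cnj (U k))"
    \<comment> \<open>Rows are projected off the pivot row while the coordinates undergo one step of
      Gaussian elimination; both operations remove the same dimension.\<close>
    define V' where "V' = (\<lambda>n k. V n k - ip (V n) * U k)"
    define c' where "c' = (\<lambda>n i. c n i - c n N / c m N * c m i)"
    have S0: "S \<ge> 0" by (simp add: S_def sum_nonneg)
    have U: "(\<Sum>k<L. (cmod (U k))\<^sup>2) = 1 \<or> (\<forall>k<L. U k = 0)"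
    proof (cases "S = 0")
      case False
      have "(\<Sum>k<L. (cmod (U k))\<^sup>2) = (\<Sum>k<L. (cmod (V m k))\<^sup>2 / S)"
        using S0 by (simp add: U_def norm_divide power_divide)
      also have "\<dots> = 1" using False by (simp add: S_def flip: sum_divide_distrib)
      finally show ?thesis ..
    qed (simp add: U_def)
    have VU: "V m k = of_real (sqrt S) * U k" if "k < L" for k
    proof (cases "S = 0")
      case True
      then have "(cmod (V m k))\<^sup>2 = 0"
        using that unfolding S_def by (subst (asm) sum_nonneg_eq_0_iff) auto
      then show ?thesis using True by simp
    qed (simp add: U_def)
    have proj: "(\<Sum>k<L. (cmod (x k - ip x * U k))\<^sup>2) = (\<Sum>k<L. (cmod (x k))\<^sup>2) - (cmod (ip x))\<^sup>2" for x
      unfolding ip_def by (rule projection_norm[OF U])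
    have bessel: "(cmod (ip x))\<^sup>2 \<le> (\<Sum>k<L. (cmod (x k))\<^sup>2)" for x
    proof -
      have "0 \<le> (\<Sum>k<L. (cmod (x k - ip x * U k))\<^sup>2)" by (intro sum_nonneg) auto
      then show ?thesis unfolding proj by simp
    qed
    have ip_sum: "ip (\<lambda>k. \<Sum>n<M. \<alpha> n * V n k) = (\<Sum>n<M. \<alpha> n * ip (V n))" for \<alpha>
    proof -
      have "ip (\<lambda>k. \<Sum>n<M. \<alpha> n * V n k) = (\<Sum>k<L. \<Sum>n<M. \<alpha> n * (V n k * cnj (U k)))"
        unfolding ip_def by (simp add: sum_distrib_right mult.assoc)
      also have "\<dots> = (\<Sum>n<M. \<Sum>k<L. \<alpha> n * (V n k * cnj (U k)))" by (rule sum.swap)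
      finally show ?thesis by (simp add: ip_def sum_distrib_left)
    qed
    have V'_sum: "(\<Sum>n<M. \<alpha> n * V' n k) = (\<Sum>n<M. \<alpha> n * V n k) - ip (\<lambda>k. \<Sum>n<M. \<alpha> n * V n k) * U k" for \<alpha> k
      unfolding ip_sum V'_def by (simp add: algebra_simps sum_subtractf sum_distrib_left)
    have "(\<Sum>n<M. \<Sum>k<L. (cmod (V n k))\<^sup>2) = (\<Sum>n<M. \<Sum>k<L. (cmod (V' n k))\<^sup>2) + (\<Sum>n<M. (cmod (ip (V n)))\<^sup>2)"
      unfolding V'_def proj by (simp add: sum_subtractf)
    moreover have "(\<Sum>n<M. (cmod (ip (V n)))\<^sup>2) \<le> D"
    proof -
      define Q where "Q = (\<Sum>n<M. (cmod (ip (V n)))\<^sup>2)"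
      \<comment> \<open>With these coefficients the component of x along U is the sum Q itself, so
        the norm bound reads Q^2 <= D Q and gives Q <= D.\<close>
      define x where "x = (\<lambda>k. \<Sum>n<M. cnj (ip (V n)) * V n k)"
      have "ip x = (\<Sum>n<M. cnj (ip (V n)) * ip (V n))" unfolding x_def by (rule ip_sum)
      also have "\<dots> = of_real Q" unfolding Q_def of_real_sum complex_norm_square by (simp add: mult.commute)
      finally have "Q\<^sup>2 = (cmod (ip x))\<^sup>2" by simp
      also have "\<dots> \<le> (\<Sum>k<L. (cmod (x k))\<^sup>2)" by (rule bessel)
      also have "\<dots> \<le> D * (\<Sum>n<M. (cmod (cnj (ip (V n))))\<^sup>2)" unfolding x_def by (rule bd)
      finally have "Q * Q \<le> D * Q" by (simp add: Q_def power2_eq_square)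
      moreover have "Q \<ge> 0" unfolding Q_def by (intro sum_nonneg) auto
      ultimately show ?thesis using \<open>D \<ge> 0\<close> unfolding Q_def[symmetric] by (cases "Q = 0") auto
    qed
    moreover have "(\<Sum>n<M. \<Sum>k<L. (cmod (V' n k))\<^sup>2) \<le> N * D"
    proof (rule Suc.IH[where c=c'])
      fix \<alpha> :: "nat \<Rightarrow> complex"
      have "(\<Sum>k<L. (cmod (\<Sum>n<M. \<alpha> n * V' n k))\<^sup>2) \<le> (\<Sum>k<L. (cmod (\<Sum>n<M. \<alpha> n * V n k))\<^sup>2)"
        unfolding V'_sum using proj[of "\<lambda>k. \<Sum>n<M. \<alpha> n * V n k"] by simp
      also have "\<dots> \<le> D * (\<Sum>n<M. (cmod (\<alpha> n))\<^sup>2)" by (rule bd)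
      finally show "(\<Sum>k<L. (cmod (\<Sum>n<M. \<alpha> n * V' n k))\<^sup>2) \<le> D * (\<Sum>n<M. (cmod (\<alpha> n))\<^sup>2)" .
    next
      fix \<alpha> assume *: "\<forall>i<N. (\<Sum>n<M. \<alpha> n * c' n i) = 0"
      \<comment> \<open>Subtracting \<open>\<beta>\<close> from the coefficient of the pivot
        restores the relation in coordinate N. The old relations then show that the original
        combination of rows is a multiple of the pivot row, hence of U, and the projection kills
        it.\<close>
      define \<beta> where "\<beta> = (\<Sum>n<M. \<alpha> n * c n N) / c m N"
      define \<alpha>' where "\<alpha>' = (\<lambda>n. \<alpha> n - (if n = m then \<beta> else 0))"
      have \<alpha>': "(\<Sum>n<M. \<alpha>' n * y n) = (\<Sum>n<M. \<alpha> n * y n) - \<beta> * y m" for y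
        using m by (simp add: \<alpha>'_def left_diff_distrib sum_subtractf if_distrib[of "\<lambda>x. x * _"] sum.delta cong: if_cong)
      have "(\<Sum>n<M. \<alpha>' n * c n i) = 0" if "i < Suc N" for i
      proof (cases "i = N")
        case True
        then show ?thesis unfolding \<alpha>' using m by (simp add: \<beta>_def)
      next
        case False
        have "(\<Sum>n<M. \<alpha> n * c' n i) = (\<Sum>n<M. \<alpha> n * c n i) - \<beta> * c m i"
        proof -
          have "(\<Sum>n<M. \<alpha> n * (c n N / c m N * c m i)) = \<beta> * c m i"
            unfolding \<beta>_def sum_divide_distrib sum_distrib_right by (intro sum.cong refl) simp
          then show ?thesis by (simp add: c'_def right_diff_distrib sum_subtractf)
        qed
        then show ?thesis unfolding \<alpha>' using * that False by simp
      qed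
      then have "\<forall>k<L. (\<Sum>n<M. \<alpha>' n * V n k) = 0" using rel by blast
      then have x: "(\<Sum>n<M. \<alpha> n * V n k) = (\<beta> * of_real (sqrt S)) * U k" if "k < L" for k
        unfolding \<alpha>' using VU[OF that] that by simp
      have "ip (\<lambda>k. \<Sum>n<M. \<alpha> n * V n k) = (\<beta> * of_real (sqrt S)) * (\<Sum>k<L. U k * cnj (U k))"
        unfolding ip_def sum_distrib_left by (intro sum.cong refl) (simp add: x)
      also have "(\<Sum>k<L. U k * cnj (U k)) = of_real (\<Sum>k<L. (cmod (U k))\<^sup>2)"
        by (simp only: of_real_sum complex_norm_square)
      finally have "ip (\<lambda>k. \<Sum>n<M. \<alpha> n * V n k) = (\<beta> * of_real (sqrt S)) * of_real (\<Sum>k<L. (cmod (U k))\<^sup>2)" .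
      then have z: "ip (\<lambda>k. \<Sum>n<M. \<alpha> n * V n k) * U k = (\<beta> * of_real (sqrt S)) * U k" if "k < L" for k
        using U that by (elim disjE) (simp_all only: of_real_1 mult_1_right, simp)
      show "\<forall>k<L. (\<Sum>n<M. \<alpha> n * V' n k) = 0"
      proof (intro allI impI)
        fix k assume "k < L"
        then show "(\<Sum>n<M. \<alpha> n * V' n k) = 0" unfolding V'_sum by (simp only: z x diff_self)
      qed
    qed
    ultimately show ?thesis by (simp add: algebra_simps)
  qed
qed

text \<open>The coefficientwise bound |a - b|^2 <= 2 |a|^2 + 2 |b|^2 replaces the triangle
  inequality; constants are harmless because only geometric rates matter later.\<close>

lemma H2_diff:
  assumes "f \<in> H2" "g \<in> H2"
  shows "(\<lambda>z. f z - g z) \<in> H2"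
    and "(h2norm (\<lambda>z. f z - g z))\<^sup>2 \<le> 2 * (h2norm f)\<^sup>2 + 2 * (h2norm g)\<^sup>2"
proof -
  have hol: "f holomorphic_on unit_disc" "g holomorphic_on unit_disc" using assms by (auto simp: H2_def)
  have le: "(cmod (taylor_coeff (\<lambda>z. f z - g z) n))\<^sup>2 \<le>
      2 * (cmod (taylor_coeff f n))\<^sup>2 + 2 * (cmod (taylor_coeff g n))\<^sup>2" for n
  proof -
    have "(cmod (a - b))\<^sup>2 \<le> (cmod a + cmod b)\<^sup>2" for a b :: complex
      by (intro power_mono norm_triangle_ineq4) auto
    moreover have "(x + y)\<^sup>2 \<le> 2 * x\<^sup>2 + 2 * y\<^sup>2" for x y :: real
      using zero_le_power2[of "x - y"] by (simp add: power2_sum power2_diff)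
    ultimately show ?thesis unfolding taylor_coeff_diff[OF hol] by (meson order_trans)
  qed
  have s: "(\<lambda>n. 2 * (cmod (taylor_coeff f n))\<^sup>2 + 2 * (cmod (taylor_coeff g n))\<^sup>2) sums (2 * (h2norm f)\<^sup>2 + 2 * (h2norm g)\<^sup>2)"
    by (intro sums_add sums_mult h2norm_square assms)
  have "summable (\<lambda>n. (cmod (taylor_coeff (\<lambda>z. f z - g z) n))\<^sup>2)"
    by (rule summable_comparison_test'[OF sums_summable[OF s], of 0]) (use le in auto)
  then show *: "(\<lambda>z. f z - g z) \<in> H2" using hol by (auto simp: H2_def intro!: holomorphic_intros)
  show "(h2norm (\<lambda>z. f z - g z))\<^sup>2 \<le> 2 * (h2norm f)\<^sup>2 + 2 * (h2norm g)\<^sup>2"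
    by (rule sums_le[OF le h2norm_square[OF *] s])
qed

lemma monomial_H2: "(\<lambda>z. z ^ n) \<in> H2"
  using h2norm_poly(1)[where N="Suc n" and a="\<lambda>i. if i = n then 1 else 0"]
  by (simp add: if_distrib[of "\<lambda>x. x * _"] sum.delta cong: if_cong)

lemma h2norm_monomial: "h2norm (\<lambda>z. z ^ n) = 1"
proof -
  have "(h2norm (\<lambda>z. z ^ n))\<^sup>2 = (\<Sum>i<Suc n. (cmod (if i = n then 1 else 0))\<^sup>2)"
    using h2norm_poly(2)[where N="Suc n" and a="\<lambda>i. if i = n then 1 else 0"]
    by (simp add: if_distrib[of "\<lambda>x. x * _"] sum.delta cong: if_cong)
  also have "\<dots> = 1" by (simp add: if_distrib[of cmod] if_distrib[of "\<lambda>x. x\<^sup>2"] sum.delta cong: if_cong)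
  finally show ?thesis using h2norm_nonneg[OF monomial_H2, of n] by (simp add: power2_eq_1_iff)
qed

lemma H2_linear_op_poly:
  assumes R: "H2_linear_op R" and z: "z \<in> unit_disc"
  shows "R (\<lambda>x. \<Sum>n<M. \<alpha> n * x ^ n) z = (\<Sum>n<M. \<alpha> n * R (\<lambda>x. x ^ n) z)"
proof -
  have lin: "R (\<lambda>x. a * f x + b * g x) z = a * R f z + b * R g z" if "f \<in> H2" "g \<in> H2" for f g a b
    using R z that unfolding H2_linear_op_def by simp
  show ?thesis
  proof (induction M)
    case 0
    show ?case using lin[OF monomial_H2[of 0] monomial_H2[of 0], of 0 0] by simp
  next
    case (Suc M)
    show ?case
      using lin[OF h2norm_poly(1)[where N=M and a=\<alpha>] monomial_H2[of M], of 1 "\<alpha> M"] Suc by simp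
  qed
qed

text \<open>The matrix lemma is applied to the first L Taylor coefficients of the images of the
  monomials, then L tends to infinity. \<open>H2_rank_le\<close> supplies coordinates for each
  function separately and does not make them linear in it; this is why that lemma asks only for
  relations: a vanishing combination of coordinates makes R of the polynomial vanish.\<close>

lemma hilbert_schmidt_rank_bound:
  fixes N M :: nat and D :: real
  assumes R: "H2_rank_le R N" and D: "D \<ge> 0" "\<And>f. f \<in> H2 \<Longrightarrow> (h2norm (R f))\<^sup>2 \<le> D * (h2norm f)\<^sup>2"
  shows "(\<Sum>n<M. (h2norm (R (\<lambda>z. z ^ n)))\<^sup>2) \<le> N * D"
proof -
  have lin: "H2_linear_op R" using R by (simp add: H2_rank_le_def)
  have RH2: "R f \<in> H2" if "f \<in> H2" for f using lin that by (simp add: H2_linear_op_def)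
  have Rhol: "R (\<lambda>z. z ^ n) holomorphic_on unit_disc" for n
    using RH2[OF monomial_H2] by (simp add: H2_def)
  obtain g where g: "\<And>f. f \<in> H2 \<Longrightarrow> \<exists>c. \<forall>z\<in>unit_disc. R f z = (\<Sum>i<N. c i * g i z)"
    using R unfolding H2_rank_le_def by blast
  have "\<forall>n. \<exists>c. \<forall>z\<in>unit_disc. R (\<lambda>z. z ^ n) z = (\<Sum>i<N. c i * g i z)"
    using g monomial_H2 by blast
  then obtain c where c: "\<And>n z. z \<in> unit_disc \<Longrightarrow> R (\<lambda>z. z ^ n) z = (\<Sum>i<N. c n i * g i z)"
    by metis
  define V where "V = (\<lambda>n. taylor_coeff (R (\<lambda>z. z ^ n)))"
  have Vsum: "taylor_coeff (R (\<lambda>x. \<Sum>n<M. \<alpha> n * x ^ n)) k = (\<Sum>n<M. \<alpha> n * V n k)" for \<alpha> k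
  proof -
    have "taylor_coeff (R (\<lambda>x. \<Sum>n<M. \<alpha> n * x ^ n)) k = taylor_coeff (\<lambda>z. \<Sum>n<M. \<alpha> n * R (\<lambda>x. x ^ n) z) k"
      by (rule taylor_coeff_cong) (rule H2_linear_op_poly[OF lin])
    also have "\<dots> = (\<Sum>n<M. \<alpha> n * V n k)"
      unfolding V_def by (rule taylor_coeff_sum) (use Rhol in auto)
    finally show ?thesis .
  qed
  have fin: "(\<Sum>n<M. \<Sum>k<L. (cmod (V n k))\<^sup>2) \<le> N * D" for L
  proof (rule hilbert_schmidt_le_rank_mult_norm[where c=c, OF D(1)])
    fix \<alpha> assume 0: "\<forall>i<N. (\<Sum>n<M. \<alpha> n * c n i) = 0"
    have "R (\<lambda>x. \<Sum>n<M. \<alpha> n * x ^ n) z = 0" if z: "z \<in> unit_disc" for z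
    proof -
      have "R (\<lambda>x. \<Sum>n<M. \<alpha> n * x ^ n) z = (\<Sum>n<M. \<Sum>i<N. \<alpha> n * c n i * g i z)"
        unfolding H2_linear_op_poly[OF lin z] c[OF z] by (simp add: sum_distrib_left mult.assoc)
      also have "\<dots> = (\<Sum>i<N. \<Sum>n<M. \<alpha> n * c n i * g i z)" by (rule sum.swap)
      also have "\<dots> = (\<Sum>i<N. (\<Sum>n<M. \<alpha> n * c n i) * g i z)" by (simp add: sum_distrib_right)
      finally show ?thesis using 0 by simp
    qed
    then have "taylor_coeff (R (\<lambda>x. \<Sum>n<M. \<alpha> n * x ^ n)) k = taylor_coeff (\<lambda>z. \<Sum>i<0. 0 * z ^ i) k" for k
      by (intro taylor_coeff_cong) simp
    then show "\<forall>k<L. (\<Sum>n<M. \<alpha> n * V n k) = 0"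
      unfolding Vsum taylor_coeff_poly by simp
  next
    fix \<alpha> :: "nat \<Rightarrow> complex"
    let ?f = "\<lambda>x. \<Sum>n<M. \<alpha> n * x ^ n"
    have f: "?f \<in> H2" by (rule h2norm_poly)
    have "(\<Sum>k<L. (cmod (\<Sum>n<M. \<alpha> n * V n k))\<^sup>2) = (\<Sum>k<L. (cmod (taylor_coeff (R ?f) k))\<^sup>2)"
      by (simp add: Vsum)
    also have "\<dots> \<le> (h2norm (R ?f))\<^sup>2"
      unfolding sums_unique[OF h2norm_square[OF RH2[OF f]]]
      by (rule sum_le_suminf) (use h2norm_square[OF RH2[OF f]] in \<open>auto simp: sums_iff\<close>)
    also have "\<dots> \<le> D * (h2norm ?f)\<^sup>2" by (rule D(2)[OF f])
    finally show "(\<Sum>k<L. (cmod (\<Sum>n<M. \<alpha> n * V n k))\<^sup>2) \<le> D * (\<Sum>n<M. (cmod (\<alpha> n))\<^sup>2)"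
      unfolding h2norm_poly(2) .
  qed
  have "(\<lambda>L. \<Sum>n<M. \<Sum>k<L. (cmod (V n k))\<^sup>2) \<longlonglongrightarrow> (\<Sum>n<M. (h2norm (R (\<lambda>z. z ^ n)))\<^sup>2)"
    using h2norm_square[OF RH2[OF monomial_H2]] unfolding V_def sums_def by (intro tendsto_sum)
  then show ?thesis by (rule LIMSEQ_le_const2) (use fin in auto)
qed

section \<open>Approximation numbers\<close>

lemma H2_rank_le_mono:
  assumes "H2_rank_le R n" "n \<le> m"
  shows "H2_rank_le R m"
proof -
  obtain g where lin: "H2_linear_op R"
    and g: "\<And>f. f \<in> H2 \<Longrightarrow> \<exists>c. \<forall>z\<in>unit_disc. R f z = (\<Sum>i<n. c i * g i z)"
    using assms(1) unfolding H2_rank_le_def by blast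
  have "\<exists>c. \<forall>z\<in>unit_disc. R f z = (\<Sum>i<m. c i * g i z)" if "f \<in> H2" for f
  proof -
    obtain c where c: "\<And>z. z \<in> unit_disc \<Longrightarrow> R f z = (\<Sum>i<n. c i * g i z)" using g[OF \<open>f \<in> H2\<close>] by blast
    have "(\<Sum>i<n. c i * g i z) = (\<Sum>i<m. (if i < n then c i else 0) * g i z)" for z
      using assms(2) by (intro sum.mono_neutral_cong_left) auto
    then show ?thesis using c by (intro exI[of _ "\<lambda>i. if i < n then c i else 0"]) simp
  qed
  then show ?thesis using lin unfolding H2_rank_le_def by blast
qed

text \<open>A real \<open>Inf\<close> is usable only for a nonempty set; boundedness of T together
  with the zero operator provides an element. The slack between \<open>sing_num\<close> and s stands
  in for attainment of the infimum.\<close>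

lemma sing_num_approx:
  assumes T: "H2_bounded_op T" and s: "sing_num T N < s"
  obtains R where "H2_rank_le R N" "\<And>f. f \<in> H2 \<Longrightarrow> h2norm (\<lambda>z. T f z - R f z) \<le> s * h2norm f"
proof -
  let ?S = "{C. C \<ge> 0 \<and> (\<exists>R. H2_rank_le R N \<and> (\<forall>f\<in>H2. h2norm (\<lambda>z. T f z - R f z) \<le> C * h2norm f))}"
  have ne: "?S \<noteq> {}"
  proof -
    obtain C where C: "\<And>f. f \<in> H2 \<Longrightarrow> h2norm (T f) \<le> C * h2norm f"
      using T by (auto simp: H2_bounded_op_def)
    have "(\<lambda>z. 0) \<in> H2" using h2norm_poly(1)[where N=0] by simp
    then have z: "H2_rank_le (\<lambda>f z. 0) N"
      unfolding H2_rank_le_def H2_linear_op_def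
      by (intro conjI exI[of _ "\<lambda>_ _. 0"] ballI exI[of _ "\<lambda>_. 0"]) auto
    have "h2norm (T f) \<le> max C 0 * h2norm f" if "f \<in> H2" for f
      using C[OF that] mult_right_mono[of C "max C 0" "h2norm f"] h2norm_nonneg[OF that] by simp
    then have "max C 0 \<in> ?S" using z by (auto intro!: exI[of _ "\<lambda>f z. 0"])
    then show ?thesis by blast
  qed
  obtain C where C: "C \<in> ?S" "C < s"
    using cInf_lessD[OF ne s[unfolded sing_num_def]] by blast
  then obtain R where R: "H2_rank_le R N" "\<And>f. f \<in> H2 \<Longrightarrow> h2norm (\<lambda>z. T f z - R f z) \<le> C * h2norm f"
    by blast
  show ?thesis
  proof (rule that[OF R(1)])
    fix f assume f: "f \<in> H2"
    have "C * h2norm f \<le> s * h2norm f" using C h2norm_nonneg[OF f] by (intro mult_right_mono) auto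
    then show "h2norm (\<lambda>z. T f z - R f z) \<le> s * h2norm f" using R(2)[OF f] by linarith
  qed
qed

lemma sing_num_nonneg:
  assumes T: "H2_bounded_op T"
  shows "sing_num T N \<ge> 0"
proof -
  obtain R where "H2_rank_le R N" "\<And>f. f \<in> H2 \<Longrightarrow> h2norm (\<lambda>z. T f z - R f z) \<le> (\<bar>sing_num T N\<bar> + 1) * h2norm f"
    by (rule sing_num_approx[OF T, of N "\<bar>sing_num T N\<bar> + 1"]) auto
  then have "\<bar>sing_num T N\<bar> + 1 \<in> {C. C \<ge> 0 \<and> (\<exists>R. H2_rank_le R N \<and> (\<forall>f\<in>H2. h2norm (\<lambda>z. T f z - R f z) \<le> C * h2norm f))}"
    by auto
  then have "{C. C \<ge> 0 \<and> (\<exists>R. H2_rank_le R N \<and> (\<forall>f\<in>H2. h2norm (\<lambda>z. T f z - R f z) \<le> C * h2norm f))} \<noteq> {}"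
    by blast
  then show ?thesis unfolding sing_num_def by (intro cInf_greatest) auto
qed

lemma sing_num_antimono:
  assumes T: "H2_bounded_op T" and "N \<le> M"
  shows "sing_num T M \<le> sing_num T N"
proof (rule field_le_epsilon)
  fix e :: real assume "e > 0"
  then obtain R where R: "H2_rank_le R N" "\<And>f. f \<in> H2 \<Longrightarrow> h2norm (\<lambda>z. T f z - R f z) \<le> (sing_num T N + e) * h2norm f"
    using sing_num_approx[OF T, of N "sing_num T N + e"] by auto
  have "sing_num T N + e \<ge> 0" using sing_num_nonneg[OF T, of N] \<open>e > 0\<close> by simp
  then show "sing_num T M \<le> sing_num T N + e"
    unfolding sing_num_def[of T M] using R H2_rank_le_mono[OF R(1) \<open>N \<le> M\<close>]
    by (intro cInf_lower) (auto intro!: bdd_belowI[of _ 0])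
qed

text \<open>Monotonicity gives 2^j s^p <= A for the singular number s of index 2^j, hence geometric
  decay of s with ratio 2^(-1/p). An approximant of rank 2^j has total squared norm at most 2^j D on
  the 4^j monomials, and the error adds 4^j times its square; divided by 4^j, both decay
  geometrically.\<close>

theorem schatten_orbit_decay:
  assumes p: "p > 0" and T: "schatten p T"
  obtains C \<theta> where "0 < \<theta>" "\<theta> < 1" "C \<ge> 0"
    "\<And>j. (\<Sum>n<4^j. (h2norm (T (\<lambda>z. z ^ n)))\<^sup>2) \<le> C * 4 ^ j * \<theta> ^ j"
proof -
  have bdd: "H2_bounded_op T" and sm: "summable (\<lambda>n. sing_num T n powr p)"
    using T by (auto simp: schatten_def)
  have TH2: "T f \<in> H2" if "f \<in> H2" for f
    using bdd that by (simp add: H2_bounded_op_def H2_linear_op_def)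
  obtain C0 where C0: "\<And>f. f \<in> H2 \<Longrightarrow> h2norm (T f) \<le> C0 * h2norm f"
    using bdd by (auto simp: H2_bounded_op_def)
  define A where "A = (\<Sum>n. sing_num T n powr p)"
  define \<sigma> where "\<sigma> = (1/2::real) powr (1/p)"
  define B where "B = A powr (1/p)"
  have A0: "A \<ge> 0" unfolding A_def by (intro suminf_nonneg sm) auto
  have \<sigma>: "0 < \<sigma>" "\<sigma> < 1" using p powr_less_mono2[of "1/p" "1/2" 1] by (auto simp: \<sigma>_def)
  have sing: "sing_num T (2 ^ j) \<le> B * \<sigma> ^ j" for j
  proof -
    have "2 ^ j * sing_num T (2 ^ j) powr p = (\<Sum>n<(2::nat) ^ j. sing_num T (2 ^ j) powr p)" by simp
    also have "\<dots> \<le> (\<Sum>n<(2::nat) ^ j. sing_num T n powr p)"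
      using p by (intro sum_mono powr_mono2 sing_num_antimono[OF bdd] sing_num_nonneg[OF bdd]) auto
    also have "\<dots> \<le> A" unfolding A_def by (rule sum_le_suminf[OF sm]) auto
    finally have "sing_num T (2 ^ j) powr p \<le> A * (1/2) ^ j" by (simp add: field_simps power_divide)
    then have "(sing_num T (2 ^ j) powr p) powr (1/p) \<le> (A * (1/2) ^ j) powr (1/p)"
      using p by (intro powr_mono2) auto
    also have "(sing_num T (2 ^ j) powr p) powr (1/p) = sing_num T (2 ^ j)"
      using p sing_num_nonneg[OF bdd] by (simp add: powr_powr)
    also have "(A * (1/2) ^ j) powr (1/p) = B * \<sigma> ^ j"
      using A0 by (simp add: powr_mult B_def \<sigma>_def powr_powr powr_realpow[symmetric] mult.commute flip: powr_realpow)
    finally show ?thesis .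
  qed
  \<comment> \<open>It dominates the ratio of the singular numbers and the ratio 1/2 from the rank
    term.\<close>
  define \<theta> where "\<theta> = max \<sigma> (1/2)"
  have \<theta>: "0 < \<theta>" "\<theta> < 1" "\<sigma> \<le> \<theta>" "1/2 \<le> \<theta>" using \<sigma> by (auto simp: \<theta>_def)
  have B0: "B \<ge> 0" by (simp add: B_def)
  \<comment> \<open>B + 1 instead of B makes the bound strict, as the choice of an approximant
    requires; B itself may be 0.\<close>
  define s where "s = (\<lambda>j. (B + 1) * \<theta> ^ j)"
  define C where "C = 2 * (B + 1)\<^sup>2 + 2 * (2 * C0\<^sup>2 + 2 * (B + 1)\<^sup>2)"
  have main: "(\<Sum>n<4^j. (h2norm (T (\<lambda>z. z ^ n)))\<^sup>2) \<le> (2 * C) * 4 ^ j * \<theta> ^ j" for j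
  proof -
    have s0: "s j \<ge> 0" using B0 \<theta> by (simp add: s_def)
    have "\<theta> ^ j \<le> 1" using \<theta> by (intro power_le_one) auto
    then have s1: "s j \<le> B + 1" using B0 by (simp add: s_def mult_left_le)
    have "sing_num T (2 ^ j) < s j"
    proof -
      have "B * \<sigma> ^ j \<le> B * \<theta> ^ j" using B0 \<sigma> \<theta> by (intro mult_left_mono power_mono) auto
      also have "\<dots> < s j" using \<theta> by (simp add: s_def algebra_simps)
      finally show ?thesis using sing[of j] by simp
    qed
    then obtain R where R: "H2_rank_le R (2 ^ j)" "\<And>f. f \<in> H2 \<Longrightarrow> h2norm (\<lambda>z. T f z - R f z) \<le> s j * h2norm f"
      using sing_num_approx[OF bdd] by metis
    have RH2: "R f \<in> H2" if "f \<in> H2" for f using R(1) that by (simp add: H2_rank_le_def H2_linear_op_def)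
    have TR: "(h2norm (\<lambda>z. T f z - R f z))\<^sup>2 \<le> (s j)\<^sup>2 * (h2norm f)\<^sup>2" if f: "f \<in> H2" for f
      using power_mono[OF R(2)[OF f] h2norm_nonneg[OF H2_diff(1)[OF TH2[OF f] RH2[OF f]]], of 2]
      by (simp add: power_mult_distrib)
    have Tb: "(h2norm (T f))\<^sup>2 \<le> C0\<^sup>2 * (h2norm f)\<^sup>2" if f: "f \<in> H2" for f
      using power_mono[OF C0[OF f] h2norm_nonneg[OF TH2[OF f]], of 2] by (simp add: power_mult_distrib)
    define D where "D = 2 * C0\<^sup>2 + 2 * (s j)\<^sup>2"
    have Rb: "(h2norm (R f))\<^sup>2 \<le> D * (h2norm f)\<^sup>2" if f: "f \<in> H2" for f
    proof -
      have "(h2norm (R f))\<^sup>2 = (h2norm (\<lambda>z. T f z - (T f z - R f z)))\<^sup>2" by simp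
      also have "\<dots> \<le> 2 * (h2norm (T f))\<^sup>2 + 2 * (h2norm (\<lambda>z. T f z - R f z))\<^sup>2"
        by (intro H2_diff TH2 RH2 f)
      also have "\<dots> \<le> D * (h2norm f)\<^sup>2" using TR[OF f] Tb[OF f] by (simp add: D_def algebra_simps)
      finally show ?thesis .
    qed
    have D: "D \<ge> 0" "D \<le> 2 * C0\<^sup>2 + 2 * (B + 1)\<^sup>2"
      using power_mono[OF s1 s0, of 2] by (auto simp: D_def)
    have e: "(h2norm (T (\<lambda>z. z ^ n)))\<^sup>2 \<le> 2 * (h2norm (R (\<lambda>z. z ^ n)))\<^sup>2 + 2 * (s j)\<^sup>2" for n
    proof -
      let ?f = "\<lambda>z::complex. z ^ n"
      \<comment> \<open>The negative is introduced so that T = (T - R) + R can be read as a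
        difference and fed to \<open>H2_diff\<close>.\<close>
      have m: "(\<lambda>z. - R ?f z) \<in> H2" "h2norm (\<lambda>z. - R ?f z) = h2norm (R ?f)"
      proof -
        have h: "R ?f holomorphic_on unit_disc" using RH2[OF monomial_H2] by (simp add: H2_def)
        have "taylor_coeff (\<lambda>z. - R ?f z) k = - taylor_coeff (R ?f) k" for k
          using taylor_coeff_lincomb[OF h h, of "-1" 0] by simp
        then show "(\<lambda>z. - R ?f z) \<in> H2" "h2norm (\<lambda>z. - R ?f z) = h2norm (R ?f)"
          using RH2[OF monomial_H2, of n] by (auto simp: H2_def h2norm_def intro!: holomorphic_intros)
      qed
      have "(h2norm (T ?f))\<^sup>2 = (h2norm (\<lambda>z. (T ?f z - R ?f z) - (- R ?f z)))\<^sup>2" by simp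
      also have "\<dots> \<le> 2 * (h2norm (\<lambda>z. T ?f z - R ?f z))\<^sup>2 + 2 * (h2norm (\<lambda>z. - R ?f z))\<^sup>2"
        by (intro H2_diff TH2 RH2 monomial_H2 m)
      also have "\<dots> \<le> 2 * (s j)\<^sup>2 + 2 * (h2norm (R ?f))\<^sup>2"
        using TR[OF monomial_H2, of n] by (simp add: m h2norm_monomial)
      finally show ?thesis by simp
    qed
    have "(\<Sum>n<4^j. (h2norm (T (\<lambda>z. z ^ n)))\<^sup>2) \<le> (\<Sum>n<4^j. 2 * (h2norm (R (\<lambda>z. z ^ n)))\<^sup>2 + 2 * (s j)\<^sup>2)"
      by (intro sum_mono e)
    also have "\<dots> = 2 * (\<Sum>n<4^j. (h2norm (R (\<lambda>z. z ^ n)))\<^sup>2) + 2 * 4 ^ j * (s j)\<^sup>2"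
      by (simp add: sum.distrib sum_distrib_left)
    also have "\<dots> \<le> 2 * (2 ^ j * D) + 2 * 4 ^ j * (s j)\<^sup>2"
      using hilbert_schmidt_rank_bound[OF R(1) D(1) Rb, of "4 ^ j"] by simp
    also have "2 ^ j * D = 4 ^ j * (1/2) ^ j * D"
      by (simp flip: power_mult_distrib)
    also have "2 * (4 ^ j * (1/2) ^ j * D) + 2 * 4 ^ j * (s j)\<^sup>2 = 4 ^ j * (2 * ((1/2) ^ j * D) + 2 * (s j)\<^sup>2)"
      by (simp add: algebra_simps)
    also have "\<dots> \<le> 4 ^ j * (2 * C * \<theta> ^ j)"
    proof (rule mult_left_mono)
      have "(1/2) ^ j * D \<le> \<theta> ^ j * (2 * C0\<^sup>2 + 2 * (B + 1)\<^sup>2)"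
        using \<theta> D by (intro mult_mono power_mono) auto
      moreover have "(s j)\<^sup>2 \<le> \<theta> ^ j * (B + 1)\<^sup>2"
      proof -
        have "(s j)\<^sup>2 = (\<theta> ^ j * \<theta> ^ j) * (B + 1)\<^sup>2" by (simp add: s_def power2_eq_square)
        also have "\<dots> \<le> (\<theta> ^ j * 1) * (B + 1)\<^sup>2"
          using \<theta> \<open>\<theta> ^ j \<le> 1\<close> by (intro mult_right_mono mult_left_mono) auto
        finally show ?thesis by simp
      qed
      ultimately have "2 * ((1/2) ^ j * D) + 2 * (s j)\<^sup>2 \<le> \<theta> ^ j * (2 * (2 * C0\<^sup>2 + 2 * (B + 1)\<^sup>2) + 2 * (B + 1)\<^sup>2)"
        by (simp add: algebra_simps)
      also have "\<dots> \<le> \<theta> ^ j * (2 * C)"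
        using \<theta> by (intro mult_left_mono) (auto simp: C_def)
      finally show "2 * ((1/2) ^ j * D) + 2 * (s j)\<^sup>2 \<le> 2 * C * \<theta> ^ j" by (simp add: mult_ac)
    qed simp
    finally show ?thesis by (simp add: mult_ac)
  qed
  show ?thesis
    by (rule that[OF \<theta>(1,2) _ main]) (simp add: C_def)
qed

subsection \<open>Sufficiency of the logarithmic condition\<close>

text \<open>Cauchy-Schwarz between the tail coefficients and a geometric series. The loss 1 / (1 -
  |z|^2), taken at phi z, is later absorbed by the weight.\<close>

lemma H2_tail_bound:
  assumes f: "f \<in> H2" and z: "cmod z < 1"
  shows "(cmod (f z - (\<Sum>i<N. taylor_coeff f i * z ^ i)))\<^sup>2 \<le> (h2norm f)\<^sup>2 * (cmod z ^ (2*N) / (1 - (cmod z)\<^sup>2))"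
proof -
  have hol: "f holomorphic_on unit_disc" using f by (simp add: H2_def)
  define a where "a = taylor_coeff f"
  have z2: "(cmod z)\<^sup>2 < 1" using z by (simp add: abs_square_less_1)
  have s: "(\<lambda>n. a (n + N) * z ^ (n + N)) sums (f z - (\<Sum>i<N. a i * z ^ i))"
    using sums_split_initial_segment[OF taylor_sums[OF hol z]] by (simp add: a_def)
  have "(cmod (\<Sum>n<M. a (n + N) * z ^ (n + N)))\<^sup>2 \<le> (h2norm f)\<^sup>2 * (cmod z ^ (2*N) / (1 - (cmod z)\<^sup>2))" for M
  proof -
    have "(cmod (\<Sum>n<M. a (n + N) * z ^ (n + N)))\<^sup>2 \<le> (\<Sum>n<M. cmod (a (n + N)) * cmod z ^ (n + N))\<^sup>2"
      by (intro power_mono order_trans[OF norm_sum]) (auto simp: norm_mult norm_power)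
    also have "\<dots> \<le> (\<Sum>n<M. (cmod (a (n + N)))\<^sup>2) * (\<Sum>n<M. (cmod z ^ (n + N))\<^sup>2)"
      by (rule Cauchy_Schwarz_ineq_sum)
    also have "\<dots> \<le> (h2norm f)\<^sup>2 * (cmod z ^ (2*N) / (1 - (cmod z)\<^sup>2))"
    proof (rule mult_mono)
      have "(\<Sum>n<M. (cmod (a (n + N)))\<^sup>2) = (\<Sum>n\<in>(\<lambda>n. n + N) ` {..<M}. (cmod (a n))\<^sup>2)"
        by (subst sum.reindex) (auto simp: inj_on_def)
      also have "\<dots> \<le> (\<Sum>n. (cmod (a n))\<^sup>2)"
        using h2norm_square[OF f] by (intro sum_le_suminf) (auto simp: a_def sums_iff)
      finally show "(\<Sum>n<M. (cmod (a (n + N)))\<^sup>2) \<le> (h2norm f)\<^sup>2"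
        using h2norm_square[OF f] by (simp add: a_def sums_iff)
      have "(\<Sum>n<M. (cmod z ^ (n + N))\<^sup>2) = cmod z ^ (2*N) * (\<Sum>n<M. ((cmod z)\<^sup>2) ^ n)"
        unfolding sum_distrib_left by (intro sum.cong refl) (simp add: power_add power_mult_distrib power_mult[symmetric] mult.commute)
      also have "\<dots> \<le> cmod z ^ (2*N) * (1 / (1 - (cmod z)\<^sup>2))"
      proof (rule mult_left_mono)
        have "(\<Sum>n<M. ((cmod z)\<^sup>2) ^ n) \<le> (\<Sum>n. ((cmod z)\<^sup>2) ^ n)"
          using z2 by (intro sum_le_suminf summable_geometric) auto
        also have "\<dots> = 1 / (1 - (cmod z)\<^sup>2)" using z2 by (intro suminf_geometric) auto
        finally show "(\<Sum>n<M. ((cmod z)\<^sup>2) ^ n) \<le> 1 / (1 - (cmod z)\<^sup>2)" .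
      qed simp
      finally show "(\<Sum>n<M. (cmod z ^ (n + N))\<^sup>2) \<le> cmod z ^ (2*N) / (1 - (cmod z)\<^sup>2)" by simp
    qed (auto intro: sum_nonneg)
    finally show ?thesis .
  qed
  then show ?thesis
    using tendsto_power[OF tendsto_norm[OF s[unfolded sums_def]], of 2] 
    unfolding a_def by (intro LIMSEQ_le_const2) auto
qed

text \<open>For m = 1, (q + 1) y^q is at most the geometric sum up to q, and multiplying by 1 - y
  leaves at most 1. In general each of the m factors 1 - y takes q = N div m powers of y, and N + 1
  <= m (q + 1). This converts powers of the defect into decay in N.\<close>

lemma power_mult_one_minus_power_le:
  fixes y :: real
  assumes y: "0 \<le> y" "y \<le> 1"
  shows "y ^ N * (1 - y) ^ m \<le> (real m / (real N + 1)) ^ m"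
proof (cases "m = 0")
  case True
  then show ?thesis using y by (simp add: power_le_one)
next
  case False
  define q where "q = N div m"
  have one: "y ^ q * (1 - y) \<le> 1 / (real q + 1)"
  proof -
    have "(real q + 1) * y ^ q = (\<Sum>i\<le>q. y ^ q)" by simp
    also have "\<dots> \<le> (\<Sum>i\<le>q. y ^ i)" using y by (intro sum_mono power_decreasing) auto
    finally have "(1 - y) * ((real q + 1) * y ^ q) \<le> (1 - y) * (\<Sum>i\<le>q. y ^ i)"
      using y by (intro mult_left_mono) auto
    also have "\<dots> = 1 - y ^ Suc q" by (rule sum_gp_basic)
    also have "\<dots> \<le> 1" using y by simp
    finally show ?thesis by (simp add: field_simps)
  qed
  have "q * m \<le> N" by (simp add: q_def)
  then have "y ^ N \<le> y ^ (q * m)" using y by (intro power_decreasing) auto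
  then have "y ^ N * (1 - y) ^ m \<le> y ^ (q * m) * (1 - y) ^ m"
    using y by (intro mult_right_mono) auto
  also have "\<dots> = (y ^ q * (1 - y)) ^ m" by (simp add: power_mult power_mult_distrib)
  also have "\<dots> \<le> (1 / (real q + 1)) ^ m" using y by (intro power_mono one) auto
  also have "\<dots> \<le> (real m / (real N + 1)) ^ m"
  proof (intro power_mono)
    have "N = q * m + N mod m" by (simp add: q_def)
    moreover have "N mod m < m" using False by simp
    ultimately have "N + 1 \<le> m * (q + 1)" by (simp add: algebra_simps)
    then have "real (N + 1) \<le> real (m * (q + 1))" by (rule of_nat_mono)
    then show "1 / (real q + 1) \<le> real m / (real N + 1)" by (simp add: field_simps)
  qed auto
  finally show ?thesis .
qed

lemma sing_num_le:
  assumes "C \<ge> 0" "H2_rank_le R n" "\<And>f. f \<in> H2 \<Longrightarrow> h2norm (\<lambda>z. T f z - R f z) \<le> C * h2norm f"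
  shows "sing_num T n \<le> C" "sing_num T n \<ge> 0"
proof -
  let ?S = "{C. C \<ge> 0 \<and> (\<exists>R. H2_rank_le R n \<and> (\<forall>f\<in>H2. h2norm (\<lambda>z. T f z - R f z) \<le> C * h2norm f))}"
  have mem: "C \<in> ?S" using assms by blast
  show "sing_num T n \<le> C" unfolding sing_num_def
    by (rule cInf_lower[OF mem]) (auto intro!: bdd_belowI[of _ 0])
  show "sing_num T n \<ge> 0" unfolding sing_num_def
    by (rule cInf_greatest) (use mem in auto)
qed

context self_map
begin

lemma wcomp_holomorphic:
  assumes "w holomorphic_on unit_disc" "f holomorphic_on unit_disc"
  shows "wcomp w \<phi> f holomorphic_on unit_disc"
  unfolding wcomp_def
  by (intro holomorphic_intros assms holomorphic_on_compose_gen[OF hol assms(2) ran, unfolded o_def])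

text \<open>The operator \<open>R N\<close> truncates the Taylor series of f after N terms, so its
  rank is at most N. The error is estimated pointwise on the disk, which bounds the H^2 norm and
  thus the singular numbers.\<close>

theorem schatten_if_log_integral_finite:
  assumes "log_integral \<phi> < \<infinity>"
  obtains w where "w \<in> Hinf" "w \<in> H2" "w 0 \<noteq> 0" "hilbert_schmidt (wcomp w \<phi>)" "\<And>p. p > 0 \<Longrightarrow> schatten p (wcomp w \<phi>)"
proof -
  obtain w where w: "w holomorphic_on unit_disc" "w 0 \<noteq> 0"
    "\<And>K::nat. \<exists>C>0. \<forall>z\<in>unit_disc. cmod (w z) \<le> C * (1 - (cmod (\<phi> z))\<^sup>2) ^ K"
    using fast_weight_exists[OF assms] by metis
  let ?T = "wcomp w \<phi>"
  define R where "R = (\<lambda>N f z. w z * (\<Sum>i<N. taylor_coeff f i * \<phi> z ^ i))"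
  have key: "\<exists>C>0. \<forall>N. \<forall>f\<in>H2. \<forall>z\<in>unit_disc. cmod (?T f z - R N f z) \<le> C * (2 * real k / (real N + 1)) ^ k * h2norm f"
    if k: "k > 0" for k :: nat
  proof -
    \<comment> \<open>The square of the weight carries (1 - y)^(4k). Half of it pays for the factor
      1 / (1 - y) of the tail bound; the other half meets y^N and yields (2k / (N + 1))^(2k), whose
      square root is the claimed rate.\<close>
    obtain C where C: "C > 0" "\<And>z. z \<in> unit_disc \<Longrightarrow> cmod (w z) \<le> C * (1 - (cmod (\<phi> z))\<^sup>2) ^ (2*k)"
      using w(3)[of "2*k"] by auto
    have "cmod (?T f z - R N f z) \<le> C * (2 * real k / (real N + 1)) ^ k * h2norm f"
      if f: "f \<in> H2" and z: "z \<in> unit_disc" for N f z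
    proof -
      define y where "y = (cmod (\<phi> z))\<^sup>2"
      have pz: "cmod (\<phi> z) < 1" using norm_less_1 z by simp
      then have y: "0 \<le> y" "y < 1" by (auto simp: y_def abs_square_less_1)
      have Ty: "cmod (\<phi> z) ^ (2*N) / (1 - (cmod (\<phi> z))\<^sup>2) = y ^ N / (1 - y)"
        by (simp add: y_def power_mult)
      have "(cmod (?T f z - R N f z))\<^sup>2 = (cmod (w z))\<^sup>2 * (cmod (f (\<phi> z) - (\<Sum>i<N. taylor_coeff f i * \<phi> z ^ i)))\<^sup>2"
        by (simp add: wcomp_def R_def power_mult_distrib[symmetric] norm_mult[symmetric] algebra_simps)
      also have "\<dots> \<le> (C * (1 - y) ^ (2*k))\<^sup>2 * ((h2norm f)\<^sup>2 * (y ^ N / (1 - y)))"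
        by (intro mult_mono power_mono H2_tail_bound[OF f pz, of N, unfolded Ty] C(2)[OF z, folded y_def]) auto
      also have "\<dots> = (C * h2norm f)\<^sup>2 * (y ^ N * ((1 - y) ^ (2*k) * ((1 - y) ^ (2*k) / (1 - y))))"
        by (simp add: power_mult_distrib power2_eq_square)
      also have "\<dots> \<le> (C * h2norm f)\<^sup>2 * (y ^ N * ((1 - y) ^ (2*k) * 1))"
      proof (intro mult_left_mono)
        have "(1 - y) ^ (2*k) \<le> (1 - y) ^ 1" using y k by (intro power_decreasing) auto
        then show "(1 - y) ^ (2*k) / (1 - y) \<le> 1" using y by simp
      qed (use y in auto)
      also have "\<dots> \<le> (C * h2norm f)\<^sup>2 * ((2 * real k / (real N + 1)) ^ (2*k))"
        using power_mult_one_minus_power_le[of y N "2*k"] y by (intro mult_left_mono) auto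
      also have "\<dots> = (C * (2 * real k / (real N + 1)) ^ k * h2norm f)\<^sup>2"
        by (simp add: power_mult_distrib power_mult mult.commute)
      finally show ?thesis
        by (rule power2_le_imp_le) (use C h2norm_nonneg[OF f] in auto)
    qed
    then show ?thesis using C(1) by blast
  qed
  obtain C0 where C0: "C0 > 0" "\<And>z. z \<in> unit_disc \<Longrightarrow> cmod (w z) \<le> C0"
    using w(3)[of 0] by auto
  have wH2: "w \<in> H2" by (rule H2_if_bounded(1)[OF w(1) C0(2)])
  have wHinf: "w \<in> Hinf" using w(1) C0(2) by (auto simp: Hinf_def bounded_iff intro!: exI[of _ C0])
  have Rhol: "R N f holomorphic_on unit_disc" for N f
    unfolding R_def by (intro holomorphic_intros w hol)
  have fhol: "f holomorphic_on unit_disc" if "f \<in> H2" for f using that by (simp add: H2_def)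
  have TRhol: "(\<lambda>z. ?T f z - R N f z) holomorphic_on unit_disc" if "f \<in> H2" for f N
    by (intro holomorphic_on_diff wcomp_holomorphic w fhol Rhol that)
  have TR: "(\<lambda>z. ?T f z - R N f z) \<in> H2 \<and> h2norm (\<lambda>z. ?T f z - R N f z) \<le> C * (2 * real k / (real N + 1)) ^ k * h2norm f"
    if "\<forall>N. \<forall>f\<in>H2. \<forall>z\<in>unit_disc. cmod (?T f z - R N f z) \<le> C * (2 * real k / (real N + 1)) ^ k * h2norm f" "f \<in> H2"
    for C f N and k :: nat
    using H2_if_bounded[OF TRhol[OF that(2)], of N "C * (2 * real k / (real N + 1)) ^ k * h2norm f"] that by auto
  \<comment> \<open>Hence the error estimate at N = 0 is an estimate for the operator itself, and
    gives both that it maps into \<open>H2\<close> and that it is bounded.\<close>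
  have R0: "R 0 f = (\<lambda>z. 0)" for f by (simp add: R_def)
  have lin: "H2_linear_op ?T" unfolding H2_linear_op_def
  proof (intro conjI ballI allI)
    fix f assume f: "f \<in> H2"
    obtain C where "\<forall>N. \<forall>f\<in>H2. \<forall>z\<in>unit_disc. cmod (?T f z - R N f z) \<le> C * (2 * real 1 / (real N + 1)) ^ 1 * h2norm f"
      using key[of 1] by auto
    from TR[of C 1 f 0] this f show "?T f \<in> H2" by (simp add: R0)
  qed (simp add: wcomp_def algebra_simps)
  have bdd: "H2_bounded_op ?T" unfolding H2_bounded_op_def
  proof (intro conjI lin)
    obtain C where "\<forall>N. \<forall>f\<in>H2. \<forall>z\<in>unit_disc. cmod (?T f z - R N f z) \<le> C * (2 * real 1 / (real N + 1)) ^ 1 * h2norm f"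
      using key[of 1] by auto
    from TR[of C 1 _ 0] this show "\<exists>C. \<forall>f\<in>H2. h2norm (?T f) \<le> C * h2norm f"
      by (intro exI[of _ "C * 2"]) (simp add: R0)
  qed
  have rank: "H2_rank_le (R N) N" for N
  proof -
    have tc: "taylor_coeff (\<lambda>x. a * f x + b * g x) i = a * taylor_coeff f i + b * taylor_coeff g i"
      if "f \<in> H2" "g \<in> H2" for a b f g i
      using that by (intro taylor_coeff_lincomb fhol)
    have RH2: "R N f \<in> H2" for f
    proof (rule H2_if_bounded(1)[OF Rhol])
      fix z :: complex assume z: "z \<in> unit_disc"
      have "cmod (R N f z) \<le> C0 * (\<Sum>i<N. cmod (taylor_coeff f i))"
        unfolding R_def norm_mult
      proof (intro mult_mono C0(2) z order_trans[OF norm_sum] sum_mono)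
        show "cmod (taylor_coeff f i * \<phi> z ^ i) \<le> cmod (taylor_coeff f i)" for i
          using norm_less_1[of z] z by (auto simp: norm_mult norm_power intro!: mult_left_le power_le_one)
      qed (use C0(1) in auto)
      then show "cmod (R N f z) \<le> C0 * (\<Sum>i<N. cmod (taylor_coeff f i))" .
    qed
    have "H2_linear_op (R N)" unfolding H2_linear_op_def
    proof (intro conjI ballI allI RH2)
      fix f g a b z assume "f \<in> H2" "g \<in> H2"
      then show "R N (\<lambda>x. a * f x + b * g x) z = a * R N f z + b * R N g z"
        by (simp add: R_def tc sum.distrib sum_distrib_left algebra_simps)
    qed
    moreover have "R N f z = (\<Sum>i<N. taylor_coeff f i * (w z * \<phi> z ^ i))" for f z
      by (simp add: R_def sum_distrib_left mult_ac)
    ultimately show ?thesis unfolding H2_rank_le_def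
      by (intro conjI exI[of _ "\<lambda>i z. w z * \<phi> z ^ i"] ballI exI[of _ "taylor_coeff _"]) auto
  qed
  have sing: "\<exists>C>0. \<forall>N. sing_num ?T N \<le> C * (2 * real k / (real N + 1)) ^ k \<and> sing_num ?T N \<ge> 0" if k0: "k > 0" for k :: nat
  proof -
    obtain C where C: "C > 0" "\<forall>N. \<forall>f\<in>H2. \<forall>z\<in>unit_disc. cmod (?T f z - R N f z) \<le> C * (2 * real k / (real N + 1)) ^ k * h2norm f"
      using key[OF k0] by auto
    have "sing_num ?T N \<le> C * (2 * real k / (real N + 1)) ^ k \<and> sing_num ?T N \<ge> 0" for N
      using sing_num_le[of "C * (2 * real k / (real N + 1)) ^ k" "R N" N ?T] C(1) rank TR[OF C(2), of _ N] by simp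
    then show ?thesis using C(1) by blast
  qed
  have sch: "schatten p ?T" if p: "p > 0" for p
  proof -
    \<comment> \<open>The singular numbers are of order N^-k, so this k bounds their p-th powers by
      a constant times (N + 1)^-2.\<close>
    obtain k :: nat where k: "k * p \<ge> 2" "k > 0"
    proof -
      obtain k :: nat where "real k > max (2 / p) 1" using reals_Archimedean2 by blast
      then have "k * p \<ge> 2" "k > 0" using p by (auto simp: field_simps)
      then show ?thesis by (rule that)
    qed
    obtain C where C: "C > 0" "\<And>N. sing_num ?T N \<le> C * (2 * real k / (real N + 1)) ^ k" "\<And>N. sing_num ?T N \<ge> 0"
      using sing[OF k(2)] by auto
    define D where "D = C * (2 * real k) ^ k"
    have D: "D > 0" using C k by (simp add: D_def)
    have "summable (\<lambda>N. sing_num ?T N powr p)"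
    proof (rule summable_comparison_test'[where N=0])
      show "summable (\<lambda>N. D powr p * inverse (real (Suc N) ^ 2))"
        by (intro summable_mult, subst summable_Suc_iff) (rule inverse_power_summable, simp)
      fix N
      have "sing_num ?T N \<le> D * inverse (real (Suc N) ^ k)"
        using C(2)[of N] by (simp add: D_def power_divide power_mult_distrib divide_inverse power_inverse add.commute mult.assoc)
      then have "sing_num ?T N powr p \<le> (D * inverse (real (Suc N) ^ k)) powr p"
        using C(3) p by (intro powr_mono2) auto
      also have "\<dots> = D powr p * (real (Suc N) ^ k) powr (- p)"
        using D by (simp add: powr_mult powr_minus inverse_powr del: of_nat_Suc)
      also have "(real (Suc N) ^ k) powr (- p) = real (Suc N) powr (- (k * p))"
        by (simp add: powr_realpow[symmetric] powr_powr del: of_nat_Suc)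
      also have "\<dots> \<le> real (Suc N) powr (- 2)"
        using k by (intro powr_mono) auto
      also have "\<dots> = inverse (real (Suc N) ^ 2)"
        by (simp add: powr_minus powr_numeral del: of_nat_Suc)
      finally show "norm (sing_num ?T N powr p) \<le> D powr p * inverse (real (Suc N) ^ 2)" using D by simp
    qed
    then show ?thesis using bdd by (simp add: schatten_def)
  qed
  have hs: "hilbert_schmidt ?T"
  proof -
    \<comment> \<open>One power of the defect suffices here: it makes the image of z^n uniformly of
      size 1 / (n + 1), and the squares are summable.\<close>
    obtain C where C: "C > 0" "\<And>z. z \<in> unit_disc \<Longrightarrow> cmod (w z) \<le> C * (1 - (cmod (\<phi> z))\<^sup>2) ^ 1"
      using w(3)[of 1] by auto
    have le: "h2norm (?T (\<lambda>z. z ^ n)) \<le> 2 * C / (real n + 1)" for n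
    proof (rule H2_if_bounded(2))
      show "?T (\<lambda>z. z ^ n) holomorphic_on unit_disc"
        by (intro wcomp_holomorphic w holomorphic_intros)
      fix z :: complex assume z: "z \<in> unit_disc"
      define x where "x = cmod (\<phi> z)"
      have x: "0 \<le> x" "x < 1" using norm_less_1[of z] z by (auto simp: x_def)
      have "cmod (?T (\<lambda>z. z ^ n) z) \<le> C * (1 - x\<^sup>2) * x ^ n"
        using C(2)[OF z] by (auto simp: wcomp_def norm_mult norm_power x_def intro!: mult_right_mono)
      also have "\<dots> = C * (1 + x) * (x ^ n * (1 - x) ^ 1)" by (simp add: power2_eq_square algebra_simps)
      also have "\<dots> \<le> (C * 2) * (1 / (real n + 1)) ^ 1"
        using power_mult_one_minus_power_le[of x n 1] x C(1)
        by (intro mult_mono mult_left_mono) auto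
      finally show "cmod (?T (\<lambda>z. z ^ n) z) \<le> 2 * C / (real n + 1)" by (simp add: mult.commute)
    qed
    have "summable (\<lambda>n. (h2norm (?T (\<lambda>z. z ^ n)))\<^sup>2)"
    proof (rule summable_comparison_test'[where N=0])
      show "summable (\<lambda>n. (2 * C)\<^sup>2 * inverse (real (Suc n) ^ 2))"
        by (intro summable_mult, subst summable_Suc_iff) (rule inverse_power_summable, simp)
      fix n
      have "?T (\<lambda>z. z ^ n) \<in> H2"
        using lin monomial_H2 by (simp add: H2_linear_op_def)
      then have "(h2norm (?T (\<lambda>z. z ^ n)))\<^sup>2 \<le> (2 * C / (real n + 1))\<^sup>2"
        by (intro power_mono le h2norm_nonneg)
      then show "norm ((h2norm (?T (\<lambda>z. z ^ n)))\<^sup>2) \<le> (2 * C)\<^sup>2 * inverse (real (Suc n) ^ 2)"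
        by (simp add: power_divide power_mult_distrib divide_inverse power_inverse add.commute)
    qed
    then show ?thesis using bdd by (simp add: hilbert_schmidt_def)
  qed
  show ?thesis by (rule that[OF wHinf wH2 w(2) hs sch])
qed

end

subsection \<open>Necessity of the logarithmic condition\<close>

lemma integral_minus_left_endpoint_le:
  fixes H :: "real \<Rightarrow> real"
  assumes "continuous_on {a..a+d} H" "d \<ge> 0" and e: "\<And>x. x \<in> {a..a+d} \<Longrightarrow> \<bar>H x - H a\<bar> \<le> e"
  shows "\<bar>integral {a..a+d} H - d * H a\<bar> \<le> d * e"
proof -
  have "((\<lambda>x. H x - H a) has_integral (integral {a..a+d} H - d * H a)) {a..a+d}"
    using has_integral_diff[OF integrable_integral[OF integrable_continuous_real[OF assms(1)]] has_integral_const_real[of "H a" a "a+d"]] \<open>d \<ge> 0\<close>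
    by simp
  moreover have "e \<ge> 0" using e[of a] \<open>d \<ge> 0\<close> by simp
  ultimately have "norm (integral {a..a+d} H - d * H a) \<le> e * measure lborel {a..a+d}"
    using e by (intro has_integral_bound_real[of e]) auto
  then show ?thesis using \<open>d \<ge> 0\<close> by (simp add: mult.commute)
qed

text \<open>The starting point of the nodes may vary arbitrarily with N, as the one produced in
  \<open>weighted_jensen\<close> does. Periodicity removes the shift from the integral, and uniform
  continuity on [0, 4 pi], which contains all nodes, makes the error independent of it.\<close>

lemma riemann_sums_circ:
  fixes H :: "real \<Rightarrow> real" and s :: "nat \<Rightarrow> real"
  assumes H: "continuous_on UNIV H" and per: "\<And>t. H (t + 2*pi) = H t" and s: "\<And>N. s N \<in> {0..2*pi}"
  shows "(\<lambda>N. (\<Sum>j<N. H (s N + 2*pi/real N * real j)) / N) \<longlonglongrightarrow> (LINT t|circ. H t)"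
proof (rule LIMSEQ_I)
  fix e :: real assume e: "e > 0"
  have hi: "H integrable_on {a..b}" for a b
    by (intro integrable_continuous_real continuous_on_subset[OF H]) auto
  have "uniformly_continuous_on {0..4*pi} H"
    by (intro compact_uniformly_continuous continuous_on_subset[OF H]) auto
  then obtain d where d: "d > 0" "\<And>x y. x \<in> {0..4*pi} \<Longrightarrow> y \<in> {0..4*pi} \<Longrightarrow> \<bar>x - y\<bar> < d \<Longrightarrow> \<bar>H x - H y\<bar> < e / 2"
    using e unfolding uniformly_continuous_on_def dist_real_def by (metis half_gt_zero)
  obtain N0 :: nat where N0: "N0 > 2 * pi / d" using reals_Archimedean2 by blast
  show "\<exists>N0. \<forall>N\<ge>N0. norm ((\<Sum>j<N. H (s N + 2*pi/real N * real j)) / N - (LINT t|circ. H t)) < e"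
  proof (intro exI[of _ "max 1 N0"] allI impI)
    fix N assume "max 1 N0 \<le> N"
    then have N: "N > 0" "N0 \<le> N" by auto
    define h where "h = 2 * pi / N"
    have h: "h > 0" using N by (simp add: h_def)
    have "2 * pi / d < N" using N N0 by linarith
    then have hd: "h < d" using d(1) N by (simp add: h_def field_simps)
    have hN: "h * N = 2 * pi" using N by (simp add: h_def)
    define a where "a = (\<lambda>j::nat. s N + h * j)"
    have split: "integral {s N..a m} H = (\<Sum>j<m. integral {a j..a j + h} H)" for m
    proof (induction m)
      case (Suc m)
      have "a m + h = a (Suc m)" by (simp add: a_def algebra_simps)
      moreover have "s N \<le> a m" using h by (simp add: a_def)
      ultimately have "integral {s N..a (Suc m)} H = integral {s N..a m} H + integral {a m..a m + h} H"
        using Henstock_Kurzweil_Integration.integral_combine[OF _ _ hi, of "s N" "a m" "a (Suc m)"] h by simp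
      then show ?case using Suc by simp
    qed (simp add: a_def)
    have aN: "a N = s N + 2 * pi" using hN by (simp add: a_def)
    have "integral {s N..s N + 2*pi} H = integral {0..2*pi} H"
    proof -
      have "integral {0..s N} H + integral {s N..s N + 2*pi} H = integral {0..s N + 2*pi} H"
        using s[of N] by (intro Henstock_Kurzweil_Integration.integral_combine hi) auto
      also have "\<dots> = integral {0..2*pi} H + integral {2*pi..s N + 2*pi} H"
        using s[of N] by (intro Henstock_Kurzweil_Integration.integral_combine[symmetric] hi) auto
      also have "integral {2*pi..s N + 2*pi} H = integral {0..s N} H"
        using integral_shift_real_ivl[of "2*pi" "2*pi" "s N + 2*pi" H] per by simp
      finally show ?thesis by simp
    qed
    then have I: "integral {0..2*pi} H = (\<Sum>j<N. integral {a j..a j + h} H)"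
      using split[of N] by (simp add: aN)
    have piece: "\<bar>integral {a j..a j + h} H - h * H (a j)\<bar> \<le> h * (e / 2)" if "j < N" for j
    proof (rule integral_minus_left_endpoint_le)
      show "continuous_on {a j..a j + h} H" by (rule continuous_on_subset[OF H]) auto
      fix x assume x: "x \<in> {a j..a j + h}"
      have "h * (real j + 1) \<le> h * N" using that h by (intro mult_left_mono) auto
      then have "a j + h \<le> 4 * pi" using s[of N] hN by (simp add: a_def algebra_simps)
      moreover have "a j \<ge> 0" using s[of N] h by (simp add: a_def)
      ultimately have "x \<in> {0..4*pi}" "a j \<in> {0..4*pi}" using x h by auto
      moreover have "\<bar>x - a j\<bar> < d" using x hd by auto
      ultimately show "\<bar>H x - H (a j)\<bar> \<le> e / 2" using d(2) by (meson less_imp_le)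
    qed (use h in auto)
    have "\<bar>integral {0..2*pi} H - h * (\<Sum>j<N. H (a j))\<bar> = \<bar>\<Sum>j<N. integral {a j..a j + h} H - h * H (a j)\<bar>"
      unfolding I by (simp add: sum_subtractf sum_distrib_left)
    also have "\<dots> \<le> (\<Sum>j<N. h * (e / 2))" by (intro order_trans[OF sum_abs] sum_mono piece) auto
    also have "\<dots> = 2 * pi * (e / 2)" using hN by (simp add: mult_ac)
    finally have *: "\<bar>integral {0..2*pi} H - h * (\<Sum>j<N. H (a j))\<bar> \<le> 2 * pi * (e / 2)" .
    have "(\<Sum>j<N. H (a j)) / N - (LINT t|circ. H t) = - ((integral {0..2*pi} H - h * (\<Sum>j<N. H (a j))) / (2 * pi))"
      unfolding integral_circ_eq[OF H] h_def using N by (simp add: field_simps)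
    then have "\<bar>(\<Sum>j<N. H (a j)) / N - (LINT t|circ. H t)\<bar> = \<bar>integral {0..2*pi} H - h * (\<Sum>j<N. H (a j))\<bar> / (2 * pi)"
      by simp
    also have "\<dots> \<le> 2 * pi * (e / 2) / (2 * pi)" by (intro divide_right_mono *) auto
    also have "\<dots> < e" using e by simp
    finally show "norm ((\<Sum>j<N. H (s N + 2*pi/real N * real j)) / N - (LINT t|circ. H t)) < e"
      by (simp add: a_def h_def)
  qed
qed

text \<open>Summing ln u <= u - 1 over the quotients u of the x j by their mean leaves zero on the
  right.\<close>

lemma sum_ln_le_ln_mean:
  fixes x :: "nat \<Rightarrow> real"
  assumes "N > 0" "\<And>j. j < N \<Longrightarrow> x j > 0"
  shows "(\<Sum>j<N. ln (x j)) / N \<le> ln ((\<Sum>j<N. x j) / N)"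
proof -
  define a where "a = (\<Sum>j<N. x j) / N"
  have a: "a > 0" unfolding a_def using assms by (intro divide_pos_pos sum_pos) auto
  have "(\<Sum>j<N. ln (x j)) \<le> (\<Sum>j<N. ln a + (x j / a - 1))"
  proof (rule sum_mono)
    fix j assume "j \<in> {..<N}"
    then have "x j > 0" using assms by simp
    then have "ln (x j) - ln a \<le> x j / a - 1" using a ln_le_minus_one[of "x j / a"] by (simp add: ln_div)
    then show "ln (x j) \<le> ln a + (x j / a - 1)" by simp
  qed
  also have "\<dots> = N * ln a + (\<Sum>j<N. x j) / a - N"
    by (simp add: sum.distrib sum_subtractf sum_divide_distrib)
  also have "(\<Sum>j<N. x j) / a = N" using a assms(1) by (simp add: a_def field_simps)
  finally have "(\<Sum>j<N. ln (x j)) \<le> N * ln a" by simp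
  then show ?thesis unfolding a_def[symmetric] using assms(1) by (simp add: field_simps)
qed

text \<open>A weighted form of Jensen's inequality. The maximum principle for the product of \<open>v\<close> over the
  \<open>N\<close>-th roots of unity together with the arithmetic-geometric mean inequality gives it for Riemann sums,
  so that zeros of \<open>v\<close> on the circle cause no trouble.\<close>
lemma weighted_jensen:
  fixes k :: "real \<Rightarrow> real"
  assumes v: "v holomorphic_on unit_disc" and v0: "v 0 \<noteq> 0" and r: "0 < r" "r < 1"
    and k: "continuous_on UNIV k" "\<And>t. k t > 0" "\<And>t. k (t + 2*pi) = k t"
  shows "(cmod (v 0))\<^sup>2 * exp (LINT t|circ. ln (k t)) \<le> (LINT t|circ. (cmod (v (of_real r * cis t)))\<^sup>2 * k t)"
proof -
  define F where "F = (\<lambda>t. (cmod (v (of_real r * cis t)))\<^sup>2 * k t)"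
  have cF: "continuous_on UNIV F"
    unfolding F_def using r by (intro continuous_intros continuous_on_circle v k(1)) auto
  have cl: "continuous_on UNIV (\<lambda>t. ln (k t))"
  proof -
    have "k t \<noteq> 0" for t using k(2)[of t] by simp
    then show ?thesis by (intro continuous_intros k(1)) auto
  qed
  have cis2: "cis (t + 2*pi) = cis t" for t by (simp flip: cis_mult)
  have "\<exists>s\<in>{0..2*pi}. N > 0 \<longrightarrow> (cmod (v 0))\<^sup>2 * exp ((\<Sum>j<N. ln (k (s + 2*pi/real N * real j))) / N) \<le>
      (\<Sum>j<N. F (s + 2*pi/real N * real j)) / N" for N
  proof -
    \<comment> \<open>G 0 is v 0 to the power N. A maximum point cis s of |G| on the unit circle
      fixes the rotation s of the nodes at which the product is large enough.\<close>
    define G where "G = (\<lambda>z. \<Prod>j<N. v (of_real r * cis (2*pi/real N * real j) * z))"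
    have G: "G holomorphic_on cball 0 1"
      unfolding G_def
    proof (intro holomorphic_on_prod)
      fix j
      have *: "cmod (of_real r * cis (2*pi/real N * real j) * z) < 1" if "cmod z \<le> 1" for z
      proof -
        have "cmod (of_real r * cis (2*pi/real N * real j) * z) = r * cmod z" using r by (simp add: norm_mult)
        also have "\<dots> \<le> r * 1" using r that by (intro mult_left_mono) auto
        finally show ?thesis using r by simp
      qed
      show "(\<lambda>z. v (of_real r * cis (2*pi/real N * real j) * z)) holomorphic_on cball 0 1"
        by (rule holomorphic_on_compose_gen[OF _ v, of _ "cball 0 1", unfolded o_def])
           (use * in \<open>auto intro!: holomorphic_intros\<close>)
    qed
    have cG: "continuous_on (cball 0 1) G" by (rule holomorphic_on_imp_continuous_on[OF G])
    have "continuous_on (sphere 0 1) (\<lambda>z. cmod (G z))"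
      by (intro continuous_intros continuous_on_subset[OF cG]) auto
    then obtain \<zeta> where \<zeta>: "\<zeta> \<in> sphere 0 1" "\<And>z. z \<in> sphere 0 1 \<Longrightarrow> cmod (G z) \<le> cmod (G \<zeta>)"
      using continuous_attains_sup[of "sphere (0::complex) 1" "\<lambda>z. cmod (G z)"] by auto
    have G0: "cmod (G 0) \<le> cmod (G \<zeta>)"
      by (rule maximum_modulus_frontier[of G "cball 0 1"])
         (use \<zeta>(2) cG G in \<open>auto intro: holomorphic_on_subset\<close>)
    define s where "s = Arg2pi \<zeta>"
    have s: "0 \<le> s" "s \<le> 2*pi" "\<zeta> = cis s"
      using Arg2pi[of \<zeta>] \<zeta>(1) unfolding s_def by (auto simp: cis_conv_exp is_Arg_def)
    define t where "t = (\<lambda>j::nat. s + 2*pi/real N * real j)"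
    have "(cmod (v 0)) ^ N \<le> (\<Prod>j<N. cmod (v (of_real r * cis (t j))))"
      using G0 unfolding G_def s(3) t_def
      by (simp add: prod_norm[symmetric] norm_power mult.assoc cis_mult add.commute)
    then have "((cmod (v 0)) ^ N)\<^sup>2 \<le> (\<Prod>j<N. cmod (v (of_real r * cis (t j))))\<^sup>2"
      by (intro power_mono) auto
    then have P: "((cmod (v 0))\<^sup>2) ^ N \<le> (\<Prod>j<N. (cmod (v (of_real r * cis (t j))))\<^sup>2)"
      by (simp add: prod_power_distrib power_mult[symmetric] mult.commute)
    have "(cmod (v 0))\<^sup>2 * exp ((\<Sum>j<N. ln (k (t j))) / N) \<le> (\<Sum>j<N. F (t j)) / N" if N: "N > 0"
    proof -
      \<comment> \<open>As v 0 is nonzero, the maximum principle itself rules out zeros of v at the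
        chosen nodes, so all logarithms below are genuine.\<close>
      have "(\<Prod>j<N. (cmod (v (of_real r * cis (t j))))\<^sup>2) > 0"
        using P v0 by (meson less_le_trans zero_less_norm_iff zero_less_power)
      then have nz: "(cmod (v (of_real r * cis (t j))))\<^sup>2 > 0" if "j < N" for j
        using that by (metis finite_lessThan lessThan_iff less_irrefl prod_zero zero_le_power2 order_le_less)
      have Fpos: "F (t j) > 0" if "j < N" for j
        unfolding F_def using nz[OF that] k(2)[of "t j"] by (rule mult_pos_pos)
      have aux: "n * a + b \<le> c \<Longrightarrow> n > 0 \<Longrightarrow> a + b / n \<le> c / n" for a b c n :: real
        using divide_right_mono[of "n * a + b" c n] by (simp add: add_divide_distrib)
      have "N * ln ((cmod (v 0))\<^sup>2) = ln (((cmod (v 0))\<^sup>2) ^ N)" using v0 by (simp add: ln_realpow)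
      also have "\<dots> \<le> ln (\<Prod>j<N. (cmod (v (of_real r * cis (t j))))\<^sup>2)"
        using P v0 by (intro ln_mono) auto
      also have "\<dots> = (\<Sum>j<N. ln ((cmod (v (of_real r * cis (t j))))\<^sup>2))"
        by (rule ln_prod) (use nz in auto)
      finally have 1: "N * ln ((cmod (v 0))\<^sup>2) \<le> (\<Sum>j<N. ln ((cmod (v (of_real r * cis (t j))))\<^sup>2))" .
      have "N * ln ((cmod (v 0))\<^sup>2) + (\<Sum>j<N. ln (k (t j))) \<le> (\<Sum>j<N. ln ((cmod (v (of_real r * cis (t j))))\<^sup>2) + ln (k (t j)))"
        using 1 by (simp add: sum.distrib)
      also have "\<dots> = (\<Sum>j<N. ln (F (t j)))"
        unfolding F_def using nz k(2) by (intro sum.cong refl ln_mult_pos[symmetric]) auto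
      finally have "ln ((cmod (v 0))\<^sup>2) + (\<Sum>j<N. ln (k (t j))) / N \<le> (\<Sum>j<N. ln (F (t j))) / N"
        by (rule aux) (use N in simp)
      also have "\<dots> \<le> ln ((\<Sum>j<N. F (t j)) / N)" by (rule sum_ln_le_ln_mean[OF N Fpos])
      finally have "exp (ln ((cmod (v 0))\<^sup>2) + (\<Sum>j<N. ln (k (t j))) / N) \<le> exp (ln ((\<Sum>j<N. F (t j)) / N))" by simp
      moreover have "(\<Sum>j<N. F (t j)) / N > 0" using Fpos N by (intro divide_pos_pos sum_pos) auto
      ultimately show ?thesis using v0 by (simp add: exp_add)
    qed
    then show ?thesis using s unfolding t_def by (intro bexI[of _ s]) auto
  qed
  then obtain s where s: "\<And>N. s N \<in> {0..2*pi}"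
    "\<And>N. N > 0 \<Longrightarrow> (cmod (v 0))\<^sup>2 * exp ((\<Sum>j<N. ln (k (s N + 2*pi/real N * real j))) / N) \<le> (\<Sum>j<N. F (s N + 2*pi/real N * real j)) / N"
    by metis
  have "(\<lambda>N. (\<Sum>j<N. ln (k (s N + 2*pi/real N * real j))) / N) \<longlonglongrightarrow> (LINT t|circ. ln (k t))"
    by (rule riemann_sums_circ[OF cl _ s(1)]) (simp add: k(3))
  then have "(\<lambda>N. (cmod (v 0))\<^sup>2 * exp ((\<Sum>j<N. ln (k (s N + 2*pi/real N * real j))) / N)) \<longlonglongrightarrow> (cmod (v 0))\<^sup>2 * exp (LINT t|circ. ln (k t))"
    by (intro tendsto_intros)
  moreover have "(\<lambda>N. (\<Sum>j<N. F (s N + 2*pi/real N * real j)) / N) \<longlonglongrightarrow> (LINT t|circ. F t)"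
    by (rule riemann_sums_circ[OF cF _ s(1)]) (simp add: F_def k(3) cis2)
  ultimately have "(cmod (v 0))\<^sup>2 * exp (LINT t|circ. ln (k t)) \<le> (LINT t|circ. F t)"
    by (rule LIMSEQ_le) (use s(2) in \<open>auto intro!: exI[of _ 1]\<close>)
  then show ?thesis by (simp add: F_def)
qed

text \<open>If 1 - y lies between 4^-(J+1) and 4^-J, the left side is at most E^(J+1), while y^(4^J)
  >= 1/4 by Bernoulli's inequality. So the single term j = J, multiplied by 4 E, is already enough.
  The induction on J locates that level.\<close>

lemma powr_le_lacunary_sum:
  fixes y E \<epsilon> :: real
  assumes y: "0 \<le> y" "y < 1" and \<epsilon>: "\<epsilon> > 0" and E: "E = 4 powr \<epsilon>" and J: "(1/4) ^ J \<le> 1 - y"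
  shows "(1 - y) powr (- \<epsilon>) \<le> 4 * E * (1 + (\<Sum>j<J. E ^ j * y ^ (4 ^ j)))"
  using J
proof (induction J)
  have E1: "E \<ge> 1" unfolding E using \<epsilon> by (simp add: ge_one_powr_ge_zero)
  case 0
  then have "y = 0" using y by simp
  then show ?case using E1 by simp
next
  have E1: "E \<ge> 1" unfolding E using \<epsilon> by (simp add: ge_one_powr_ge_zero)
  have sn: "(\<Sum>j<K. E ^ j * y ^ (4 ^ j)) \<ge> 0" for K using E1 y by (intro sum_nonneg) auto
  case (Suc J)
  have up: "(1 - y) powr (- \<epsilon>) \<le> E ^ Suc J"
  proof -
    have "(1 - y) powr (- \<epsilon>) \<le> ((1/4) ^ Suc J) powr (- \<epsilon>)"
      using \<epsilon> Suc.prems by (intro powr_mono2') auto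
    also have "((1/4::real) ^ Suc J) powr (- \<epsilon>) = E ^ Suc J"
    proof -
      have "(4::real) powr (- real (Suc J)) = inverse (4 ^ Suc J)"
        unfolding powr_minus by (subst powr_realpow) auto
      then have "(1/4::real) ^ Suc J = 4 powr (- real (Suc J))"
        by (simp only: power_one_over inverse_eq_divide)
      then have "((1/4::real) ^ Suc J) powr (- \<epsilon>) = 4 powr (\<epsilon> * real (Suc J))"
        by (simp add: powr_powr mult.commute del: power_Suc of_nat_Suc)
      also have "\<dots> = E ^ Suc J" unfolding E
        by (simp add: powr_powr[symmetric] powr_realpow del: power_Suc of_nat_Suc)
      finally show ?thesis .
    qed
    finally show ?thesis .
  qed
  show ?case
  proof (cases "(1/4) ^ J \<le> 1 - y")
    case True
    have "(1 - y) powr (- \<epsilon>) \<le> 4 * E * (1 + (\<Sum>j<J. E ^ j * y ^ (4 ^ j)))" by (rule Suc.IH[OF True])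
    also have "\<dots> \<le> 4 * E * (1 + (\<Sum>j<Suc J. E ^ j * y ^ (4 ^ j)))"
      using E1 y by (intro mult_left_mono) auto
    finally show ?thesis .
  next
    case False
    show ?thesis
    \<comment> \<open>Here 4^0 is odd and cannot be halved as below; the summand 1 covers this
      level.\<close>
    proof (cases "J = 0")
      case True
      have "(1 - y) powr (- \<epsilon>) \<le> E * 1" using up True by simp
      also have "\<dots> \<le> (4 * E) * (1 + (\<Sum>j<Suc J. E ^ j * y ^ (4 ^ j)))"
        using E1 sn[of "Suc J"] by (intro mult_mono) auto
      finally show ?thesis .
    next
      case J0: False
      define n :: nat where "n = 2 * 4 ^ (J - 1)"
      have n: "4 ^ J = 2 * n" using J0 unfolding n_def by (cases J) auto
      have y4: "y \<ge> 1 - 1 / (2 * n)"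
      proof -
        have "(1/4::real) ^ J = 1 / (4 ^ J)" by (simp add: power_divide)
        also have "(4::real) ^ J = 2 * n" using n by (metis of_nat_mult of_nat_numeral of_nat_power)
        finally show ?thesis using False by simp
      qed
      have "1/2 \<le> y ^ n"
      proof -
        have n1: "n \<ge> 1" by (simp add: n_def)
        have "1 + n * (- (1 / (2 * n))) \<le> (1 + (- (1 / (2 * n)))) ^ n"
          using n1 by (intro Bernoulli_inequality) (auto simp: field_simps)
        also have "\<dots> \<le> y ^ n" using y4 n1 by (intro power_mono) (auto simp: field_simps)
        finally show ?thesis using n1 by simp
      qed
      then have "(1/2)\<^sup>2 \<le> (y ^ n)\<^sup>2" by (intro power_mono) auto
      then have q: "1/4 \<le> y ^ (4 ^ J)" unfolding n by (simp add: power_mult[symmetric] mult.commute power_divide)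
      have "(1 - y) powr (- \<epsilon>) \<le> 4 * E * (E ^ J * (1/4))" using up by simp
      also have "\<dots> \<le> 4 * E * (E ^ J * y ^ (4 ^ J))" using q E1 by (intro mult_left_mono) auto
      also have "\<dots> \<le> 4 * E * (1 + (\<Sum>j<Suc J. E ^ j * y ^ (4 ^ j)))"
        using E1 sn[of J] by (intro mult_left_mono) auto
      finally show ?thesis .
    qed
  qed
qed

text \<open>Here m is the order of the zero of w at 0 and v is the shifted Taylor series. Jensen's
  inequality at the centre needs a function that does not vanish there.\<close>

lemma factor_out_zero:
  assumes w: "w holomorphic_on unit_disc" "z0 \<in> unit_disc" "w z0 \<noteq> 0"
  obtains v m where "v holomorphic_on unit_disc" "v 0 \<noteq> 0" "\<And>z. z \<in> unit_disc \<Longrightarrow> w z = z ^ m * v z"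
proof -
  define a where "a = taylor_coeff w"
  have sums: "(\<lambda>n. a n * z ^ n) sums w z" if "z \<in> unit_disc" for z
    unfolding a_def by (rule taylor_sums[OF w(1)]) (use that in simp)
  have "\<exists>n. a n \<noteq> 0"
  proof (rule ccontr)
    assume "\<not> ?thesis"
    then have "(\<lambda>n. 0) sums w z0" using sums[OF w(2)] by simp
    then show False using w(3) sums_unique2[OF sums_zero] by metis
  qed
  define m where "m = (LEAST n. a n \<noteq> 0)"
  have am: "a m \<noteq> 0" using \<open>\<exists>n. a n \<noteq> 0\<close> unfolding m_def by (rule LeastI_ex)
  have below: "a n = 0" if "n < m" for n using that not_less_Least unfolding m_def by blast
  define v where "v = (\<lambda>z. \<Sum>n. a (n + m) * z ^ n)"
  have vs: "(\<lambda>n. a (n + m) * z ^ n) sums v z \<and> w z = z ^ m * v z" if z: "z \<in> unit_disc" for z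
  proof (cases "z = 0")
    case True
    have v0: "(\<lambda>n. a (n + m) * z ^ n) sums a m"
      using powser_sums_zero[of "\<lambda>n. a (n + m)"] True by simp
    moreover have "v z = a m" unfolding v_def using sums_unique[OF v0] by simp
    moreover have "w 0 = a 0" using sums[of 0] powser_sums_zero[of a] sums_unique2 by fastforce
    ultimately show ?thesis using True below[of 0] by (cases "m = 0") auto
  next
    case False
    have "(\<lambda>n. a (n + m) * z ^ (n + m)) sums (w z - (\<Sum>n<m. a n * z ^ n))"
      by (rule sums_split_initial_segment[OF sums[OF z]])
    also have "(\<Sum>n<m. a n * z ^ n) = 0" using below by simp
    finally have "(\<lambda>n. a (n + m) * z ^ (n + m) / z ^ m) sums ((w z - 0) / z ^ m)" by (rule sums_divide)
    then have "(\<lambda>n. a (n + m) * z ^ n) sums (w z / z ^ m)" using False by (simp add: power_add)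
    moreover from this have "v z = w z / z ^ m" unfolding v_def by (rule sums_unique[symmetric])
    ultimately show ?thesis using False by simp
  qed
  show ?thesis
  proof (rule that)
    show "v holomorphic_on unit_disc"
      by (rule power_series_holomorphic[where a="\<lambda>n. a (n + m)"]) (use vs in auto)
    show "v 0 \<noteq> 0" using vs[of 0] powser_sums_zero[of "\<lambda>n. a (n + m)"] am sums_unique2 by fastforce
  qed (use vs in blast)
qed

section \<open>From decay of the orbit norms to the logarithmic integral\<close>

context self_map
begin

text \<open>The lacunary majorant involves phi only at the exponents 4^j, exactly where decay is
  assumed. Integrated against |w|^2 it is dominated by a geometric series, so the bound
  \<open>B\<close> depends neither on r nor on the number of terms.\<close>

theorem log_integral_finite_if_decay:
  assumes w: "w holomorphic_on unit_disc" "z0 \<in> unit_disc" "w z0 \<noteq> 0" and w2: "w \<in> H2"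
    and wn: "\<And>j. (\<lambda>z. w z * \<phi> z ^ (4 ^ j)) \<in> H2"
    and dec: "\<And>j. (h2norm (\<lambda>z. w z * \<phi> z ^ (4 ^ j)))\<^sup>2 \<le> C * \<theta> ^ j" and \<theta>: "0 < \<theta>" "\<theta> < 1" "C \<ge> 0"
  shows "log_integral \<phi> < \<infinity>"
proof -
  obtain v m where v: "v holomorphic_on unit_disc" "v 0 \<noteq> 0" "\<And>z. z \<in> unit_disc \<Longrightarrow> w z = z ^ m * v z"
    using factor_out_zero[OF w] by metis
  \<comment> \<open>Chosen so that E is \<open>\<theta>\<close> to the power -1/2: the terms grow
    like E^j and decay like \<open>\<theta> ^ j\<close>, and their product is still geometric with
    ratio below 1.\<close>
  define \<epsilon> where "\<epsilon> = log 4 (1 / \<theta>) / 2"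
  define E where "E = 4 powr \<epsilon>"
  have \<epsilon>: "\<epsilon> > 0" using \<theta> by (simp add: \<epsilon>_def)
  have E1: "E \<ge> 1" unfolding E_def using \<epsilon> by (simp add: ge_one_powr_ge_zero)
  have E\<theta>: "E * \<theta> < 1"
  proof -
    have "4 powr \<epsilon> < 4 powr (log 4 (1 / \<theta>))" using \<theta> \<epsilon> by (intro powr_less_mono) (auto simp: \<epsilon>_def)
    also have "\<dots> = 1 / \<theta>" using \<theta> by (subst powr_log_cancel) auto
    finally show ?thesis using \<theta> by (simp add: E_def field_simps)
  qed
  define B where "B = 4 ^ m * (4 * E * ((h2norm w)\<^sup>2 + C * (1 / (1 - E * \<theta>))))"
  have main: "(LINT t|circ. ln (1 / (1 - cmod (\<phi> (of_real r * cis t))))) \<le> ln 2 + ln (B / (cmod (v 0))\<^sup>2) / \<epsilon>"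
    if r: "1/2 \<le> r" "r < 1" for r
  proof -
    define x where "x = (\<lambda>t. cmod (\<phi> (of_real r * cis t)))"
    define k where "k = (\<lambda>t. (1 - (x t)\<^sup>2) powr (- \<epsilon>))"
    define W where "W = (\<lambda>t. (cmod (w (of_real r * cis t)))\<^sup>2)"
    have r0: "0 \<le> r" "0 < r" using r by auto
    have x: "0 \<le> x t" "x t < 1" for t using norm_circle_less_1[OF r0(1) r(2)] by (auto simp: x_def)
    have x2: "(x t)\<^sup>2 < 1" for t using x[of t] by (simp add: abs_square_less_1)
    have cx: "continuous_on UNIV x"
      unfolding x_def by (intro continuous_intros continuous_on_circle hol r0 r)
    have cW: "continuous_on UNIV W"
      unfolding W_def by (intro continuous_intros continuous_on_circle w r0 r)
    have ck: "continuous_on UNIV k"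
      unfolding k_def using x2 by (intro continuous_intros cx) (auto simp: less_imp_neq)
    have kpos: "k t > 0" for t using x2[of t] by (simp add: k_def)
    \<comment> \<open>One J serves the whole circle because |phi| attains its maximum on the closed
      disk of radius r and that maximum is below 1.\<close>
    obtain J where J: "\<And>t. (1/4) ^ J \<le> 1 - (x t)\<^sup>2"
    proof -
      have "compact ((\<lambda>z. (cmod (\<phi> z))\<^sup>2) ` cball 0 r)"
        using r by (intro compact_continuous_image continuous_intros
             continuous_on_subset[OF holomorphic_on_imp_continuous_on[OF hol]]) auto
      moreover have "(\<lambda>z. (cmod (\<phi> z))\<^sup>2) ` cball 0 r \<noteq> {}" using r0 by auto
      ultimately obtain z1 where z1: "z1 \<in> cball 0 r" "\<And>z. z \<in> cball 0 r \<Longrightarrow> (cmod (\<phi> z))\<^sup>2 \<le> (cmod (\<phi> z1))\<^sup>2"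
        using compact_attains_sup[of "(\<lambda>z. (cmod (\<phi> z))\<^sup>2) ` cball 0 r"] by blast
      have "cmod (\<phi> z1) < 1" using norm_less_1[of z1] z1(1) r by simp
      then have "1 - (cmod (\<phi> z1))\<^sup>2 > 0" by (simp add: abs_square_less_1)
      from real_arch_pow_inv[OF this, of "1/4"] obtain J where "(1/4::real) ^ J < 1 - (cmod (\<phi> z1))\<^sup>2" by auto
      moreover have "(x t)\<^sup>2 \<le> (cmod (\<phi> z1))\<^sup>2" for t
        unfolding x_def using r0 by (intro z1(2)) (simp add: norm_mult)
      ultimately have "\<And>t. (1/4) ^ J \<le> 1 - (x t)\<^sup>2" by (smt (verit))
      then show ?thesis by (rule that)
    qed
    have kle: "k t \<le> 4 * E * (1 + (\<Sum>j<J. E ^ j * ((x t)\<^sup>2) ^ (4 ^ j)))" for t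
      unfolding k_def by (rule powr_le_lacunary_sum[OF _ x2 \<epsilon> E_def J]) simp
    have Wj: "W t * ((x t)\<^sup>2) ^ (4 ^ j) = (cmod (w (of_real r * cis t) * \<phi> (of_real r * cis t) ^ (4 ^ j)))\<^sup>2" for t j
      by (simp add: W_def x_def norm_mult norm_power power_mult_distrib power_mult[symmetric] mult.commute)
    \<comment> \<open>Removing the zero at the centre costs r^(-2m), which is at most 4^m since r >=
      1/2.\<close>
    have vW: "(cmod (v (of_real r * cis t)))\<^sup>2 \<le> 4 ^ m * W t" for t
    proof -
      have "w (of_real r * cis t) = (of_real r * cis t) ^ m * v (of_real r * cis t)"
        using r by (intro v) (simp add: norm_mult)
      then have "W t = (r ^ m)\<^sup>2 * (cmod (v (of_real r * cis t)))\<^sup>2"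
        using r0 by (simp add: W_def norm_mult norm_power power_mult_distrib)
      moreover have "((1/2) ^ m)\<^sup>2 \<le> (r ^ m)\<^sup>2" using r by (intro power_mono) auto
      moreover have "((1/2::real) ^ m)\<^sup>2 = 1 / 4 ^ m" by (simp add: power_mult[symmetric] power_divide mult.commute[of m] power_mult)
      ultimately have "(1 / 4 ^ m) * (cmod (v (of_real r * cis t)))\<^sup>2 \<le> W t"
        by (metis mult_right_mono zero_le_power2)
      then show ?thesis by (simp add: field_simps)
    qed
    have iW: "integrable circ (\<lambda>t. W t * ((x t)\<^sup>2) ^ (4 ^ j))" for j
      by (intro integrable_circ continuous_intros cW cx)
    have "(LINT t|circ. (cmod (v (of_real r * cis t)))\<^sup>2 * k t) \<le>
       (LINT t|circ. 4 ^ m * (4 * E * (W t + (\<Sum>j<J. E ^ j * (W t * ((x t)\<^sup>2) ^ (4 ^ j))))))"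
    proof (intro integral_mono integrable_circ continuous_intros ck cW cx continuous_on_circle v r0 r)
      fix t
      have "(cmod (v (of_real r * cis t)))\<^sup>2 * k t \<le> (4 ^ m * W t) * (4 * E * (1 + (\<Sum>j<J. E ^ j * ((x t)\<^sup>2) ^ (4 ^ j))))"
        using kpos[of t] by (intro mult_mono vW kle) (auto simp: W_def)
      also have "\<dots> = 4 ^ m * (4 * E * (W t + (\<Sum>j<J. E ^ j * (W t * ((x t)\<^sup>2) ^ (4 ^ j)))))"
        by (simp add: algebra_simps sum_distrib_left)
      finally show "(cmod (v (of_real r * cis t)))\<^sup>2 * k t \<le> 4 ^ m * (4 * E * (W t + (\<Sum>j<J. E ^ j * (W t * ((x t)\<^sup>2) ^ (4 ^ j)))))" .
    qed
    also have "\<dots> = 4 ^ m * (4 * E * ((LINT t|circ. W t) + (\<Sum>j<J. E ^ j * (LINT t|circ. W t * ((x t)\<^sup>2) ^ (4 ^ j)))))"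
      using iW integrable_circ[OF cW] by simp
    also have "\<dots> \<le> B"
      unfolding B_def
    proof (intro mult_left_mono add_mono)
      show "(LINT t|circ. W t) \<le> (h2norm w)\<^sup>2"
        unfolding W_def by (intro circle_mean_le_h2norm w2 r0 r)
      have "(\<Sum>j<J. E ^ j * (LINT t|circ. W t * ((x t)\<^sup>2) ^ (4 ^ j))) \<le> (\<Sum>j<J. E ^ j * (C * \<theta> ^ j))"
        unfolding Wj using E1
        by (intro sum_mono mult_left_mono order_trans[OF circle_mean_le_h2norm[OF wn r0(1) r(2)] dec]) auto
      also have "\<dots> = C * (\<Sum>j<J. (E * \<theta>) ^ j)"
        by (simp add: sum_distrib_left power_mult_distrib mult_ac)
      also have "\<dots> \<le> C * (1 / (1 - E * \<theta>))"
      proof (rule mult_left_mono[OF _ \<theta>(3)])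
        have "(\<Sum>j<J. (E * \<theta>) ^ j) \<le> (\<Sum>j. (E * \<theta>) ^ j)"
          using E\<theta> E1 \<theta> by (intro sum_le_suminf summable_geometric) auto
        also have "\<dots> = 1 / (1 - E * \<theta>)" using E\<theta> E1 \<theta> by (intro suminf_geometric) auto
        finally show "(\<Sum>j<J. (E * \<theta>) ^ j) \<le> 1 / (1 - E * \<theta>)" .
      qed
      finally show "(\<Sum>j<J. E ^ j * (LINT t|circ. W t * ((x t)\<^sup>2) ^ (4 ^ j))) \<le> C * (1 / (1 - E * \<theta>))" .
    qed (use E1 in auto)
    finally have le: "(LINT t|circ. (cmod (v (of_real r * cis t)))\<^sup>2 * k t) \<le> B" .
    have "(cmod (v 0))\<^sup>2 * exp (LINT t|circ. ln (k t)) \<le> (LINT t|circ. (cmod (v (of_real r * cis t)))\<^sup>2 * k t)"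
      by (rule weighted_jensen[OF v(1,2) r0(2) r(2) ck kpos]) (simp add: k_def x_def flip: cis_mult)
    with le have "(cmod (v 0))\<^sup>2 * exp (LINT t|circ. ln (k t)) \<le> B" by simp
    then have "exp (LINT t|circ. ln (k t)) \<le> B / (cmod (v 0))\<^sup>2" using v(2) by (simp add: field_simps)
    then have L: "(LINT t|circ. ln (k t)) \<le> ln (B / (cmod (v 0))\<^sup>2)"
      by (metis exp_gt_zero exp_ln exp_le_cancel_iff less_le_trans)
    have lnk: "ln (k t) = \<epsilon> * ln (1 / (1 - (x t)\<^sup>2))" for t
      using x2[of t] by (simp add: k_def ln_powr ln_div)
    have cl: "continuous_on UNIV (\<lambda>t. ln (1 / (1 - (x t)\<^sup>2)))" "continuous_on UNIV (\<lambda>t. ln (1 / (1 - x t)))"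
    proof -
      have ne: "1 - (x t)\<^sup>2 \<noteq> 0" "1 - x t \<noteq> 0" for t using x2[of t] x(2)[of t] by auto
      show "continuous_on UNIV (\<lambda>t. ln (1 / (1 - (x t)\<^sup>2)))" "continuous_on UNIV (\<lambda>t. ln (1 / (1 - x t)))"
        by (intro continuous_intros cx ballI; use ne in simp)+
    qed
    have "(LINT t|circ. ln (k t)) = \<epsilon> * (LINT t|circ. ln (1 / (1 - (x t)\<^sup>2)))" unfolding lnk by simp
    with L have L2: "(LINT t|circ. ln (1 / (1 - (x t)\<^sup>2))) \<le> ln (B / (cmod (v 0))\<^sup>2) / \<epsilon>"
      using \<epsilon> by (simp add: field_simps)
    have "(LINT t|circ. ln (1 / (1 - x t))) \<le> (LINT t|circ. ln 2 + ln (1 / (1 - (x t)\<^sup>2)))"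
    proof (intro integral_mono integrable_circ continuous_on_add continuous_on_const cl)
      fix t
      \<comment> \<open>Returns from the defect in |phi|^2 to the one in |phi|; the factor 2 becomes
        the additive ln 2.\<close>
      have "1 - (x t)\<^sup>2 \<le> 2 * (1 - x t)"
        using x[of t] zero_le_power2[of "1 - x t"] by (simp add: power2_diff)
      then have "ln (1 - (x t)\<^sup>2) \<le> ln (2 * (1 - x t))" using x2[of t] by (intro ln_mono) auto
      also have "\<dots> = ln 2 + ln (1 - x t)" using x[of t] by (intro ln_mult_pos) auto
      finally show "ln (1 / (1 - x t)) \<le> ln 2 + ln (1 / (1 - (x t)\<^sup>2))"
        using x2[of t] x[of t] by (simp add: ln_div)
    qed
    also have "\<dots> = ln 2 + (LINT t|circ. ln (1 / (1 - (x t)\<^sup>2)))"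
      using integrable_circ[OF cl(1)] by simp
    finally show ?thesis using L2 by (simp add: x_def)
  qed
  show ?thesis by (rule log_integral_finite_if_circle_means[OF main])
qed

lemma h2norm_mult_power_antimono:
  assumes w: "w holomorphic_on unit_disc" and H: "\<And>n. (\<lambda>z. w z * \<phi> z ^ n) \<in> H2" and "n \<le> k"
  shows "(h2norm (\<lambda>z. w z * \<phi> z ^ k))\<^sup>2 \<le> (h2norm (\<lambda>z. w z * \<phi> z ^ n))\<^sup>2"
proof (rule H2_if_circle_means_bounded(2))
  show "(\<lambda>z. w z * \<phi> z ^ k) holomorphic_on unit_disc" using H[of k] by (simp add: H2_def)
  fix r :: real assume r: "0 \<le> r" "r < 1"
  have "(LINT t|circ. (cmod (w (of_real r * cis t) * \<phi> (of_real r * cis t) ^ k))\<^sup>2) \<le>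
        (LINT t|circ. (cmod (w (of_real r * cis t) * \<phi> (of_real r * cis t) ^ n))\<^sup>2)"
    using \<open>n \<le> k\<close>
    by (intro integral_mono integrable_circ continuous_intros continuous_on_circle w hol r power_mono)
       (auto simp: norm_mult norm_power less_imp_le[OF norm_circle_less_1[OF r]] intro!: mult_left_mono power_decreasing)
  also have "\<dots> \<le> (h2norm (\<lambda>z. w z * \<phi> z ^ n))\<^sup>2"
    by (rule circle_mean_le_h2norm[OF H r])
  finally show "(LINT t|circ. (cmod (w (of_real r * cis t) * \<phi> (of_real r * cis t) ^ k))\<^sup>2) \<le> (h2norm (\<lambda>z. w z * \<phi> z ^ n))\<^sup>2" .
qed

text \<open>As |phi| < 1, the norms decrease in n, so the one at n = 4^j is at most the average of
  the 4^j norms before it.\<close>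

lemma log_integral_finite_if_sum_decay:
  assumes w: "w holomorphic_on unit_disc" "z0 \<in> unit_disc" "w z0 \<noteq> 0"
    and H: "\<And>n. (\<lambda>z. w z * \<phi> z ^ n) \<in> H2"
    and dec: "\<And>j. (\<Sum>n<4^j. (h2norm (\<lambda>z. w z * \<phi> z ^ n))\<^sup>2) \<le> C * 4 ^ j * \<theta> ^ j" and \<theta>: "0 < \<theta>" "\<theta> < 1" "C \<ge> 0"
  shows "log_integral \<phi> < \<infinity>"
proof (rule log_integral_finite_if_decay[OF w _ H _ \<theta>])
  show "w \<in> H2" using H[of 0] by simp
  fix j :: nat
  have "4 ^ j * (h2norm (\<lambda>z. w z * \<phi> z ^ (4 ^ j)))\<^sup>2 = (\<Sum>n<(4::nat)^j. (h2norm (\<lambda>z. w z * \<phi> z ^ (4 ^ j)))\<^sup>2)" by simp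
  also have "\<dots> \<le> (\<Sum>n<(4::nat)^j. (h2norm (\<lambda>z. w z * \<phi> z ^ n))\<^sup>2)"
    by (intro sum_mono h2norm_mult_power_antimono[OF w(1) H]) auto
  also have "\<dots> \<le> 4 ^ j * (C * \<theta> ^ j)" using dec[of j] by (simp add: mult_ac)
  finally show "(h2norm (\<lambda>z. w z * \<phi> z ^ (4 ^ j)))\<^sup>2 \<le> C * \<theta> ^ j" by simp
qed

end

theorem theorem4p6:
  fixes \<phi> :: "complex \<Rightarrow> complex"
  assumes "\<phi> holomorphic_on unit_disc" and "\<phi> ` unit_disc \<subseteq> unit_disc"
  shows "((\<exists>w\<in>H2. (\<exists>z\<in>unit_disc. w z \<noteq> 0) \<and> hilbert_schmidt (wcomp w \<phi>))
           \<longleftrightarrow> (\<exists>w\<in>Hinf. (\<exists>z\<in>unit_disc. w z \<noteq> 0) \<and> (\<forall>p>0. schatten p (wcomp w \<phi>))))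
       \<and> ((\<exists>w\<in>Hinf. (\<exists>z\<in>unit_disc. w z \<noteq> 0) \<and> (\<forall>p>0. schatten p (wcomp w \<phi>)))
           \<longleftrightarrow> (\<exists>p>0. \<exists>w\<in>Hinf. (\<exists>z\<in>unit_disc. w z \<noteq> 0) \<and> schatten p (wcomp w \<phi>)))
       \<and> ((\<exists>p>0. \<exists>w\<in>Hinf. (\<exists>z\<in>unit_disc. w z \<noteq> 0) \<and> schatten p (wcomp w \<phi>))
           \<longleftrightarrow> log_integral \<phi> < \<infinity>)"
proof -
  interpret self_map \<phi> by standard (use assms in auto)
  let ?P1 = "\<exists>w\<in>H2. (\<exists>z\<in>unit_disc. w z \<noteq> 0) \<and> hilbert_schmidt (wcomp w \<phi>)"
  let ?P2 = "\<exists>w\<in>Hinf. (\<exists>z\<in>unit_disc. w z \<noteq> 0) \<and> (\<forall>p>0. schatten p (wcomp w \<phi>))"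
  let ?P3 = "\<exists>p>0. \<exists>w\<in>Hinf. (\<exists>z\<in>unit_disc. w z \<noteq> 0) \<and> schatten p (wcomp w \<phi>)"
  let ?P4 = "log_integral \<phi> < \<infinity>"
  have wn: "(\<lambda>z. w z * \<phi> z ^ n) \<in> H2" "wcomp w \<phi> (\<lambda>z. z ^ n) = (\<lambda>z. w z * \<phi> z ^ n)"
    if "H2_bounded_op (wcomp w \<phi>)" for w n
  proof -
    show "wcomp w \<phi> (\<lambda>z. z ^ n) = (\<lambda>z. w z * \<phi> z ^ n)" by (simp add: wcomp_def)
    moreover have "wcomp w \<phi> (\<lambda>z. z ^ n) \<in> H2"
      using that monomial_H2[of n] unfolding H2_bounded_op_def H2_linear_op_def by blast
    ultimately show "(\<lambda>z. w z * \<phi> z ^ n) \<in> H2" by simp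
  qed
  have 14: ?P4 if P1: ?P1
  proof -
    obtain w z0 where w: "w \<in> H2" "z0 \<in> unit_disc" "w z0 \<noteq> 0" "hilbert_schmidt (wcomp w \<phi>)" using P1 by blast
    have b: "H2_bounded_op (wcomp w \<phi>)" and sm: "summable (\<lambda>n. (h2norm (\<lambda>z. w z * \<phi> z ^ n))\<^sup>2)"
      using w(4) by (auto simp: hilbert_schmidt_def wcomp_def)
    define C where "C = (\<Sum>n. (h2norm (\<lambda>z. w z * \<phi> z ^ n))\<^sup>2)"
    \<comment> \<open>Square summability bounds all partial sums by one constant, which is the
      required decay with ratio 1/4.\<close>
    have "(\<Sum>n<4^j. (h2norm (\<lambda>z. w z * \<phi> z ^ n))\<^sup>2) \<le> C * 4 ^ j * (1/4) ^ j" for j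
    proof -
      have "(\<Sum>n<4^j. (h2norm (\<lambda>z. w z * \<phi> z ^ n))\<^sup>2) \<le> C"
        unfolding C_def by (rule sum_le_suminf[OF sm]) auto
      then show ?thesis by (simp add: power_divide)
    qed
    moreover have "C \<ge> 0" unfolding C_def by (intro suminf_nonneg sm) auto
    moreover have "w holomorphic_on unit_disc" using w(1) by (simp add: H2_def)
    ultimately show ?thesis
      by (intro log_integral_finite_if_sum_decay[OF _ w(2,3) wn(1)[OF b], where C=C and \<theta>="1/4"]) auto
  qed
  have 34: ?P4 if P3: ?P3
  proof -
    obtain p w z0 where w: "p > 0" "w \<in> Hinf" "z0 \<in> unit_disc" "w z0 \<noteq> 0" "schatten p (wcomp w \<phi>)" using P3 by blast
    have b: "H2_bounded_op (wcomp w \<phi>)" using w(5) by (simp add: schatten_def)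
    have hw: "w holomorphic_on unit_disc" using w(2) by (simp add: Hinf_def)
    show ?thesis
    proof (rule schatten_orbit_decay[OF w(1,5)])
      fix C \<theta> :: real
      assume \<theta>: "0 < \<theta>" "\<theta> < 1" "0 \<le> C"
        and dec: "\<And>j. (\<Sum>n<4^j. (h2norm (wcomp w \<phi> (\<lambda>z. z ^ n)))\<^sup>2) \<le> C * 4 ^ j * \<theta> ^ j"
      show ?thesis
        by (rule log_integral_finite_if_sum_decay[OF hw w(3,4) wn(1)[OF b] dec[unfolded wn(2)[OF b]] \<theta>])
    qed
  qed
  \<comment> \<open>The same bounded weight witnesses both assertions, since it also belongs to
    \<open>H2\<close>.\<close>
  have 4: "?P1 \<and> ?P2" if P4: ?P4
  proof (rule schatten_if_log_integral_finite[OF P4])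
    fix w assume w: "w \<in> Hinf" "w \<in> H2" "w 0 \<noteq> 0" "hilbert_schmidt (wcomp w \<phi>)"
      "\<And>p. p > 0 \<Longrightarrow> schatten p (wcomp w \<phi>)"
    have "\<exists>z\<in>unit_disc. w z \<noteq> 0" by (rule bexI[of _ 0]) (use w(3) in auto)
    then show "?P1 \<and> ?P2" using w by blast
  qed
  have 23: ?P3 if ?P2
    using that zero_less_one by blast
  show ?thesis using 14 34 4 23 by blast
qed

end
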